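(* Let $R$ be an arithmetical ring and let $n\geq 3$ be an integer. Then every matrix $\sigma(x)\in \mathrm{SL}_n(R[x])$ is congruent to $\sigma(0)$ modulo $E_n(R[x])$, i.e. there is $E\in E_n(R[x])$ such that $\sigma(x)\cdot E=\sigma(0)$.
   Context: All rings are commutative with unity. A valuation ring is a commutative ring $V$ whose principal ideals are totally ordered by inclusion, i.e. for any $a,b\in V$ either $a\mid b$ or $b\mid a$ (zero divisors are allowed; $V$ need not be a domain). A commutative ring $R$ is arithmetical if the localization $R_m$ is a valuation ring (in this sense) for every maximal ideal $m$ of $R$. For a commutative ring $S$, $\mathrm{SL}_n(S)$ is the group of $n\times n$ matrices over $S$ of determinant $1$, and $E_n(S)$ is the subgroup generated by the elementary matrices $I_n+a\,\mathbf{e}_{ij}$ with $a\in S$, $i\neq j$, where $\mathbf{e}_{ij}$ is the matrix whose only nonzero entry is $1$ at position $(i,j)$. For $\sigma(x)\in \mathrm{SL}_n(R[x])$, $\sigma(0)\in \mathrm{SL}_n(R)$ is obtained by substituting $x=0$ in every entry; it is regarded as a constant matrix in $\mathrm{SL}_n(R[x])$. *)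

theory Defs
  imports
    "Jordan_Normal_Form.Determinant"
    "HOL-Algebra.Generated_Groups"
    "HOL-Algebra.Algebraic_Closure_Type"
begin

section \<open>Localizations and arithmetical rings\<close>

text \<open>The factor \<open>u\<close> is needed for transitivity, as \<open>S\<close> may contain zero divisors.\<close>

definition fraction_rel :: "('a, 'b) ring_scheme \<Rightarrow> 'a set \<Rightarrow> (('a \<times> 'a) \<times> ('a \<times> 'a)) set" where
  "fraction_rel R S = {((a, s), (b, t)).
     a \<in> carrier R \<and> s \<in> S \<and> b \<in> carrier R \<and> t \<in> S \<and>
     (\<exists>u\<in>S. u \<otimes>\<^bsub>R\<^esub> (t \<otimes>\<^bsub>R\<^esub> a) = u \<otimes>\<^bsub>R\<^esub> (s \<otimes>\<^bsub>R\<^esub> b))}"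

definition fraction :: "('a, 'b) ring_scheme \<Rightarrow> 'a set \<Rightarrow> 'a \<Rightarrow> 'a \<Rightarrow> ('a \<times> 'a) set" where
  "fraction R S a s = fraction_rel R S `` {(a, s)}"

text \<open>The unions below run over all representatives of the two classes; by
  \<open>localization_mult\<close> and \<open>localization_add\<close> they are unions of a single class.\<close>

definition localization :: "('a, 'b) ring_scheme \<Rightarrow> 'a set \<Rightarrow> ('a \<times> 'a) set ring" where
  "localization R S = \<lparr>
     carrier = (carrier R \<times> S) // fraction_rel R S,
     mult = (\<lambda>x y. \<Union>(a, s)\<in>x. \<Union>(b, t)\<in>y. fraction R S (a \<otimes>\<^bsub>R\<^esub> b) (s \<otimes>\<^bsub>R\<^esub> t)),
     one = fraction R S \<one>\<^bsub>R\<^esub> \<one>\<^bsub>R\<^esub>,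
     zero = fraction R S \<zero>\<^bsub>R\<^esub> \<one>\<^bsub>R\<^esub>,
     add = (\<lambda>x y. \<Union>(a, s)\<in>x. \<Union>(b, t)\<in>y.
              fraction R S ((t \<otimes>\<^bsub>R\<^esub> a) \<oplus>\<^bsub>R\<^esub> (s \<otimes>\<^bsub>R\<^esub> b)) (s \<otimes>\<^bsub>R\<^esub> t))\<rparr>"

locale valuation_ring = cring V for V (structure) +
  assumes divides_total: "a \<in> carrier V \<Longrightarrow> b \<in> carrier V \<Longrightarrow> a divides b \<or> b divides a"

locale arithmetical_ring = cring R for R (structure) +
  assumes valuation_ring_localization:
    "maximalideal m R \<Longrightarrow> valuation_ring (localization R (carrier R - m))"

locale cring_fractions = cring R for R (structure) +
  fixes S
  assumes S_submonoid: "submonoid S R"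
begin

lemma S_carrier: "s \<in> S \<Longrightarrow> s \<in> carrier R"
  using submonoid.subset[OF S_submonoid] by blast

lemma S_mult: "s \<in> S \<Longrightarrow> t \<in> S \<Longrightarrow> s \<otimes> t \<in> S"
  using submonoid.m_closed[OF S_submonoid] .

lemma S_one: "\<one> \<in> S"
  using submonoid.one_closed[OF S_submonoid] .

lemma fraction_relI:
  assumes "a \<in> carrier R" "s \<in> S" "b \<in> carrier R" "t \<in> S" "u \<in> S"
    and "u \<otimes> (t \<otimes> a) = u \<otimes> (s \<otimes> b)"
  shows "((a, s), (b, t)) \<in> fraction_rel R S"
  using assms unfolding fraction_rel_def by blast

lemma fraction_relE:
  assumes "((a, s), (b, t)) \<in> fraction_rel R S"
  obtains u where "a \<in> carrier R" "s \<in> S" "b \<in> carrier R" "t \<in> S" "u \<in> S"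
    "u \<otimes> (t \<otimes> a) = u \<otimes> (s \<otimes> b)"
  using assms unfolding fraction_rel_def by blast

lemma equiv_fraction_rel: "equiv (carrier R \<times> S) (fraction_rel R S)"
proof (rule equivI)
  show "fraction_rel R S \<subseteq> (carrier R \<times> S) \<times> (carrier R \<times> S)"
    unfolding fraction_rel_def by auto
  show "refl_on (carrier R \<times> S) (fraction_rel R S)"
    using S_one by (auto simp: refl_on_def fraction_rel_def)
  show "sym (fraction_rel R S)"
    unfolding sym_def fraction_rel_def by (auto; metis)
  show "trans (fraction_rel R S)"
  proof (rule transI, clarify)
    fix a s b t c w
    assume 1: "((a, s), (b, t)) \<in> fraction_rel R S" and 2: "((b, t), (c, w)) \<in> fraction_rel R S"
    from 1 obtain u where u: "a \<in> carrier R" "s \<in> S" "b \<in> carrier R" "t \<in> S" "u \<in> S"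
      "u \<otimes> (t \<otimes> a) = u \<otimes> (s \<otimes> b)" by (rule fraction_relE)
    from 2 obtain v where v: "c \<in> carrier R" "w \<in> S" "v \<in> S"
      "v \<otimes> (w \<otimes> b) = v \<otimes> (t \<otimes> c)" by (rule fraction_relE)
    note c = u(1,3) v(1) u(2,4,5)[THEN S_carrier] v(2,3)[THEN S_carrier]
    have "(u \<otimes> v \<otimes> t) \<otimes> (w \<otimes> a) = (v \<otimes> w) \<otimes> (u \<otimes> (t \<otimes> a))"
      using c by (simp add: m_ac)
    also have "\<dots> = (v \<otimes> w) \<otimes> (u \<otimes> (s \<otimes> b))" by (simp only: u(6))
    also have "\<dots> = (u \<otimes> s) \<otimes> (v \<otimes> (w \<otimes> b))" using c by (simp add: m_ac)
    also have "\<dots> = (u \<otimes> s) \<otimes> (v \<otimes> (t \<otimes> c))" by (simp only: v(4))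
    also have "\<dots> = (u \<otimes> v \<otimes> t) \<otimes> (s \<otimes> c)" using c by (simp add: m_ac)
    finally show "((a, s), (c, w)) \<in> fraction_rel R S"
      using u v by (intro fraction_relI[where u = "u \<otimes> v \<otimes> t"] S_mult)
  qed
qed

lemma fraction_eqI:
  assumes "a \<in> carrier R" "s \<in> S" "b \<in> carrier R" "t \<in> S" "u \<in> S"
    and "u \<otimes> (t \<otimes> a) = u \<otimes> (s \<otimes> b)"
  shows "fraction R S a s = fraction R S b t"
  unfolding fraction_def using equiv_class_eq[OF equiv_fraction_rel fraction_relI[OF assms]] .

lemma fraction_in_carrier:
  "a \<in> carrier R \<Longrightarrow> s \<in> S \<Longrightarrow> fraction R S a s \<in> carrier (localization R S)"
  unfolding localization_def fraction_def by (auto intro: quotientI)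

lemma localizationE:
  assumes "x \<in> carrier (localization R S)"
  obtains a s where "a \<in> carrier R" "s \<in> S" "x = fraction R S a s"
  using assms unfolding localization_def fraction_def by (auto elim!: quotientE)

lemma fraction_self: "a \<in> carrier R \<Longrightarrow> s \<in> S \<Longrightarrow> (a, s) \<in> fraction R S a s"
  unfolding fraction_def using equiv_class_self[OF equiv_fraction_rel] by blast

lemma fraction_UN:
  assumes "a \<in> carrier R" "s \<in> S" "b \<in> carrier R" "t \<in> S"
    and "\<And>a' s' b' t'. ((a, s), (a', s')) \<in> fraction_rel R S \<Longrightarrow>
           ((b, t), (b', t')) \<in> fraction_rel R S \<Longrightarrow> f a' s' b' t' = f a s b t"
  shows "(\<Union>(a, s)\<in>fraction R S a s. \<Union>(b, t)\<in>fraction R S b t. f a s b t) = f a s b t"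
proof -
  have ne: "(a, s) \<in> fraction R S a s" "(b, t) \<in> fraction R S b t" using assms fraction_self by auto
  have eq: "f a' s' b' t' = f a s b t"
    if "(a', s') \<in> fraction R S a s" "(b', t') \<in> fraction R S b t" for a' s' b' t'
    using that assms(5) unfolding fraction_def by blast
  show ?thesis using ne eq by fast
qed

lemma localization_mult:
  assumes "a \<in> carrier R" "s \<in> S" "b \<in> carrier R" "t \<in> S"
  shows "fraction R S a s \<otimes>\<^bsub>localization R S\<^esub> fraction R S b t = fraction R S (a \<otimes> b) (s \<otimes> t)"
  unfolding localization_def monoid.simps
proof (rule fraction_UN[OF assms])
  fix a' s' b' t'
  assume 1: "((a, s), (a', s')) \<in> fraction_rel R S" and 2: "((b, t), (b', t')) \<in> fraction_rel R S"
  from 1 obtain u where u: "a' \<in> carrier R" "s' \<in> S" "u \<in> S"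
    "u \<otimes> (s' \<otimes> a) = u \<otimes> (s \<otimes> a')" by (rule fraction_relE)
  from 2 obtain v where v: "b' \<in> carrier R" "t' \<in> S" "v \<in> S"
    "v \<otimes> (t' \<otimes> b) = v \<otimes> (t \<otimes> b')" by (rule fraction_relE)
  note c = assms(1,3) u(1) v(1) assms(2,4)[THEN S_carrier] u(2,3)[THEN S_carrier] v(2,3)[THEN S_carrier]
  have "(u \<otimes> v) \<otimes> ((s \<otimes> t) \<otimes> (a' \<otimes> b')) = (u \<otimes> (s \<otimes> a')) \<otimes> (v \<otimes> (t \<otimes> b'))"
    using c by (simp add: m_ac)
  also have "\<dots> = (u \<otimes> (s' \<otimes> a)) \<otimes> (v \<otimes> (t' \<otimes> b))" by (simp only: u(4) v(4))
  also have "\<dots> = (u \<otimes> v) \<otimes> ((s' \<otimes> t') \<otimes> (a \<otimes> b))" using c by (simp add: m_ac)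
  finally show "fraction R S (a' \<otimes> b') (s' \<otimes> t') = fraction R S (a \<otimes> b) (s \<otimes> t)"
    using assms u v by (intro fraction_eqI[where u = "u \<otimes> v"] S_mult m_closed)
qed

lemma localization_add:
  assumes "a \<in> carrier R" "s \<in> S" "b \<in> carrier R" "t \<in> S"
  shows "fraction R S a s \<oplus>\<^bsub>localization R S\<^esub> fraction R S b t
           = fraction R S ((t \<otimes> a) \<oplus> (s \<otimes> b)) (s \<otimes> t)"
  unfolding localization_def ring.simps
proof (rule fraction_UN[OF assms])
  fix a' s' b' t'
  assume 1: "((a, s), (a', s')) \<in> fraction_rel R S" and 2: "((b, t), (b', t')) \<in> fraction_rel R S"
  from 1 obtain u where u: "a' \<in> carrier R" "s' \<in> S" "u \<in> S"
    "u \<otimes> (s' \<otimes> a) = u \<otimes> (s \<otimes> a')" by (rule fraction_relE)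
  from 2 obtain v where v: "b' \<in> carrier R" "t' \<in> S" "v \<in> S"
    "v \<otimes> (t' \<otimes> b) = v \<otimes> (t \<otimes> b')" by (rule fraction_relE)
  note c = assms(1,3) u(1) v(1) assms(2,4)[THEN S_carrier] u(2,3)[THEN S_carrier] v(2,3)[THEN S_carrier]
  have "(u \<otimes> v) \<otimes> ((s \<otimes> t) \<otimes> ((t' \<otimes> a') \<oplus> (s' \<otimes> b')))
      = (v \<otimes> t \<otimes> t') \<otimes> (u \<otimes> (s \<otimes> a')) \<oplus> (u \<otimes> s \<otimes> s') \<otimes> (v \<otimes> (t \<otimes> b'))"
    using c by (simp add: m_ac r_distr)
  also have "\<dots> = (v \<otimes> t \<otimes> t') \<otimes> (u \<otimes> (s' \<otimes> a)) \<oplus> (u \<otimes> s \<otimes> s') \<otimes> (v \<otimes> (t' \<otimes> b))"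
    by (simp only: u(4) v(4))
  also have "\<dots> = (u \<otimes> v) \<otimes> ((s' \<otimes> t') \<otimes> ((t \<otimes> a) \<oplus> (s \<otimes> b)))"
    using c by (simp add: m_ac r_distr)
  finally show "fraction R S ((t' \<otimes> a') \<oplus> (s' \<otimes> b')) (s' \<otimes> t')
      = fraction R S ((t \<otimes> a) \<oplus> (s \<otimes> b)) (s \<otimes> t)"
    using assms u v S_carrier
    by (intro fraction_eqI[where u = "u \<otimes> v"] S_mult m_closed a_closed) auto
qed

lemma localization_one: "\<one>\<^bsub>localization R S\<^esub> = fraction R S \<one> \<one>"
  and localization_zero: "\<zero>\<^bsub>localization R S\<^esub> = fraction R S \<zero> \<one>"
  by (simp_all add: localization_def)

lemma cring_localization: "cring (localization R S)"
proof (rule cringI)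
  note [simp] = S_carrier S_mult S_one fraction_in_carrier localization_mult localization_add
    localization_one localization_zero
  have E: "fraction R S a s = fraction R S b t"
    if "t \<otimes> a = s \<otimes> b" "a \<in> carrier R" "s \<in> S" "b \<in> carrier R" "t \<in> S" for a s b t
    using that by (intro fraction_eqI[where u = \<one>]) auto
  show "abelian_group (localization R S)"
  proof (rule abelian_groupI)
    fix x assume x: "x \<in> carrier (localization R S)"
    obtain a s where a: "a \<in> carrier R" "s \<in> S" "x = fraction R S a s" using x by (rule localizationE)
    show "\<exists>y\<in>carrier (localization R S). y \<oplus>\<^bsub>localization R S\<^esub> x = \<zero>\<^bsub>localization R S\<^esub>"
    proof
      have "fraction R S \<zero> (s \<otimes> s) = fraction R S \<zero> \<one>" using a by (intro E) auto
      then show "fraction R S (\<ominus> a) s \<oplus>\<^bsub>localization R S\<^esub> x = \<zero>\<^bsub>localization R S\<^esub>"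
        using a by (simp add: r_minus l_neg)
      show "fraction R S (\<ominus> a) s \<in> carrier (localization R S)" using a by simp
    qed
    show "\<zero>\<^bsub>localization R S\<^esub> \<oplus>\<^bsub>localization R S\<^esub> x = x" using a by simp
    fix y assume y: "y \<in> carrier (localization R S)"
    obtain b t where b: "b \<in> carrier R" "t \<in> S" "y = fraction R S b t" using y by (rule localizationE)
    show "x \<oplus>\<^bsub>localization R S\<^esub> y \<in> carrier (localization R S)" using a b by simp
    show "x \<oplus>\<^bsub>localization R S\<^esub> y = y \<oplus>\<^bsub>localization R S\<^esub> x"
      using a b by (simp add: a_comm m_comm)
    fix z assume z: "z \<in> carrier (localization R S)"
    obtain c w where c: "c \<in> carrier R" "w \<in> S" "z = fraction R S c w" using z by (rule localizationE)
    show "x \<oplus>\<^bsub>localization R S\<^esub> y \<oplus>\<^bsub>localization R S\<^esub> z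
        = x \<oplus>\<^bsub>localization R S\<^esub> (y \<oplus>\<^bsub>localization R S\<^esub> z)"
      using a b c by (simp add: r_distr m_ac a_ac)
  qed simp
  show "comm_monoid (localization R S)"
  proof (rule comm_monoidI)
    fix x assume x: "x \<in> carrier (localization R S)"
    obtain a s where a: "a \<in> carrier R" "s \<in> S" "x = fraction R S a s" using x by (rule localizationE)
    show "\<one>\<^bsub>localization R S\<^esub> \<otimes>\<^bsub>localization R S\<^esub> x = x" using a by simp
    fix y assume y: "y \<in> carrier (localization R S)"
    obtain b t where b: "b \<in> carrier R" "t \<in> S" "y = fraction R S b t" using y by (rule localizationE)
    show "x \<otimes>\<^bsub>localization R S\<^esub> y \<in> carrier (localization R S)" using a b by simp
    show "x \<otimes>\<^bsub>localization R S\<^esub> y = y \<otimes>\<^bsub>localization R S\<^esub> x"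
      using a b by (simp add: m_comm)
    fix z assume z: "z \<in> carrier (localization R S)"
    obtain c w where c: "c \<in> carrier R" "w \<in> S" "z = fraction R S c w" using z by (rule localizationE)
    show "x \<otimes>\<^bsub>localization R S\<^esub> y \<otimes>\<^bsub>localization R S\<^esub> z
        = x \<otimes>\<^bsub>localization R S\<^esub> (y \<otimes>\<^bsub>localization R S\<^esub> z)"
      using a b c by (simp add: m_ac)
  qed simp
  fix x y z
  assume x: "x \<in> carrier (localization R S)" and y: "y \<in> carrier (localization R S)"
    and z: "z \<in> carrier (localization R S)"
  obtain a s where a: "a \<in> carrier R" "s \<in> S" "x = fraction R S a s" using x by (rule localizationE)
  obtain b t where b: "b \<in> carrier R" "t \<in> S" "y = fraction R S b t" using y by (rule localizationE)
  obtain c w where c: "c \<in> carrier R" "w \<in> S" "z = fraction R S c w" using z by (rule localizationE)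
  show "(x \<oplus>\<^bsub>localization R S\<^esub> y) \<otimes>\<^bsub>localization R S\<^esub> z
      = x \<otimes>\<^bsub>localization R S\<^esub> z \<oplus>\<^bsub>localization R S\<^esub> y \<otimes>\<^bsub>localization R S\<^esub> z"
    using a b c by (simp, intro E) (auto simp: r_distr l_distr m_ac)
qed

end

lemma (in cring) cring_localization_maximalideal:
  assumes "maximalideal m R"
  shows "cring (localization R (carrier R - m))"
proof -
  interpret primeideal m R using maximalideal_prime[OF assms] .
  have "submonoid (carrier R - m) R"
    using I_prime I_notcarr one_imp_carrier by unfold_locales auto
  then show ?thesis
    by (intro cring_fractions.cring_localization cring_fractions.intro
        cring_fractions_axioms.intro is_cring)
qed


section \<open>Special linear and elementary groups\<close>

definition SL :: "nat \<Rightarrow> 'a :: comm_ring_1 mat monoid" where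
  "SL n = \<lparr>carrier = {A \<in> carrier_mat n n. det A = 1}, mult = (*), one = 1\<^sub>m n\<rparr>"

text \<open>\<open>addrow_mat n a i j\<close> is the matrix \<open>I + a e_ij\<close> of size \<open>n\<close>.\<close>

definition elementary_group :: "nat \<Rightarrow> 'a :: comm_ring_1 mat set" where
  "elementary_group n = generate (SL n) {addrow_mat n a i j | a i j. i < n \<and> j < n \<and> i \<noteq> j}"

lemma group_SL: "group (SL n :: 'a :: comm_ring_1 mat monoid)"
proof (rule groupI)
  fix A :: "'a mat" assume "A \<in> carrier (SL n)"
  then have A: "A \<in> carrier_mat n n" "det A = 1" by (auto simp: SL_def)
  have "det (adj_mat A * A) = 1"
    using adj_mat(3)[OF A(1)] A(2) by simp
  then have "det (adj_mat A) = 1"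
    using det_mult[OF adj_mat(1)[OF A(1)] A(1)] A(2) by simp
  then show "\<exists>B\<in>carrier (SL n). B \<otimes>\<^bsub>SL n\<^esub> A = \<one>\<^bsub>SL n\<^esub>"
    using adj_mat[OF A(1)] A(2) by (intro bexI[of _ "adj_mat A"]) (auto simp: SL_def)
qed (auto simp: SL_def det_mult assoc_mult_mat[of _ n n _ n _ n])

lemma subgroup_elementary_group:
  "subgroup (elementary_group n) (SL n :: 'a :: comm_ring_1 mat monoid)"
  unfolding elementary_group_def
  by (rule group.generate_is_subgroup[OF group_SL])
     (auto simp: SL_def det_addrow_mat)

definition const_mat :: "'a :: comm_ring_1 mat \<Rightarrow> 'a poly mat" where
  "const_mat A = map_mat (\<lambda>c. [:c:]) A"

definition eval0_mat :: "'a :: comm_ring_1 poly mat \<Rightarrow> 'a mat" where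
  "eval0_mat A = map_mat (\<lambda>p. poly p 0) A"

end

theory Submission
  imports Defs
begin

text \<open>Let \<open>V\<close> be a valuation ring; its nonunits form an ideal, and every nonempty finite set of elements
has one that divides the others. The heart of the matter is that \<open>SL\<^sub>n(V[x]) = E\<^sub>n(V[x])\<close> for
\<open>n \<ge> 3\<close> (\<open>SL_valuation_type\<close>). Arithmetical rings are then treated by patching over the maximal
ideals.

\<^emph>\<open>Valuation rings.\<close> Euclid's algorithm over the residue field turns every unimodular column over
\<open>V[x]\<close> into one with an entry \<open>p\<close> that is congruent to a unit of \<open>V\<close> modulo the nonunits. Let \<open>m\<close>
bound the degree of such a \<open>p\<close> and let \<open>y = 1/x\<close>. As \<open>p(0)\<close> is a unit, \<open>y\<^sup>m p(1/y)\<close> is, up to a unit, a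
monic polynomial in \<open>y\<close> that reduces to \<open>y\<^sup>m\<close>. Hence \<open>B = V[y]/(y\<^sup>m p(1/y))\<close> is a local ring, free of
rank \<open>m\<close> over \<open>V\<close>, and \<open>V[x]/(p) = B[1/y]\<close>. Let \<open>q\<close> be another polynomial. A power of \<open>y\<close> takes it
into \<open>B\<close>, where it is a constant times an element one of whose coefficients is a unit. By
Nakayama's lemma the latter is a unit of \<open>B\<close> times a Weierstrass polynomial in \<open>y\<close> of degree less
than \<open>m\<close>. Read in \<open>x\<close> again, this is a polynomial \<open>w\<close> of degree less than \<open>m\<close> that is congruent
to a unit, and \<open>p\<close> and \<open>w\<close> may change roles (\<open>weierstrass\<close>, stated in \<open>V[x]\<close> itself). So there is a
Euclidean algorithm although leading coefficients need not be units, as long as the factors that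
were split off are harmless.

For a column of length at least three these factors are units modulo \<open>p\<close>, and Whitehead's lemma
moves them to a third entry (\<open>column_equiv_unit\<close>); in this way \<open>SL\<^sub>n\<close> is reduced to \<open>SL\<^sub>2\<close> inside
\<open>SL\<^sub>3\<close>. There the first column \<open>(p, q)\<close> determines the class modulo \<open>E\<^sub>3\<close>, and this
Mennicke symbol is multiplicative in each argument. The factors have trivial symbol: powers of \<open>x\<close>
because \<open>p(0)\<close> is a unit, polynomials with unit leading coefficient by an induction on the degree
(\<open>residually_unit_unit_lead\<close>), and constants because a constant comaximal with \<open>p\<close> divides a power
of the content of \<open>p - p(0)\<close> (\<open>mennicke_trivial_const\<close>).

\<^emph>\<open>Patching.\<close> Let \<open>J\<close> be the set of all \<open>s\<close> in \<open>R\<close> such that \<open>\<sigma>(f + s g)\<close> and \<open>\<sigma>(f)\<close> agree modulo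
\<open>E\<^sub>n(R[x])\<close> for all polynomials \<open>f\<close>, \<open>g\<close>. It is an ideal, and \<open>1 \<in> J\<close> with \<open>f = 0\<close> and \<open>g = x\<close> is the
claim. If \<open>\<sigma>\<close> becomes elementary over a localization, then \<open>\<sigma>(x)\<inverse> \<sigma>(x + T)\<close> is there a product of
conjugates of elementary matrices with entries divisible by \<open>T\<close>. Suslin's explicit formulas for
such conjugates clear their denominators after replacing \<open>T\<close> by \<open>s T\<close> for some denominator \<open>s\<close>, so that
\<open>s \<in> J\<close> (\<open>translation_set_meets\<close>). Hence \<open>J\<close> lies in no maximal ideal.\<close>

hide_const (open) up_ring.coeff up_ring.monom Polynomials.degree Polynomials.lead_coeff

section \<open>Elementary matrices\<close>

lemma elementary_group_one [simp]: "1\<^sub>m n \<in> elementary_group n"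
  unfolding elementary_group_def using generate.one[of "SL n"] by (simp add: SL_def)

lemma elementary_group_mult [simp]:
  "A \<in> elementary_group n \<Longrightarrow> B \<in> elementary_group n \<Longrightarrow> A * B \<in> elementary_group n"
  unfolding elementary_group_def using generate.eng[of A "SL n" _ B] by (simp add: SL_def)

lemma elementary_group_addrow [simp]:
  "i < n \<Longrightarrow> j < n \<Longrightarrow> i \<noteq> j \<Longrightarrow> addrow_mat n a i j \<in> elementary_group n"
  unfolding elementary_group_def by (auto intro!: generate.incl)

lemma elementary_group_SL: "A \<in> elementary_group n \<Longrightarrow> A \<in> carrier (SL n)"
  using subgroup.subset[OF subgroup_elementary_group] by blast

lemma elementary_group_carrier [simp]: "A \<in> elementary_group n \<Longrightarrow> A \<in> carrier_mat n n"
  using elementary_group_SL by (force simp: SL_def)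

lemma elementary_group_inverse:
  fixes A :: "'a :: comm_ring_1 mat"
  assumes "A \<in> elementary_group n"
  obtains B where "B \<in> elementary_group n" "A * B = 1\<^sub>m n" "B * A = 1\<^sub>m n"
proof -
  interpret group "SL n :: 'a mat monoid" by (rule group_SL)
  have "inv\<^bsub>SL n\<^esub> A \<in> elementary_group n"
    using subgroup.m_inv_closed[OF subgroup_elementary_group assms] .
  moreover have "A * inv\<^bsub>SL n\<^esub> A = 1\<^sub>m n" "inv\<^bsub>SL n\<^esub> A * A = 1\<^sub>m n"
    using r_inv[OF elementary_group_SL[OF assms]] l_inv[OF elementary_group_SL[OF assms]]
    by (simp_all add: SL_def)
  ultimately show ?thesis using that by blast
qed

lemma addrow_mat_inverse:
  fixes a :: "'a :: comm_ring_1"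
  assumes "i < n" "j < n" "i \<noteq> j"
  shows "inv\<^bsub>SL n\<^esub> (addrow_mat n a i j) = addrow_mat n (- a) i j"
proof -
  interpret group "SL n :: 'a mat monoid" by (rule group_SL)
  show ?thesis
    using assms addrow_mat_inv[of i n j "- a"]
    by (intro inv_equality) (auto simp: SL_def det_addrow_mat)
qed

text \<open>Inverses of the generators are again generators, so a word in the generators, read from the
left, is enough.\<close>

lemma elementary_group_induct [consumes 1, case_names one addrow]:
  fixes A :: "'a :: comm_ring_1 mat"
  assumes "A \<in> elementary_group n" and one: "P (1\<^sub>m n)"
    and step: "\<And>a i j B. i < n \<Longrightarrow> j < n \<Longrightarrow> i \<noteq> j \<Longrightarrow> B \<in> elementary_group n \<Longrightarrow> P B
      \<Longrightarrow> P (addrow_mat n a i j * B)"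
  shows "P A"
proof -
  let ?H = "{addrow_mat n a i j | a i j. i < n \<and> j < n \<and> i \<noteq> j} :: 'a mat set"
  have gen: "generate (SL n) ?H = elementary_group n"
    by (simp add: elementary_group_def)
  have "\<forall>B \<in> elementary_group n. P B \<longrightarrow> P (A * B)"
    using assms(1) unfolding gen[symmetric]
  proof (induction rule: generate.induct)
    case one
    show ?case unfolding gen
    proof (intro ballI impI)
      fix B assume "B \<in> elementary_group n" "P B"
      then show "P (\<one>\<^bsub>SL n\<^esub> * B)"
        using left_mult_one_mat[of B n n] by (simp add: SL_def)
    qed
  next
    case (incl h)
    then obtain a i j where "h = addrow_mat n a i j" "i < n" "j < n" "i \<noteq> j" by blast
    then show ?case unfolding gen using step by simp
  next
    case (inv h)
    then obtain a i j where "h = addrow_mat n a i j" "i < n" "j < n" "i \<noteq> j" by blast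
    then show ?case unfolding gen using step by (simp add: addrow_mat_inverse)
  next
    case (eng h1 h2)
    note c = eng(1,2)[unfolded gen] and IH = eng(3,4)[unfolded gen]
    show ?case unfolding gen
    proof (intro ballI impI)
      fix B assume B: "B \<in> elementary_group n" "P B"
      have "P (h1 * (h2 * B))" using IH B elementary_group_mult[OF c(2) B(1)] by blast
      then show "P (h1 \<otimes>\<^bsub>SL n\<^esub> h2 * B)"
        using assoc_mult_mat[of h1 n n h2 n B n] c B by (simp add: SL_def)
    qed
  qed
  then have "P (A * 1\<^sub>m n)" using one by simp
  then show ?thesis using right_mult_one_mat[OF elementary_group_carrier[OF assms(1)]] by simp
qed

lemma elementary_group_cancel_left:
  fixes A B :: "'a :: comm_ring_1 mat"
  assumes "A \<in> elementary_group n" "B \<in> carrier_mat n n"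
  shows "A * B \<in> elementary_group n \<longleftrightarrow> B \<in> elementary_group n"
proof
  obtain C where C: "C \<in> elementary_group n" "C * A = 1\<^sub>m n"
    using assms(1) by (rule elementary_group_inverse)
  assume "A * B \<in> elementary_group n"
  then have "C * (A * B) \<in> elementary_group n" using C by simp
  then show "B \<in> elementary_group n"
    using assoc_mult_mat[of C n n A n B n] assms C by simp
qed (simp add: assms)

lemma elementary_group_cancel_right:
  fixes A B :: "'a :: comm_ring_1 mat"
  assumes "A \<in> elementary_group n" "B \<in> carrier_mat n n"
  shows "B * A \<in> elementary_group n \<longleftrightarrow> B \<in> elementary_group n"
proof
  obtain C where C: "C \<in> elementary_group n" "A * C = 1\<^sub>m n"
    using assms(1) by (rule elementary_group_inverse)
  assume "B * A \<in> elementary_group n"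
  then have "B * A * C \<in> elementary_group n" using C by simp
  then show "B \<in> elementary_group n"
    using assoc_mult_mat[of B n n A n C n] assms C by simp
qed (simp add: assms)

lemma elementary_group_hom:
  assumes "comm_ring_hom h" "A \<in> elementary_group n"
  shows "map_mat h A \<in> elementary_group n"
proof -
  interpret comm_ring_hom h by fact
  show ?thesis using assms(2)
  proof (induction rule: elementary_group_induct)
    case one
    show ?case by (simp add: mat_hom_one)
  next
    case (addrow a i j B)
    have "map_mat h (addrow_mat n a i j) = addrow_mat n (h a) i j"
      by (rule eq_matI) (simp_all add: hom_add)
    moreover have "map_mat h (addrow_mat n a i j * B) = map_mat h (addrow_mat n a i j) * map_mat h B"
      by (rule mat_hom_mult[of _ n n _ n]) (simp_all add: addrow)
    ultimately show ?case using addrow by simp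
  qed
qed

definition corner_mat :: "'a :: comm_ring_1 mat \<Rightarrow> 'a mat" where
  "corner_mat A = four_block_mat A (0\<^sub>m (dim_row A) 1) (0\<^sub>m 1 (dim_col A)) (1\<^sub>m 1)"

lemma corner_mat_carrier [simp]: "A \<in> carrier_mat n n \<Longrightarrow> corner_mat A \<in> carrier_mat (Suc n) (Suc n)"
  unfolding corner_mat_def using four_block_carrier_mat[of A n n "1\<^sub>m 1" 1 1] by simp

lemma index_corner_mat:
  "A \<in> carrier_mat n n \<Longrightarrow> i < Suc n \<Longrightarrow> j < Suc n \<Longrightarrow>
    corner_mat A $$ (i, j) = (if i < n \<and> j < n then A $$ (i, j) else if i = j then 1 else 0)"
  unfolding corner_mat_def by (auto simp: less_Suc_eq)

lemma corner_mat_mult: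
  "A \<in> carrier_mat n n \<Longrightarrow> B \<in> carrier_mat n n \<Longrightarrow> corner_mat (A * B) = corner_mat A * corner_mat B"
  unfolding corner_mat_def
  by (subst mult_four_block_mat[of _ n n _ 1 _ 1 _ _ n _ 1]) auto

lemma elementary_group_corner:
  assumes "A \<in> elementary_group n"
  shows "corner_mat A \<in> elementary_group (Suc n)"
  using assms
proof (induction rule: elementary_group_induct)
  case one
  have "corner_mat (1\<^sub>m n :: 'a mat) = 1\<^sub>m (Suc n)"
    by (rule eq_matI) (auto simp: index_corner_mat[of _ n], auto simp: corner_mat_def)
  then show ?case by simp
next
  case (addrow a i j B)
  have "corner_mat (addrow_mat n a i j) = addrow_mat (Suc n) a i j"
    using addrow(1-3)
    by (intro eq_matI) (auto simp: index_corner_mat[of _ n] less_Suc_eq, auto simp: corner_mat_def)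
  then show ?case using addrow corner_mat_mult[of "addrow_mat n a i j" n B] by simp
qed

(*MARK*)
lemma det_corner_mat:
  assumes A: "A \<in> carrier_mat n n"
  shows "det (corner_mat A) = det A"
proof -
  note c = corner_mat_carrier[OF A]
  have "det (corner_mat A) = (\<Sum>i<Suc n. corner_mat A $$ (i, n) * cofactor (corner_mat A) i n)"
    by (rule laplace_expansion_column[OF c]) simp
  also have "\<dots> = cofactor (corner_mat A) n n"
    using A by (simp add: index_corner_mat[OF A])
  also have "mat_delete (corner_mat A) n n = A"
    using A carrier_matD[OF c]
    by (intro eq_matI) (auto simp: mat_delete_def index_corner_mat[OF A])
  then have "cofactor (corner_mat A) n n = det A" by (simp add: cofactor_def)
  finally show ?thesis .
qed

section \<open>Transvections\<close>

text \<open>The matrix \<open>I + v w\<^sup>T\<close>. Vectors are functions on the natural numbers; their values at \<open>n\<close> and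
beyond are irrelevant.\<close>

definition transvection :: "nat \<Rightarrow> (nat \<Rightarrow> 'a) \<Rightarrow> (nat \<Rightarrow> 'a) \<Rightarrow> 'a :: comm_ring_1 mat" where
  "transvection n v w = mat n n (\<lambda>(i, j). (if i = j then 1 else 0) + v i * w j)"

lemma transvection_carrier [simp]: "transvection n v w \<in> carrier_mat n n"
  by (simp add: transvection_def)

lemma index_transvection [simp]:
  "i < n \<Longrightarrow> j < n \<Longrightarrow> transvection n v w $$ (i, j) = (if i = j then 1 else 0) + v i * w j"
  "dim_row (transvection n v w) = n" "dim_col (transvection n v w) = n"
  by (simp_all add: transvection_def)

lemma index_mult_mat_sum:
  assumes "A \<in> carrier_mat n n" "B \<in> carrier_mat n n" "i < n" "j < n"
  shows "(A * B) $$ (i, j) = (\<Sum>k<n. A $$ (i, k) * B $$ (k, j))"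
  using assms by (auto simp: scalar_prod_def atLeast0LessThan intro!: sum.cong)

lemma sum_delta_lessThan:
  fixes f :: "nat \<Rightarrow> 'a :: comm_ring_1"
  shows "i < n \<Longrightarrow> (\<Sum>k<n. (if i = k then 1 else 0) * f k) = f i"
    and "i < n \<Longrightarrow> (\<Sum>k<n. f k * (if k = i then 1 else 0)) = f i"
  by (simp_all add: if_distrib[of "\<lambda>x. x * _"] if_distrib[of "\<lambda>x. _ * x"] cong: if_cong)

lemma index_transvection_mult:
  assumes "i < n" "j < n"
  shows "(transvection n v w * transvection n v' w') $$ (i, j) =
    (if i = j then 1 else 0) + v i * w j + v' i * w' j + v i * (\<Sum>k<n. w k * v' k) * w' j"
proof -
  have "(transvection n v w * transvection n v' w') $$ (i, j) =
    (\<Sum>k<n. ((if i = k then 1 else 0) + v i * w k) * ((if k = j then 1 else 0) + v' k * w' j))"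
    using assms by (subst index_mult_mat_sum) auto
  also have "\<dots> = (\<Sum>k<n. (if i = k then 1 else 0) * (if k = j then 1 else 0))
      + (\<Sum>k<n. (v i * w k) * (if k = j then 1 else 0))
      + (\<Sum>k<n. (if i = k then 1 else 0) * (v' k * w' j))
      + (\<Sum>k<n. (v i * w k) * (v' k * w' j))"
    by (simp add: sum.distrib algebra_simps)
  also have "\<dots> = (if i = j then 1 else 0) + v i * w j + v' i * w' j + v i * (\<Sum>k<n. w k * v' k) * w' j"
    using assms by (simp only: sum_delta_lessThan) (simp add: sum_distrib_left sum_distrib_right mult_ac)
  finally show ?thesis .
qed

lemma transvection_add_left:
  assumes "(\<Sum>k<n. w k * v' k) = 0"
  shows "transvection n v w * transvection n v' w = transvection n (\<lambda>i. v i + v' i) w"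
  using assms by (intro eq_matI) (auto simp: index_transvection_mult algebra_simps simp del: index_mult_mat(1))

lemma transvection_add_right:
  assumes "(\<Sum>k<n. w k * v k) = 0"
  shows "transvection n v w * transvection n v w' = transvection n v (\<lambda>i. w i + w' i)"
  using assms by (intro eq_matI) (auto simp: index_transvection_mult algebra_simps simp del: index_mult_mat(1))

lemma transvection_zero: "transvection n (\<lambda>i. 0) w = 1\<^sub>m n" "transvection n v (\<lambda>i. 0) = 1\<^sub>m n"
  by (auto intro!: eq_matI)

lemma transvection_cong:
  "(\<And>i. i < n \<Longrightarrow> v i = v' i) \<Longrightarrow> (\<And>i. i < n \<Longrightarrow> w i = w' i) \<Longrightarrow> transvection n v w = transvection n v' w'"
  by (auto intro!: eq_matI)

lemma transvection_sum_left:
  assumes "finite I" "\<And>i. i \<in> I \<Longrightarrow> (\<Sum>k<n. w k * f i k) = 0"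
    and "\<And>i. i \<in> I \<Longrightarrow> transvection n (f i) w \<in> elementary_group n"
  shows "transvection n (\<lambda>k. \<Sum>i\<in>I. f i k) w \<in> elementary_group n"
  using assms
proof (induction I)
  case (insert i I)
  have "(\<Sum>k<n. w k * (\<Sum>i\<in>I. f i k)) = (\<Sum>i\<in>I. \<Sum>k<n. w k * f i k)"
    by (simp add: sum_distrib_left sum.swap[of _ _ I])
  also have "\<dots> = 0" using insert(4) by simp
  finally have "transvection n (f i) w * transvection n (\<lambda>k. \<Sum>i\<in>I. f i k) w
    = transvection n (\<lambda>k. \<Sum>i\<in>insert i I. f i k) w"
    using insert(1,2) by (simp add: transvection_add_left)
  moreover have "transvection n (f i) w \<in> elementary_group n" using insert(5) by blast
  moreover have "transvection n (\<lambda>k. \<Sum>i\<in>I. f i k) w \<in> elementary_group n" using insert by blast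
  ultimately show ?case using elementary_group_mult by metis
qed (simp add: transvection_zero)

text \<open>The set \<open>G\<close> is arbitrary because this splitting is applied to the elementary group and also to the
matrices \<open>liftable\<close> below, whose factors have to be dilated one by one.\<close>

lemma transvection_sum_right:
  assumes "finite I" "\<And>i. i \<in> I \<Longrightarrow> (\<Sum>k<n. f i k * v k) = 0"
    and "\<And>i. i \<in> I \<Longrightarrow> transvection n v (f i) \<in> G"
    and G: "1\<^sub>m n \<in> G" "\<And>A B. A \<in> G \<Longrightarrow> B \<in> G \<Longrightarrow> A * B \<in> G"
  shows "transvection n v (\<lambda>k. \<Sum>i\<in>I. f i k) \<in> G"
  using assms(1-3)
proof (induction I)
  case (insert i I)
  have "transvection n v (f i) * transvection n v (\<lambda>k. \<Sum>i\<in>I. f i k)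
    = transvection n v (\<lambda>k. \<Sum>i\<in>insert i I. f i k)"
    using insert(1,2,4) by (simp add: transvection_add_right)
  moreover have "transvection n v (f i) \<in> G" using insert(5) by blast
  moreover have "transvection n v (\<lambda>k. \<Sum>i\<in>I. f i k) \<in> G" using insert by blast
  ultimately show ?case using G(2) by metis
qed (simp add: transvection_zero G(1))

lemma transvection_unit_unit:
  assumes "i < n" "j < n" "i \<noteq> j"
  shows "transvection n (\<lambda>k. if k = i then a else 0) (\<lambda>k. if k = j then b else 0) \<in> elementary_group n"
proof -
  have "transvection n (\<lambda>k. if k = i then a else 0) (\<lambda>k. if k = j then b else 0) = addrow_mat n (a * b) i j"
    using assms by (intro eq_matI) auto
  then show ?thesis using assms by simp
qed

lemma transvection_unit_right:
  assumes "t < n" "v t = 0"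
  shows "transvection n v (\<lambda>k. if k = t then b else 0) \<in> elementary_group n"
proof -
  have "transvection n (\<lambda>k. \<Sum>i<n. if k = i then v i else 0) (\<lambda>k. if k = t then b else 0) \<in> elementary_group n"
  proof (rule transvection_sum_left)
    fix i assume i: "i \<in> {..<n}"
    show "(\<Sum>k<n. (if k = t then b else 0) * (if k = i then v i else 0)) = 0"
      using assms by (intro sum.neutral) auto
    show "transvection n (\<lambda>k. if k = i then v i else 0) (\<lambda>k. if k = t then b else 0) \<in> elementary_group n"
    proof (cases "i = t")
      case True
      then have "(\<lambda>k. if k = i then v i else 0) = (\<lambda>k. 0)" using assms by auto
      then show ?thesis by (simp add: transvection_zero)
    qed (use i assms in \<open>simp add: transvection_unit_unit\<close>)
  qed simp
  moreover have "transvection n (\<lambda>k. \<Sum>i<n. if k = i then v i else 0) (\<lambda>k. if k = t then b else 0)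
    = transvection n v (\<lambda>k. if k = t then b else 0)"
    by (rule transvection_cong) auto
  ultimately show ?thesis by simp
qed

lemma transvection_unit_left:
  assumes "t < n" "w t = 0"
  shows "transvection n (\<lambda>k. if k = t then b else 0) w \<in> elementary_group n"
proof -
  have "transvection n (\<lambda>k. if k = t then b else 0) (\<lambda>k. \<Sum>i<n. if k = i then w i else 0) \<in> elementary_group n"
  proof (rule transvection_sum_right)
    fix i assume i: "i \<in> {..<n}"
    show "(\<Sum>k<n. (if k = i then w i else 0) * (if k = t then b else 0)) = 0"
      using assms by (intro sum.neutral) auto
    show "transvection n (\<lambda>k. if k = t then b else 0) (\<lambda>k. if k = i then w i else 0) \<in> elementary_group n"
    proof (cases "i = t")
      case True
      then have "(\<lambda>k. if k = i then w i else 0) = (\<lambda>k. 0)" using assms by auto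
      then show ?thesis by (simp add: transvection_zero)
    qed (use i assms in \<open>simp add: transvection_unit_unit\<close>)
  qed simp_all
  moreover have "transvection n (\<lambda>k. if k = t then b else 0) (\<lambda>k. \<Sum>i<n. if k = i then w i else 0)
    = transvection n (\<lambda>k. if k = t then b else 0) w"
    by (rule transvection_cong) auto
  ultimately show ?thesis by simp
qed


text \<open>As \<open>w \<cdot> v = 0\<close> and both vectors vanish at \<open>t\<close>, the matrix \<open>I + v w\<^sup>T\<close> is the commutator of
\<open>I + v e\<^sub>t\<^sup>T\<close> and \<open>I + e\<^sub>t w\<^sup>T\<close>.\<close>

lemma transvection_commutator:
  fixes v w :: "nat \<Rightarrow> 'a :: comm_ring_1"
  assumes t: "t < n" "v t = 0" "w t = 0" and vw: "(\<Sum>k<n. w k * v k) = 0"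
  shows "transvection n v w \<in> elementary_group n"
proof -
  define e where "e = (\<lambda>k. if k = t then 1 else 0 :: 'a)"
  define e' where "e' = (\<lambda>k. if k = t then - 1 else 0 :: 'a)"
  have "(\<Sum>k<n. e k * e k) = 1" "(\<Sum>k<n. e' k * e' k) = 1"
    using t by (simp_all add: e_def e'_def if_distrib[of "\<lambda>x. _ * x"] cong: if_cong)
  have ve: "(\<Sum>k<n. v k * e' k) = 0" "(\<Sum>k<n. e k * v k) = 0" "(\<Sum>k<n. w k * e k) = 0"
    using t by (auto simp: e_def e'_def intro!: sum.neutral)
  define F where "F = transvection n v e * transvection n e w"
  define H where "H = transvection n v e' * transvection n e' w"
  have idx: "F $$ (i, j) = (if i = j then 1 else 0) + v i * e j + e i * w j + v i * w j"
    "H $$ (i, j) = (if i = j then 1 else 0) + v i * e' j + e' i * w j + v i * w j" if "i < n" "j < n" for i j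
    unfolding F_def H_def
    by (simp_all only: index_transvection_mult that \<open>(\<Sum>k<n. e k * e k) = 1\<close> \<open>(\<Sum>k<n. e' k * e' k) = 1\<close>
        mult_1_right)
  have cF: "F \<in> carrier_mat n n" "H \<in> carrier_mat n n"
    unfolding F_def H_def by (meson mult_carrier_mat transvection_carrier)+
  have e': "e' k = - e k" for k by (simp add: e_def e'_def)
  have "F * H = transvection n v w"
  proof (rule eq_matI)
    fix i j assume "i < dim_row (transvection n v w)" "j < dim_col (transvection n v w)"
    then have ij: "i < n" "j < n" by simp_all
    have "(F * H) $$ (i, j) = (\<Sum>k<n. ((if i = k then 1 else 0) + (v i * e k + e i * w k + v i * w k)) *
       ((if k = j then 1 else 0) + (v k * e' j + e' k * w j + v k * w j)))"
      using ij by (subst index_mult_mat_sum[OF cF ij]) (simp add: idx add.assoc)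
    also have "\<dots> = (\<Sum>k<n. (if i = k then 1 else 0) * (if k = j then 1 else 0))
      + (\<Sum>k<n. (if i = k then 1 else 0) * (v k * e' j + e' k * w j + v k * w j))
      + (\<Sum>k<n. (v i * e k + e i * w k + v i * w k) * (if k = j then 1 else 0))
      + (\<Sum>k<n. (v i * e k + e i * w k + v i * w k) * (v k * e' j + e' k * w j + v k * w j))"
      by (simp add: sum.distrib algebra_simps)
    also have "(\<Sum>k<n. (v i * e k + e i * w k + v i * w k) * (v k * e' j + e' k * w j + v k * w j))
      = v i * e' j * (\<Sum>k<n. e k * v k) - v i * w j * (\<Sum>k<n. e k * e k)
        + v i * w j * (\<Sum>k<n. e k * v k) + (e i * (e' j + w j) + v i * (e' j + w j)) * (\<Sum>k<n. w k * v k)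
        - (e i * w j + v i * w j) * (\<Sum>k<n. w k * e k)"
      unfolding e' sum_distrib_left sum.distrib[symmetric] sum_subtractf[symmetric]
      by (rule sum.cong) (simp_all add: algebra_simps)
    finally show "(F * H) $$ (i, j) = transvection n v w $$ (i, j)"
      using ij vw ve \<open>(\<Sum>k<n. e k * e k) = 1\<close>
      by (simp only: sum_delta_lessThan) (simp add: e' algebra_simps)
  qed (use cF in auto)
  moreover have "F \<in> elementary_group n" "H \<in> elementary_group n"
    unfolding F_def H_def e_def e'_def
    using t by (intro elementary_group_mult transvection_unit_left transvection_unit_right; simp)+
  ultimately show ?thesis by (metis elementary_group_mult)
qed

text \<open>The entry of \<open>v\<close> at \<open>t\<close> splits off as the transvection \<open>I + v\<^sub>t e\<^sub>t w\<^sup>T\<close>.\<close>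

lemma transvection_hole:
  assumes t: "t < n" "w t = 0" and vw: "(\<Sum>k<n. w k * v k) = 0"
  shows "transvection n v w \<in> elementary_group n"
proof -
  define v' where "v' = v(t := 0)"
  have eq: "(\<Sum>k<n. w k * v' k) = (\<Sum>k<n. w k * v k)"
    using t by (intro sum.cong) (auto simp: v'_def)
  have "transvection n (\<lambda>k. if k = t then v t else 0) w * transvection n v' w
    = transvection n (\<lambda>i. (if i = t then v t else 0) + v' i) w"
    using eq vw by (intro transvection_add_left) simp
  also have "\<dots> = transvection n v w" by (rule transvection_cong) (auto simp: v'_def)
  finally have "transvection n (\<lambda>k. if k = t then v t else 0) w * transvection n v' w = transvection n v w" .
  moreover have "transvection n v' w \<in> elementary_group n"
    using t vw eq by (intro transvection_commutator[of t]) (simp_all add: v'_def)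
  ultimately show ?thesis using transvection_unit_left[of t n w "v t"] t elementary_group_mult by metis
qed

text \<open>The rows \<open>v\<^sub>l e\<^sub>k - v\<^sub>k e\<^sub>l\<close> are orthogonal to \<open>v\<close> and have at most two nonzero entries. For \<open>n \<ge> 3\<close>
this leaves an index for the commutator formula.\<close>

lemma transvection_koszul:
  assumes "k < n" "l < n" "k \<noteq> l" and n: "n \<ge> 3"
  shows "transvection n v (\<lambda>i. if i = k then a * v l else if i = l then - (a * v k) else 0) \<in> elementary_group n"
proof -
  have "\<exists>t<n. t \<noteq> k \<and> t \<noteq> l"
  proof (rule ccontr)
    assume "\<not> ?thesis"
    then have "{..<n} \<subseteq> {k, l}" by auto
    then have "card {..<n} \<le> card {k, l}" by (rule card_mono[rotated]) simp
    then show False using n card_insert_le_m1[of 2 "{l}" k] by simp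
  qed
  then obtain t where t: "t < n" "t \<noteq> k" "t \<noteq> l" by blast
  show ?thesis
  proof (rule transvection_hole[of t])
    have "(\<Sum>i<n. (if i = k then a * v l else if i = l then - (a * v k) else 0) * v i)
      = (\<Sum>i\<in>{k, l}. (if i = k then a * v l else if i = l then - (a * v k) else 0) * v i)"
      using assms by (intro sum.mono_neutral_right) auto
    also have "\<dots> = 0" using assms by (simp add: mult_ac)
    finally show "(\<Sum>i<n. (if i = k then a * v l else if i = l then - (a * v k) else 0) * v i) = 0" .
  qed (use t in auto)
qed

lemma conjugate_addrow_mat:
  fixes C D :: "'a :: comm_ring_1 mat"
  assumes C: "C \<in> carrier_mat n n" and D: "D \<in> carrier_mat n n" and CD: "C * D = 1\<^sub>m n"
    and ij: "i < n" "j < n" "i \<noteq> j"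
  shows "C * addrow_mat n h i j * D = transvection n (\<lambda>k. C $$ (k, i)) (\<lambda>k. h * D $$ (j, k))"
proof (rule eq_matI)
  fix a b assume "a < dim_row (transvection n (\<lambda>k. C $$ (k, i)) (\<lambda>k. h * D $$ (j, k)))"
    "b < dim_col (transvection n (\<lambda>k. C $$ (k, i)) (\<lambda>k. h * D $$ (j, k)))"
  then have ab: "a < n" "b < n" by simp_all
  have 1: "(addrow_mat n h i j * D) $$ (k, b) = D $$ (k, b) + (if k = i then h * D $$ (j, b) else 0)"
    if "k < n" for k
    using that ab ij D by (simp add: addrow_mat[OF D ij(2), symmetric] del: index_mult_mat)
  have "(C * (addrow_mat n h i j * D)) $$ (a, b)
      = (\<Sum>k<n. C $$ (a, k) * D $$ (k, b) + C $$ (a, k) * (if k = i then h * D $$ (j, b) else 0))"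
    using index_mult_mat_sum[OF C mult_carrier_mat[OF addrow_mat_carrier D] ab] 1
    by (simp add: distrib_left)
  also have "\<dots> = (C * D) $$ (a, b) + C $$ (a, i) * (h * D $$ (j, b))"
    using index_mult_mat_sum[OF C D ab] ij
    by (simp add: sum.distrib if_distrib[of "\<lambda>x. _ * x"] cong: if_cong)
  also have "C * (addrow_mat n h i j * D) = C * addrow_mat n h i j * D"
    by (rule assoc_mult_mat[OF C addrow_mat_carrier D, symmetric])
  finally show "(C * addrow_mat n h i j * D) $$ (a, b)
    = transvection n (\<lambda>k. C $$ (k, i)) (\<lambda>k. h * D $$ (j, k)) $$ (a, b)"
    using ab by (simp add: CD)
qed (use C D in auto)

text \<open>A row orthogonal to the unimodular column \<open>v\<close> is a combination of the rows \<open>v\<^sub>q e\<^sub>p - v\<^sub>p e\<^sub>q\<close>,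
because \<open>w\<^sub>k = w\<^sub>k (u \<cdot> v) - u\<^sub>k (w \<cdot> v)\<close>. With the two preceding lemmas this writes a conjugate of an
elementary matrix as a product of elementary ones whose entries are polynomials in those of the
conjugating matrix and of its inverse; the explicit form is what permits to clear denominators.\<close>

lemma koszul_decomposition:
  fixes u v w :: "nat \<Rightarrow> 'a :: comm_ring_1"
  assumes uv: "(\<Sum>l<n. u l * v l) = 1" and wv: "(\<Sum>l<n. w l * v l) = 0" and k: "k < n"
  shows "w k = (\<Sum>(p, q) \<in> {(p, q). p < q \<and> q < n}.
      if k = p then (w p * u q - w q * u p) * v q
      else if k = q then - ((w p * u q - w q * u p) * v p) else 0)"
proof -
  let ?S = "{(p, q). p < q \<and> q < n}"
  define c where "c p q = w p * u q - w q * u p" for p q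
  have fin: "finite ?S" by (rule finite_subset[of _ "{..<n} \<times> {..<n}"]) auto
  have A: "(\<Sum>(p, q) \<in> ?S. if k = p then c p q * v q else 0) = (\<Sum>q\<in>{k<..<n}. c k q * v q)"
  proof -
    have "(\<Sum>(p, q) \<in> ?S. if k = p then c p q * v q else 0)
      = (\<Sum>(p, q) \<in> Pair k ` {k<..<n}. if k = p then c p q * v q else 0)"
      using fin by (intro sum.mono_neutral_right) auto
    also have "\<dots> = (\<Sum>q\<in>{k<..<n}. c k q * v q)"
      by (subst sum.reindex) (auto intro: inj_onI)
    finally show ?thesis .
  qed
  have B: "(\<Sum>(p, q) \<in> ?S. if k = q then - (c p q * v p) else 0) = (\<Sum>q\<in>{..<k}. c k q * v q)"
  proof -
    have "(\<Sum>(p, q) \<in> ?S. if k = q then - (c p q * v p) else 0)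
      = (\<Sum>(p, q) \<in> (\<lambda>p. (p, k)) ` {..<k}. if k = q then - (c p q * v p) else 0)"
      using fin k by (intro sum.mono_neutral_right) auto
    also have "\<dots> = (\<Sum>q\<in>{..<k}. - (c q k * v q))"
      by (subst sum.reindex) (auto intro: inj_onI)
    also have "\<dots> = (\<Sum>q\<in>{..<k}. c k q * v q)"
      by (intro sum.cong) (auto simp: c_def algebra_simps)
    finally show ?thesis .
  qed
  have "(\<Sum>(p, q) \<in> ?S. if k = p then c p q * v q else if k = q then - (c p q * v p) else 0)
    = (\<Sum>(p, q) \<in> ?S. (if k = p then c p q * v q else 0) + (if k = q then - (c p q * v p) else 0))"
    by (intro sum.cong) auto
  also have "\<dots> = (\<Sum>(p, q) \<in> ?S. if k = p then c p q * v q else 0)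
      + (\<Sum>(p, q) \<in> ?S. if k = q then - (c p q * v p) else 0)"
    by (simp add: sum.distrib case_prod_beta)
  also have "\<dots> = (\<Sum>q\<in>{k<..<n}. c k q * v q) + (\<Sum>q\<in>{..<k}. c k q * v q)"
    by (simp only: A B)
  also have "\<dots> = (\<Sum>q\<in>{k<..<n} \<union> {..<k}. c k q * v q)"
    by (intro sum.union_disjoint[symmetric]) auto
  also have "\<dots> = (\<Sum>q<n. c k q * v q)"
    using k by (intro sum.mono_neutral_left) (auto simp: c_def not_less le_less)
  also have "\<dots> = w k * (\<Sum>l<n. u l * v l) - u k * (\<Sum>l<n. w l * v l)"
    by (simp add: c_def sum_distrib_left sum_subtractf algebra_simps)
  also have "\<dots> = w k" by (simp add: uv wv)
  finally show ?thesis unfolding c_def by (rule sym)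
qed

section \<open>Mennicke symbols\<close>

definition comaximal :: "'a :: comm_ring_1 \<Rightarrow> 'a \<Rightarrow> bool" where
  "comaximal a b \<longleftrightarrow> (\<exists>c d. c * a + d * b = 1)"

lemma comaximalI: "c * a + d * b = 1 \<Longrightarrow> comaximal a b"
  by (auto simp: comaximal_def)

lemma comaximal_commute: "comaximal a b \<longleftrightarrow> comaximal b a"
  unfolding comaximal_def by (metis add.commute)

lemma comaximal_add [simp]: "comaximal a (b + t * a) \<longleftrightarrow> comaximal a b"
proof
  assume "comaximal a (b + t * a)"
  then obtain c d where "c * a + d * (b + t * a) = 1" by (auto simp: comaximal_def)
  then have "(c + d * t) * a + d * b = 1" by (simp add: algebra_simps)
  then show "comaximal a b" by (rule comaximalI)
next
  assume "comaximal a b"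
  then obtain c d where "c * a + d * b = 1" by (auto simp: comaximal_def)
  then have "(c - d * t) * a + d * (b + t * a) = 1" by (simp add: algebra_simps)
  then show "comaximal a (b + t * a)" by (rule comaximalI)
qed

lemma comaximal_minus [simp]: "comaximal a (- b) \<longleftrightarrow> comaximal a b"
proof -
  have "comaximal a (- b)" if ab: "comaximal a b" for b
  proof -
    obtain c d where "c * a + d * b = 1" using ab by (auto simp: comaximal_def)
    then have "c * a + (- d) * (- b) = 1" by simp
    then show ?thesis by (rule comaximalI)
  qed
  from this[of b] this[of "- b"] show ?thesis by auto
qed

lemma comaximal_unit: "b dvd 1 \<Longrightarrow> comaximal a b"
  unfolding comaximal_def dvd_def by (metis add_0 mult.commute mult_zero_left)

lemma comaximal_mult_iff: "comaximal a (b * c) \<longleftrightarrow> comaximal a b \<and> comaximal a c"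
proof
  assume "comaximal a (b * c)"
  then obtain x y where "x * a + y * (b * c) = 1" by (auto simp: comaximal_def)
  then have "x * a + (y * c) * b = 1" "x * a + (y * b) * c = 1" by (simp_all add: algebra_simps)
  then show "comaximal a b \<and> comaximal a c" using comaximalI by blast
next
  assume "comaximal a b \<and> comaximal a c"
  then obtain x y z w where *: "x * a + y * b = 1" "z * a + w * c = 1" by (auto simp: comaximal_def)
  have "(x * z * a + x * w * c + y * b * z) * a + (y * w) * (b * c) = (x * a + y * b) * (z * a + w * c)"
    by (simp add: algebra_simps)
  then show "comaximal a (b * c)" using * by (auto intro: comaximalI)
qed

lemma comaximal_power: "comaximal a b \<Longrightarrow> comaximal a (b ^ k)"
  by (induction k) (auto simp: comaximal_mult_iff comaximal_unit)

definition mat3 :: "'a \<Rightarrow> 'a \<Rightarrow> 'a \<Rightarrow> 'a \<Rightarrow> 'a \<Rightarrow> 'a \<Rightarrow> 'a \<Rightarrow> 'a \<Rightarrow> 'a \<Rightarrow> 'a mat" where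
  "mat3 a b c d e f g h i = mat 3 3 (\<lambda>(k, l).
     if k = 0 then (if l = 0 then a else if l = 1 then b else c)
     else if k = 1 then (if l = 0 then d else if l = 1 then e else f)
     else (if l = 0 then g else if l = 1 then h else i))"

lemma mat3_carrier [simp]: "mat3 a b c d e f g h i \<in> carrier_mat 3 3"
  by (simp add: mat3_def)

lemma mat3_mult:
  fixes a :: "'a :: comm_ring_1"
  shows "mat3 a b c d e f g h i * mat3 a' b' c' d' e' f' g' h' i' =
    mat3 (a*a'+b*d'+c*g') (a*b'+b*e'+c*h') (a*c'+b*f'+c*i')
         (d*a'+e*d'+f*g') (d*b'+e*e'+f*h') (d*c'+e*f'+f*i')
         (g*a'+h*d'+i*g') (g*b'+h*e'+i*h') (g*c'+h*f'+i*i')"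
proof -
  have "{0..<3} = {0, 1, 2 :: nat}" by auto
  then show ?thesis
    by (intro eq_matI) (auto simp: mat3_def scalar_prod_def add.assoc)
qed

lemma less_3_cases: "(i :: nat) < 3 \<longleftrightarrow> i = 0 \<or> i = 1 \<or> i = 2"
  by auto

lemma mat3_elementary [simp]:
  fixes t :: "'a :: comm_ring_1"
  shows "mat3 1 t 0 0 1 0 0 0 1 \<in> elementary_group 3" "mat3 1 0 t 0 1 0 0 0 1 \<in> elementary_group 3"
    "mat3 1 0 0 t 1 0 0 0 1 \<in> elementary_group 3" "mat3 1 0 0 0 1 t 0 0 1 \<in> elementary_group 3"
    "mat3 1 0 0 0 1 0 t 0 1 \<in> elementary_group 3" "mat3 1 0 0 0 1 0 0 t 1 \<in> elementary_group 3"
proof -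
  have "mat3 1 t 0 0 1 0 0 0 1 = addrow_mat 3 t 0 1" "mat3 1 0 t 0 1 0 0 0 1 = addrow_mat 3 t 0 2"
    "mat3 1 0 0 t 1 0 0 0 1 = addrow_mat 3 t 1 0" "mat3 1 0 0 0 1 t 0 0 1 = addrow_mat 3 t 1 2"
    "mat3 1 0 0 0 1 0 t 0 1 = addrow_mat 3 t 2 0" "mat3 1 0 0 0 1 0 0 t 1 = addrow_mat 3 t 2 1"
    by (intro eq_matI; force simp: mat3_def less_3_cases)+
  then show "mat3 1 t 0 0 1 0 0 0 1 \<in> elementary_group 3" "mat3 1 0 t 0 1 0 0 0 1 \<in> elementary_group 3"
    "mat3 1 0 0 t 1 0 0 0 1 \<in> elementary_group 3" "mat3 1 0 0 0 1 t 0 0 1 \<in> elementary_group 3"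
    "mat3 1 0 0 0 1 0 t 0 1 \<in> elementary_group 3" "mat3 1 0 0 0 1 0 0 t 1 \<in> elementary_group 3"
    by simp_all
qed

lemma mat3_permutation [simp]:
  "mat3 0 1 0 (- 1) 0 0 0 0 (1 :: 'a :: comm_ring_1) \<in> elementary_group 3"
  "mat3 0 (- 1) 0 1 0 0 0 0 (1 :: 'a :: comm_ring_1) \<in> elementary_group 3"
  "mat3 1 0 0 0 0 1 0 (- 1) (0 :: 'a :: comm_ring_1) \<in> elementary_group 3"
  "mat3 1 0 0 0 0 (- 1) 0 1 (0 :: 'a :: comm_ring_1) \<in> elementary_group 3"
  "mat3 0 1 0 0 0 1 1 0 (0 :: 'a :: comm_ring_1) \<in> elementary_group 3"
  "mat3 0 0 1 1 0 0 0 1 (0 :: 'a :: comm_ring_1) \<in> elementary_group 3"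
proof -
  have *: "mat3 1 t 0 0 1 0 0 0 1 * mat3 1 0 0 (- t) 1 0 0 0 1 * mat3 1 t 0 0 1 0 0 0 1 = mat3 0 t 0 (- t) 0 0 0 0 1"
    "mat3 1 0 0 0 1 t 0 0 1 * mat3 1 0 0 0 1 0 0 (- t) 1 * mat3 1 0 0 0 1 t 0 0 1 = mat3 1 0 0 0 0 t 0 (- t) 0"
    if "t * t = 1" for t :: 'a
    using that by (simp_all add: mat3_mult)
  have E: "mat3 0 t 0 (- t) 0 0 0 0 1 \<in> elementary_group 3" "mat3 1 0 0 0 0 t 0 (- t) 0 \<in> elementary_group 3"
    if "t * t = 1" for t :: 'a
    unfolding *[OF that, symmetric] by simp_all
  show 1: "mat3 0 1 0 (- 1) 0 0 0 0 (1 :: 'a) \<in> elementary_group 3"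
    "mat3 0 (- 1) 0 1 0 0 0 0 (1 :: 'a) \<in> elementary_group 3"
    "mat3 1 0 0 0 0 1 0 (- 1) (0 :: 'a) \<in> elementary_group 3"
    "mat3 1 0 0 0 0 (- 1) 0 1 (0 :: 'a) \<in> elementary_group 3"
    using E[of 1] E[of "- 1"] by simp_all
  have "mat3 0 (- 1) 0 1 0 0 0 0 (1 :: 'a) * mat3 1 0 0 0 0 (- 1) 0 1 0 = mat3 0 0 1 1 0 0 0 1 0"
    by (simp add: mat3_mult)
  then show 2: "mat3 0 0 1 1 0 0 0 1 (0 :: 'a) \<in> elementary_group 3"
    using elementary_group_mult[OF 1(2) 1(4)] by simp
  have "mat3 0 0 1 1 0 0 0 1 (0 :: 'a) * mat3 0 0 1 1 0 0 0 1 0 = mat3 0 1 0 0 0 1 1 0 0"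
    by (simp add: mat3_mult)
  then show "mat3 0 1 0 0 0 1 1 0 (0 :: 'a) \<in> elementary_group 3"
    using elementary_group_mult[OF 2 2] by simp
qed

text \<open>The first columns of \<open>SL\<^sub>2\<close>-matrices whose Mennicke symbol is trivial; vacuously true for pairs that
are not comaximal. Two matrices with the same first column differ by an elementary factor on the
right, which is why all completions can be required at once.\<close>

definition mennicke_trivial :: "'a :: comm_ring_1 \<Rightarrow> 'a \<Rightarrow> bool" where
  "mennicke_trivial p q \<longleftrightarrow>
     (\<forall>c d. p * d - c * q = 1 \<longrightarrow> mat3 p c 0 q d 0 0 0 1 \<in> elementary_group 3)"

lemma mennicke_trivial_iff:
  assumes 1: "p * d - c * q = 1"
  shows "mennicke_trivial p q \<longleftrightarrow> mat3 p c 0 q d 0 0 0 1 \<in> elementary_group 3"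
proof
  assume *: "mat3 p c 0 q d 0 0 0 1 \<in> elementary_group 3"
  show "mennicke_trivial p q"
    unfolding mennicke_trivial_def
  proof (intro allI impI)
    fix c' d' assume 2: "p * d' - c' * q = 1"
    define t where "t = d * c' - c * d'"
    have "p * t + c = c' * (p * d - c * q) - c * (p * d' - c' * q) + c" by (simp add: t_def algebra_simps)
    moreover have "q * t + d = d' * (p * d - c * q) - d * (p * d' - c' * q) + d"
      by (simp add: t_def algebra_simps)
    ultimately have "p * t + c = c'" "q * t + d = d'" by (simp_all add: 1 2)
    then have "mat3 p c 0 q d 0 0 0 1 * mat3 1 t 0 0 1 0 0 0 1 = mat3 p c' 0 q d' 0 0 0 1"
      by (simp add: mat3_mult)
    then show "mat3 p c' 0 q d' 0 0 0 1 \<in> elementary_group 3"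
      using elementary_group_mult[OF * mat3_elementary(1)] by metis
  qed
qed (use 1 in \<open>simp add: mennicke_trivial_def\<close>)

lemma mennicke_trivial_add_imp:
  assumes "mennicke_trivial p q"
  shows "mennicke_trivial p (q + t * p)"
  unfolding mennicke_trivial_def
proof (intro allI impI)
  fix c d assume "p * d - c * (q + t * p) = 1"
  then have "p * (d - t * c) - c * q = 1" by (simp add: algebra_simps)
  then have "mat3 p c 0 q (d - t * c) 0 0 0 1 \<in> elementary_group 3"
    using assms by (simp add: mennicke_trivial_def)
  moreover have "mat3 1 0 0 t 1 0 0 0 1 * mat3 p c 0 q (d - t * c) 0 0 0 1 = mat3 p c 0 (q + t * p) d 0 0 0 1"
    by (simp add: mat3_mult add.commute)
  ultimately show "mat3 p c 0 (q + t * p) d 0 0 0 1 \<in> elementary_group 3"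
    by (metis elementary_group_mult mat3_elementary(3))
qed

lemma mennicke_trivial_add: "mennicke_trivial p (q + t * p) \<longleftrightarrow> mennicke_trivial p q"
  using mennicke_trivial_add_imp[of p q t] mennicke_trivial_add_imp[of p "q + t * p" "- t"] by auto

lemma mennicke_trivial_rotate:
  assumes "mennicke_trivial p q"
  shows "mennicke_trivial q (- p)"
  unfolding mennicke_trivial_def
proof (intro allI impI)
  fix c d assume "q * d - c * (- p) = 1"
  then have "p * c - (- d) * q = 1" by (simp add: algebra_simps)
  then have "mat3 p (- d) 0 q c 0 0 0 1 \<in> elementary_group 3"
    using assms unfolding mennicke_trivial_def by blast
  moreover have "mat3 0 1 0 (- 1) 0 0 0 0 1 * mat3 p (- d) 0 q c 0 0 0 1 = mat3 q c 0 (- p) d 0 0 0 1"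
    by (simp add: mat3_mult)
  ultimately show "mat3 q c 0 (- p) d 0 0 0 1 \<in> elementary_group 3"
    by (metis elementary_group_mult mat3_permutation(1))
qed

lemma mennicke_trivial_unit:
  assumes "p dvd 1"
  shows "mennicke_trivial p q"
proof -
  obtain u where u: "p * u = 1" using assms by (auto simp: dvd_def)
  have "mat3 1 p 0 0 1 0 0 0 1 * mat3 1 0 0 (- u) 1 0 0 0 1 * mat3 1 p 0 0 1 0 0 0 1 * mat3 0 (- 1) 0 1 0 0 0 0 1
    = mat3 p 0 0 0 u 0 0 0 1"
    using u by (simp add: mat3_mult mult.commute)
  then have "mat3 p 0 0 0 u 0 0 0 1 \<in> elementary_group 3"
    by (metis elementary_group_mult mat3_elementary(1,3) mat3_permutation(2))
  then have "mennicke_trivial p 0" using mennicke_trivial_iff[of p u 0 0] u by simp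
  then have "mennicke_trivial p (0 + (u * q) * p)" by (simp only: mennicke_trivial_add)
  moreover have "(u * q) * p = q" using u by (metis mult.assoc mult.commute mult_1)
  ultimately show ?thesis by simp
qed

text \<open>Put a completion of \<open>(a, b1)\<close> in the coordinates 0, 1 and multiply from the left by a completion of
\<open>(b2, a)\<close> in the coordinates 1, 2: the first column becomes \<open>(a, b1 b2, a b1)\<close>. Its last entry is a
multiple of \<open>a\<close>, and clearing it also produces an entry 1, so that what remains is a completion of
\<open>(a, b1 b2)\<close> up to a signed permutation.\<close>

lemma mennicke_trivial_mult_minus:
  assumes ab: "mennicke_trivial a b1" and c1: "comaximal a b1" and c2: "comaximal a b2"
  shows "mennicke_trivial a (b1 * b2) \<longleftrightarrow> mennicke_trivial a (- b2)"
proof -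
  obtain x1 y1 where "x1 * a + y1 * b1 = 1" using c1 by (auto simp: comaximal_def)
  then obtain c1 d1 where 1: "a * d1 - c1 * b1 = 1" by (metis diff_minus_eq_add minus_mult_left mult.commute)
  obtain x2 y2 where "x2 * a + y2 * b2 = 1" using c2 by (auto simp: comaximal_def)
  then obtain c2 d2 where 2: "a * d2 - c2 * b2 = 1" by (metis diff_minus_eq_add minus_mult_left mult.commute)
  define \<alpha> where "\<alpha> = mat3 a c1 0 b1 d1 0 0 0 1"
  define \<beta> where "\<beta> = mat3 1 0 0 0 b2 (- d2) 0 a (- c2)"
  \<comment> \<open>\<open>\<beta>\<close> is \<open>(b2, a)\<close> completed, \<open>\<gamma>\<close> is the completion of \<open>(a, b1 b2)\<close> that the computation yields\<close>
  define \<gamma> where "\<gamma> = mat3 a (- (c1 * c2)) 0 (b1 * b2) (d2 - c2 * d1 * b2) 0 0 0 1"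
  have \<alpha>: "\<alpha> \<in> elementary_group 3" using ab 1 by (simp add: \<alpha>_def mennicke_trivial_def)
  have car: "\<alpha> \<in> carrier_mat 3 3" "\<beta> \<in> carrier_mat 3 3" "\<gamma> \<in> carrier_mat 3 3"
    by (simp_all add: \<alpha>_def \<beta>_def \<gamma>_def)
  define L where "L = mat3 1 0 0 0 1 (- (d1 * b2)) 0 0 1 * (mat3 1 0 (- c1) 0 1 0 0 0 1 * mat3 1 0 0 0 1 0 (- b1) 0 1)"
  define Q where "Q = mat3 1 0 0 0 0 (- 1) 0 1 (0 :: 'a)"
  define C where "C = mat3 1 0 0 0 1 c2 0 0 1"
  have E: "L \<in> elementary_group 3" "Q \<in> elementary_group 3" "C \<in> elementary_group 3"
    by (simp_all add: L_def Q_def C_def)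
  have "L * (\<beta> * \<alpha>) * C = \<gamma> * Q"
  proof -
    have s: "a * d1 - b1 * c1 = 1" using 1 by (simp add: mult.commute)
    have "mat3 1 0 0 0 1 0 (- b1) 0 1 * (\<beta> * \<alpha>) = mat3 a c1 0 (b2 * b1) (b2 * d1) (- d2) 0 1 (- c2)"
      using s by (simp add: \<alpha>_def \<beta>_def mat3_mult mult.commute)
    then have "L * (\<beta> * \<alpha>) = mat3 1 0 0 0 1 (- (d1 * b2)) 0 0 1 * (mat3 1 0 (- c1) 0 1 0 0 0 1 *
        mat3 a c1 0 (b2 * b1) (b2 * d1) (- d2) 0 1 (- c2))"
      unfolding L_def by (simp only: assoc_mult_mat[of _ 3 3 _ 3 _ 3] mat3_carrier mult_carrier_mat[of _ 3 3] car)
    also have "\<dots> = mat3 a 0 (c1 * c2) (b1 * b2) 0 (c2 * d1 * b2 - d2) 0 1 (- c2)"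
      by (simp add: mat3_mult mult_ac)
    finally show ?thesis by (simp add: C_def Q_def \<gamma>_def mat3_mult)
  qed
  then have "\<gamma> \<in> elementary_group 3 \<longleftrightarrow> L * (\<beta> * \<alpha>) * C \<in> elementary_group 3"
    using elementary_group_cancel_right[OF E(2) car(3)] by simp
  also have "\<dots> \<longleftrightarrow> \<beta> \<in> elementary_group 3"
    using elementary_group_cancel_right[OF E(3), of "L * (\<beta> * \<alpha>)"] elementary_group_cancel_left[OF E(1), of "\<beta> * \<alpha>"]
      elementary_group_cancel_right[OF \<alpha> car(2)] mult_carrier_mat[OF car(2,1)]
      mult_carrier_mat[OF elementary_group_carrier[OF E(1)] mult_carrier_mat[OF car(2,1)]]
    by simp
  also have "\<beta> \<in> elementary_group 3 \<longleftrightarrow> mat3 a (- c2) 0 (- b2) d2 0 0 0 1 \<in> elementary_group 3"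
  proof -
    \<comment> \<open>turn \<open>(b2, a)\<close> into \<open>(a, - b2)\<close>, then move the block to the coordinates 0, 1\<close>
    have "mat3 0 1 0 0 0 1 1 0 0 * (mat3 1 0 0 0 0 1 0 (- 1) 0 * \<beta>) * mat3 0 0 1 1 0 0 0 1 0
      = mat3 a (- c2) 0 (- b2) d2 0 0 0 1"
      by (simp add: \<beta>_def mat3_mult)
    moreover have "mat3 1 0 0 0 0 1 0 (- 1) 0 * \<beta> \<in> carrier_mat 3 3"
      using mult_carrier_mat[OF mat3_carrier car(2)] .
    moreover from this have "mat3 0 1 0 0 0 1 1 0 0 * (mat3 1 0 0 0 0 1 0 (- 1) 0 * \<beta>) \<in> carrier_mat 3 3"
      using mult_carrier_mat[OF mat3_carrier] by blast
    ultimately show ?thesis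
      using elementary_group_cancel_right[OF mat3_permutation(6)[where ?'a = 'a]]
        elementary_group_cancel_left[OF mat3_permutation(5)[where ?'a = 'a]]
        elementary_group_cancel_left[OF mat3_permutation(3)[where ?'a = 'a] car(2)]
      by metis
  qed
  also have "\<dots> \<longleftrightarrow> mennicke_trivial a (- b2)"
    using 2 by (intro mennicke_trivial_iff[symmetric]) (simp add: algebra_simps)
  finally have "\<gamma> \<in> elementary_group 3 \<longleftrightarrow> mennicke_trivial a (- b2)" .
  moreover have "a * (d2 - c2 * d1 * b2) - (- (c1 * c2)) * (b1 * b2) = 1"
  proof -
    have "a * (d2 - c2 * d1 * b2) - (- (c1 * c2)) * (b1 * b2)
      = (a * d2 - c2 * b2) - c2 * b2 * ((a * d1 - c1 * b1) - 1)" by (simp add: algebra_simps)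
    then show ?thesis by (simp add: 1 2)
  qed
  ultimately show ?thesis unfolding \<gamma>_def using mennicke_trivial_iff by blast
qed

lemma mennicke_trivial_minus: "mennicke_trivial a (- b) \<longleftrightarrow> mennicke_trivial a b"
proof (cases "comaximal a b")
  case True
  have "mennicke_trivial a 1"
  proof -
    have "mat3 a (a - 1) 0 1 1 0 0 0 1 = mat3 1 (a - 1) 0 0 1 0 0 0 1 * mat3 1 0 0 1 1 0 0 0 1"
      by (simp add: mat3_mult)
    then have "mat3 a (a - 1) 0 1 1 0 0 0 1 \<in> elementary_group 3" by simp
    then show ?thesis using mennicke_trivial_iff[of a 1 "a - 1" 1] by simp
  qed
  then show ?thesis using mennicke_trivial_mult_minus[of a 1 b] True by (simp add: comaximal_unit)
next
  case False
  then have "mennicke_trivial a b" if "\<not> comaximal a b" for b :: 'a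
    using that unfolding mennicke_trivial_def comaximal_def
    by (metis add.commute diff_conv_add_uminus minus_mult_left mult.commute)
  then show ?thesis using False by simp
qed

lemma mennicke_trivial_mult:
  assumes "mennicke_trivial a b" "comaximal a b" "comaximal a c"
  shows "mennicke_trivial a (b * c) \<longleftrightarrow> mennicke_trivial a c"
  using mennicke_trivial_mult_minus[OF assms] by (simp add: mennicke_trivial_minus)

lemma mennicke_trivial_commute: "mennicke_trivial p q \<longleftrightarrow> mennicke_trivial q p"
  using mennicke_trivial_rotate[of p q] mennicke_trivial_rotate[of q p] by (auto simp: mennicke_trivial_minus)

lemma mennicke_trivial_power:
  assumes "mennicke_trivial a b" "comaximal a b"
  shows "mennicke_trivial a (b ^ k)"
proof (induction k)
  case 0
  show ?case using mennicke_trivial_unit[of 1 a] mennicke_trivial_commute[of a 1] by simp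
next
  case (Suc k)
  then show ?case using mennicke_trivial_mult[OF assms comaximal_power[OF assms(2)]] by simp
qed

lemma mennicke_trivial_unit_right: "q dvd 1 \<Longrightarrow> mennicke_trivial p q"
  using mennicke_trivial_unit mennicke_trivial_commute by blast

section \<open>Polynomials over a valuation ring\<close>

text \<open>Prime ideals. Two of them occur: the nonunits of a valuation ring, and the elements that divide no
power of a given element.\<close>

definition prime_set :: "'a :: comm_ring_1 set \<Rightarrow> bool" where
  "prime_set P \<longleftrightarrow> 0 \<in> P \<and> 1 \<notin> P \<and> (\<forall>a\<in>P. \<forall>b\<in>P. a + b \<in> P) \<and> (\<forall>a\<in>P. \<forall>r. r * a \<in> P)
     \<and> (\<forall>a b. a * b \<in> P \<longrightarrow> a \<in> P \<or> b \<in> P)"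

lemma prime_set_sum:
  assumes "prime_set P" "\<And>i. i \<in> I \<Longrightarrow> f i \<in> P"
  shows "sum f I \<in> P"
  using assms(2)
proof (induction I rule: infinite_finite_induct)
  case (insert i I)
  then show ?case using assms(1) by (simp add: prime_set_def)
qed (use assms(1) in \<open>simp_all add: prime_set_def\<close>)

lemma prime_set_add_iff:
  assumes "prime_set P" "b \<in> P"
  shows "a + b \<in> P \<longleftrightarrow> a \<in> P"
proof
  assume "a + b \<in> P"
  moreover have "(- 1) * b \<in> P" using assms unfolding prime_set_def by blast
  ultimately have "a + b + (- 1) * b \<in> P" using assms(1) unfolding prime_set_def by blast
  then show "a \<in> P" by simp
qed (use assms in \<open>simp add: prime_set_def\<close>)

lemma prime_set_mult: "prime_set P \<Longrightarrow> a \<in> P \<or> b \<in> P \<Longrightarrow> a * b \<in> P"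
  unfolding prime_set_def by (metis mult.commute)

text \<open>The degree of the reduction of \<open>f\<close> modulo \<open>P\<close>; it is a relation because the reduction may be zero.\<close>

definition residue_degree :: "'a :: comm_ring_1 set \<Rightarrow> 'a poly \<Rightarrow> nat \<Rightarrow> bool" where
  "residue_degree P f d \<longleftrightarrow> coeff f d \<notin> P \<and> (\<forall>i>d. coeff f i \<in> P)"

lemma residue_degree_exists:
  assumes "prime_set P" "coeff f i \<notin> P"
  obtains d where "residue_degree P f d" "i \<le> d"
proof -
  let ?S = "{i. coeff f i \<notin> P}"
  have S: "?S \<subseteq> {..degree f}"
  proof
    fix i assume "i \<in> ?S"
    then have "coeff f i \<noteq> 0" using assms(1) by (auto simp: prime_set_def)
    then show "i \<in> {..degree f}" by (simp add: le_degree)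
  qed
  then have fin: "finite ?S" by (rule finite_subset) simp
  have "residue_degree P f (Max ?S)"
    unfolding residue_degree_def using Max_in[OF fin] assms(2) Max_ge[OF fin] by fastforce
  then show ?thesis using that Max_ge[OF fin, of i] assms(2) by blast
qed

text \<open>The reduction of the coefficients is an integral domain.\<close>

lemma residue_degree_mult:
  assumes P: "prime_set P" and f: "residue_degree P f d" and g: "residue_degree P g e"
  shows "residue_degree P (f * g) (d + e)"
proof -
  have A: "coeff f i * coeff g j \<in> P" if "i > d \<or> j > e" for i j
    using that f g prime_set_mult[OF P] unfolding residue_degree_def by blast
  have "coeff (f * g) k \<in> P" if "k > d + e" for k
    unfolding coeff_mult using that by (intro prime_set_sum[OF P] A) auto
  moreover have "coeff (f * g) (d + e) = coeff f d * coeff g e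
      + (\<Sum>i\<in>{..d + e} - {d}. coeff f i * coeff g (d + e - i))"
    unfolding coeff_mult by (subst sum.remove[of _ d]) auto
  moreover have "(\<Sum>i\<in>{..d + e} - {d}. coeff f i * coeff g (d + e - i)) \<in> P"
    by (intro prime_set_sum[OF P] A) auto
  moreover have "coeff f d * coeff g e \<notin> P"
    using f g P unfolding residue_degree_def prime_set_def by blast
  ultimately show ?thesis
    unfolding residue_degree_def using prime_set_add_iff[OF P] by metis
qed

lemma residue_degree_mult_zero:
  assumes P: "prime_set P" and f: "\<And>i. coeff f i \<in> P"
  shows "coeff (f * g) i \<in> P"
  unfolding coeff_mult using f by (intro prime_set_sum[OF P] prime_set_mult[OF P]) auto

lemma poly_eq_x_mult:
  fixes f :: "'a :: comm_ring_1 poly"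
  assumes "coeff f 0 = 0"
  obtains g where "f = [:0, 1:] * g" "\<And>i. coeff g i = coeff f (Suc i)"
proof (cases f)
  case (pCons a g)
  then have "f = [:0, 1:] * g" "\<And>i. coeff g i = coeff f (Suc i)" using assms by simp_all
  then show ?thesis using that by blast
qed

locale valuation_type =
  fixes ty :: "'a :: comm_ring_1 itself"
  assumes total: "(a :: 'a) dvd b \<or> b dvd a"
begin

definition nonunits :: "'a set" where "nonunits = {a. \<not> a dvd 1}"

lemma prime_set_nonunits: "prime_set nonunits"
  unfolding prime_set_def
proof (intro conjI ballI allI impI)
  fix a b :: 'a
  assume ab: "a \<in> nonunits" "b \<in> nonunits"
  have "a dvd a + b \<or> b dvd a + b" using total[of a b] by auto
  then show "a + b \<in> nonunits" using ab unfolding nonunits_def mem_Collect_eq by (meson dvd_trans)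
next
  fix a r :: 'a
  assume "a \<in> nonunits"
  then show "r * a \<in> nonunits" unfolding nonunits_def by (auto dest: dvd_mult_right)
next
  fix a b :: 'a
  assume ab: "a * b \<in> nonunits"
  show "a \<in> nonunits \<or> b \<in> nonunits"
    using ab mult_dvd_mono[of a 1 b 1] unfolding nonunits_def by auto
qed (auto simp: nonunits_def)

lemma unit_iff: "a dvd 1 \<longleftrightarrow> a \<notin> nonunits" for a :: 'a
  by (simp add: nonunits_def)

lemma minimal_divisor:
  fixes A :: "'a set"
  assumes "finite A" "A \<noteq> {}"
  obtains a where "a \<in> A" "\<And>b. b \<in> A \<Longrightarrow> a dvd b"
proof -
  have "\<exists>a\<in>A. \<forall>b\<in>A. a dvd b"
    using assms
  proof (induction A rule: finite_ne_induct)
    case (insert x A)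
    then obtain a where "a \<in> A" "\<forall>b\<in>A. a dvd b" by blast
    then show ?case using total[of a x] by (metis dvd_refl dvd_trans insert_iff)
  qed auto
  then show ?thesis using that by blast
qed

text \<open>The content \<open>b\<close> is itself a coefficient, namely one that divides all the others, and so the
corresponding coefficient of the cofactor can be chosen to be 1.\<close>

lemma content:
  fixes p :: "'a poly"
  assumes "p \<noteq> 0"
  obtains b q j where "p = [:b:] * q" "coeff q j = 1" "degree q \<le> degree p"
    "coeff p j = b" "\<And>i. b dvd coeff p i"
proof -
  obtain b where b: "b \<in> coeff p ` {..degree p}" "\<And>c. c \<in> coeff p ` {..degree p} \<Longrightarrow> b dvd c"
    by (rule minimal_divisor[of "coeff p ` {..degree p}"]) auto
  obtain j where j: "j \<le> degree p" "b = coeff p j" using b by blast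
  define c where "c i = (if i = j then 1 else SOME c. coeff p i = b * c)" for i
  have c: "coeff p i = b * c i" if i: "i \<le> degree p" for i
  proof (cases "i = j")
    case False
    have "b dvd coeff p i" using b(2) i by blast
    then have "\<exists>c. coeff p i = b * c" by (auto simp: dvd_def)
    then show ?thesis using False someI_ex[of "\<lambda>c. coeff p i = b * c"] by (simp add: c_def)
  qed (simp add: c_def j)
  define q where "q = (\<Sum>i\<le>degree p. monom (c i) i)"
  have q: "coeff q i = (if i \<le> degree p then c i else 0)" for i
    by (simp add: q_def coeff_sum)
  show ?thesis
  proof (rule that)
    show "p = [:b:] * q"
      by (rule poly_eqI) (use c in \<open>auto simp: q not_le coeff_eq_0\<close>)
    show "coeff q j = 1" using j by (simp add: q c_def)
    show "degree q \<le> degree p" by (rule degree_le) (simp add: q)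
    show "coeff p j = b" using j by simp
    show "b dvd coeff p i" for i
      using b(2)[of "coeff p i"] by (cases "i \<le> degree p") (auto simp: not_le coeff_eq_0)
  qed
qed

text \<open>Congruence to a unit of the ring of constants modulo the nonunits.\<close>

abbreviation residually_unit :: "'a poly \<Rightarrow> bool" where
  "residually_unit p \<equiv> residue_degree nonunits p 0"

lemma residually_unit_coeff_0: "residually_unit p \<Longrightarrow> coeff p 0 dvd 1"
  by (simp add: residue_degree_def unit_iff)

text \<open>If \<open>p(0)\<close> is a unit, then \<open>x\<close> is invertible modulo \<open>p\<close>, and division by \<open>x\<close> lowers degrees.\<close>

lemma reduce_x:
  fixes p q :: "'a poly"
  assumes "coeff p 0 dvd 1"
  obtains c g where "q = [:c:] * p + [:0, 1:] * g" "\<And>i. coeff g i = coeff q (Suc i) - c * coeff p (Suc i)"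
proof -
  obtain u where u: "1 = coeff p 0 * u" using assms by (auto simp: dvd_def)
  define c where "c = coeff q 0 * u"
  have "c * coeff p 0 = coeff q 0 * (coeff p 0 * u)" by (simp add: c_def mult_ac)
  then have "coeff (q - [:c:] * p) 0 = 0" by (simp add: u[symmetric])
  then obtain g where g: "q - [:c:] * p = [:0, 1:] * g" "\<And>i. coeff g i = coeff (q - [:c:] * p) (Suc i)"
    by (rule poly_eq_x_mult) blast
  show ?thesis
  proof (rule that)
    show "q = [:c:] * p + [:0, 1:] * g" using g(1) by (simp add: algebra_simps)
    show "coeff g i = coeff q (Suc i) - c * coeff p (Suc i)" for i using g(2) by simp
  qed
qed

lemma const_unit: "b dvd 1 \<Longrightarrow> [:b:] dvd (1 :: 'a poly)"
proof -
  assume "b dvd 1"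
  then obtain u where "1 = b * u" by (auto simp: dvd_def)
  then have "1 = [:b:] * [:u:]" by (simp add: one_pCons mult.commute)
  then show ?thesis by (rule dvdI)
qed

lemma comaximal_x:
  assumes "coeff p 0 dvd (1 :: 'a)"
  shows "comaximal p [:0, 1:]" "mennicke_trivial p [:0, 1:]"
proof -
  obtain a g where p: "p = pCons a g" by (cases p)
  then have u: "[:a:] dvd 1" using assms const_unit by simp
  have p': "p = [:a:] + g * [:0, 1:]" using p by (simp add: mult.commute)
  show "comaximal p [:0, 1:]"
    unfolding p' comaximal_commute[of _ "[:0, 1:]"] comaximal_add using u by (rule comaximal_unit)
  show "mennicke_trivial p [:0, 1:]"
    unfolding p' mennicke_trivial_commute[of _ "[:0, 1:]"] mennicke_trivial_add
    using u by (rule mennicke_trivial_unit_right)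
qed

lemma division_unit_lead:
  fixes p g :: "'a poly"
  assumes lc: "lead_coeff g dvd 1"
  shows "\<exists>h. \<forall>i\<ge>degree g. coeff (p - h * g) i = 0"
proof (induction "degree p" arbitrary: p rule: less_induct)
  case less
  obtain u where u: "1 = lead_coeff g * u" using lc by (auto simp: dvd_def)
  show ?case
  proof (cases "degree p < degree g")
    case True
    then have "\<forall>i\<ge>degree g. coeff (p - 0 * g) i = 0" by (auto intro: coeff_eq_0)
    then show ?thesis by blast
  next
    case False
    define t where "t = monom (lead_coeff p * u) (degree p - degree g)"
    have top: "coeff (t * g) (degree p) = lead_coeff p"
    proof -
      have "coeff (t * g) (degree p) = (lead_coeff p * u) * lead_coeff g"
        using False by (simp add: t_def coeff_monom_mult)
      also have "\<dots> = lead_coeff p * (lead_coeff g * u)" by (simp add: mult_ac)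
      finally have "coeff (t * g) (degree p) = lead_coeff p * (lead_coeff g * u)" .
      then show ?thesis by (simp add: u[symmetric])
    qed
    have dt: "degree (t * g) \<le> degree p"
      using degree_mult_le[of t g] degree_monom_le[of "lead_coeff p * u" "degree p - degree g"] False
      by (simp add: t_def)
    show ?thesis
    proof (cases "degree p = 0")
      case True
      have "p - t * g = 0"
      proof (rule poly_eqI)
        fix i show "coeff (p - t * g) i = coeff 0 i"
          using top True dt by (cases i) (auto simp: coeff_eq_0)
      qed
      then have "\<forall>i\<ge>degree g. coeff (p - t * g) i = 0" by simp
      then show ?thesis by blast
    next
      case pos: False
      have "degree (p - t * g) < degree p"
      proof (rule degree_lessI)
        show "p - t * g \<noteq> 0 \<or> 0 < degree p" using pos by simp
        show "\<forall>k\<ge>degree p. coeff (p - t * g) k = 0"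
          using top dt by (metis coeff_diff coeff_eq_0 diff_self le_neq_implies_less order_le_less_trans)
      qed
      from less[OF this] obtain h where "\<forall>i\<ge>degree g. coeff (p - t * g - h * g) i = 0" by blast
      then have "\<forall>i\<ge>degree g. coeff (p - (t + h) * g) i = 0" by (simp add: algebra_simps)
      then show ?thesis by blast
    qed
  qed
qed

lemma residue_degree_unit_lead: "lead_coeff g dvd 1 \<Longrightarrow> residue_degree nonunits g (degree g)"
  using prime_set_nonunits by (simp add: residue_degree_def unit_iff coeff_eq_0 prime_set_def)

text \<open>If the quotient \<open>h\<close> had a unit coefficient, then \<open>h g\<close> and hence \<open>p\<close> would have one in a positive
degree.\<close>

lemma residually_unit_remainder:
  assumes p: "residually_unit p" and g: "lead_coeff g dvd 1" "degree g > 0"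
    and r: "\<forall>i\<ge>degree g. coeff (p - h * g) i = 0"
  shows "residually_unit (p - h * g)"
proof -
  have h: "coeff h i \<in> nonunits" for i
  proof (rule ccontr)
    assume "coeff h i \<notin> nonunits"
    then obtain e where e: "residue_degree nonunits h e" by (rule residue_degree_exists[OF prime_set_nonunits])
    have "residue_degree nonunits (h * g) (e + degree g)"
      by (rule residue_degree_mult[OF prime_set_nonunits e residue_degree_unit_lead[OF g(1)]])
    moreover have "coeff p (e + degree g) = coeff (h * g) (e + degree g)" using r by simp
    moreover have "e + degree g > 0" using g(2) by simp
    ultimately show False using p unfolding residue_degree_def by metis
  qed
  have hg: "- coeff (h * g) i \<in> nonunits" for i
    using residue_degree_mult_zero[OF prime_set_nonunits h, of g i] by (simp add: nonunits_def)
  show ?thesis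
    using p prime_set_add_iff[OF prime_set_nonunits hg] unfolding residue_degree_def
    by (metis add_uminus_conv_diff coeff_diff)
qed

text \<open>The remainder \<open>r\<close> of \<open>p\<close> modulo \<open>g\<close> is still congruent to a unit, so \<open>r(0)\<close> is a unit. Then some
\<open>g - c r\<close> is divisible by \<open>x\<close>; the quotient \<open>f\<close> has the leading coefficient of \<open>g\<close> and a degree that is
smaller by one. The symbol of \<open>(p, g)\<close> is that of \<open>(r, x f)\<close>, and \<open>x\<close> contributes nothing.\<close>

lemma residually_unit_unit_lead:
  fixes p g :: "'a poly"
  assumes "residually_unit p" "lead_coeff g dvd 1"
  shows "comaximal p g \<and> mennicke_trivial p g"
  using assms
proof (induction "degree g" arbitrary: p g)
  case 0
  then have "g = [:coeff g 0:]" by (metis degree_0_id)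
  then have "g dvd 1" using 0 const_unit by (metis)
  then show ?case by (simp add: comaximal_unit mennicke_trivial_unit_right)
next
  case (Suc d)
  obtain h where h: "\<forall>i\<ge>degree g. coeff (p - h * g) i = 0"
    using division_unit_lead[OF Suc.prems(2)] by blast
  define r where "r = p - h * g"
  have r: "residually_unit r" unfolding r_def using residually_unit_remainder[OF Suc.prems _ h] Suc.hyps(2) by simp
  obtain c f where cf: "g = [:c:] * r + [:0, 1:] * f"
      "\<And>i. coeff f i = coeff g (Suc i) - c * coeff r (Suc i)"
    using reduce_x[OF residually_unit_coeff_0[OF r]] by blast
  have rd: "coeff r i = 0" if "i \<ge> Suc d" for i
    using h that Suc.hyps(2) by (simp add: r_def)
  have fd: "coeff f d = lead_coeff g" using cf(2)[of d] rd[of "Suc d"] Suc.hyps(2) by simp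
  have "degree f \<le> d" 
    by (rule degree_le) (use cf(2) rd Suc.hyps(2) in \<open>auto intro: coeff_eq_0\<close>)
  moreover have "coeff f d \<noteq> 0" using fd Suc.prems(2) by auto
  ultimately have df: "degree f = d" using le_degree[of f d] by simp
  have IH: "comaximal r f \<and> mennicke_trivial r f"
    using Suc.hyps(1)[of f r] df r fd Suc.prems(2) by simp
  note x = comaximal_x[OF residually_unit_coeff_0[OF r]]
  have "comaximal r ([:0, 1:] * f)" using IH x by (simp only: comaximal_mult_iff)
  then have "comaximal r g" unfolding cf(1) using comaximal_add[of r "[:0, 1:] * f" "[:c:]"] by (simp only: add.commute)
  moreover have "mennicke_trivial r ([:0, 1:] * f)"
    using mennicke_trivial_mult[OF x(2,1)] IH by blast
  then have "mennicke_trivial r g"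
    unfolding cf(1) using mennicke_trivial_add[of r "[:0, 1:] * f" "[:c:]"] by (simp only: add.commute)
  moreover have "p = r + h * g" by (simp add: r_def)
  ultimately show ?case
    by (metis comaximal_add comaximal_commute mennicke_trivial_add mennicke_trivial_commute)
qed

lemma division_x:
  fixes p q :: "'a poly"
  assumes p: "coeff p 0 dvd 1" "degree p \<le> m" and m: "m > 0"
  shows "\<exists>N r t. q = [:0, 1:] ^ N * r + t * p \<and> degree r < m"
proof (induction "degree q" arbitrary: q rule: less_induct)
  case less
  show ?case
  proof (cases "degree q < m")
    case True
    then have "q = [:0, 1:] ^ 0 * q + 0 * p \<and> degree q < m" by simp
    then show ?thesis by blast
  next
    case False
    obtain c g where cg: "q = [:c:] * p + [:0, 1:] * g"
        "\<And>i. coeff g i = coeff q (Suc i) - c * coeff p (Suc i)"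
      using reduce_x[OF p(1)] by blast
    have "degree g \<le> degree q - 1"
      by (rule degree_le) (use cg(2) p(2) False m in \<open>auto simp: coeff_eq_0\<close>)
    then have "degree g < degree q" using False m by simp
    from less[OF this] obtain N r t where "g = [:0, 1:] ^ N * r + t * p" "degree r < m" by blast
    then have "q = [:0, 1:] ^ Suc N * r + ([:c:] + [:0, 1:] * t) * p"
      using cg(1) by (simp add: algebra_simps del: mult_pCons_left)
    then show ?thesis using \<open>degree r < m\<close> by blast
  qed
qed

lemma const_mult_nonunit: "a \<in> nonunits \<Longrightarrow> a * b \<in> nonunits" "a \<in> nonunits \<Longrightarrow> b * a \<in> nonunits"
  using prime_set_mult[OF prime_set_nonunits] by blast+

text \<open>Otherwise the elements that divide no power of \<open>a\<close> form a prime ideal \<open>P\<close>, which contains \<open>b\<close> but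
not \<open>a\<close>. Modulo \<open>P\<close> the polynomial \<open>p\<close> is invertible and has positive degree, which is impossible
over a domain.\<close>

lemma divides_power:
  fixes p :: "'a poly"
  assumes p: "coeff p j = a" "j > 0" and co: "comaximal p [:b:]"
  shows "\<exists>N. b dvd a ^ N"
proof (rule ccontr)
  assume b: "\<nexists>N. b dvd a ^ N"
  define P where "P = {z. \<forall>N. \<not> z dvd a ^ N}"
  have P: "prime_set P"
    unfolding prime_set_def
  proof (intro conjI ballI allI impI)
    fix y z assume yz: "y \<in> P" "z \<in> P"
    have "y dvd y + z \<or> z dvd y + z" using total[of y z] by auto
    then show "y + z \<in> P" using yz unfolding P_def mem_Collect_eq by (meson dvd_trans)
  next
    fix z r assume "z \<in> P"
    then show "r * z \<in> P" unfolding P_def by (auto dest: dvd_mult_right)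
  next
    fix y z assume yz: "y * z \<in> P"
    have False if "y dvd a ^ k" "z dvd a ^ l" for k l
      using mult_dvd_mono[OF that] yz unfolding P_def by (simp add: power_add[symmetric])
    then show "y \<in> P \<or> z \<in> P" unfolding P_def by blast
  next
    have False if "a ^ k = 0" for k using b dvd_0_right[of b] unfolding that[symmetric] by blast
    then show "0 \<in> P" unfolding P_def by auto
    show "1 \<notin> P" unfolding P_def by simp
  qed
  have bP: "b \<in> P" using b by (simp add: P_def)
  have "a dvd a ^ 1" by simp
  then have "a \<notin> P" unfolding P_def by blast
  then obtain d where d: "residue_degree P p d" "j \<le> d" using residue_degree_exists[OF P] p(1) by metis
  obtain f e where fe: "f * p + e * [:b:] = 1" using co by (auto simp: comaximal_def)
  have eb: "coeff (e * [:b:]) i \<in> P" for i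
    using prime_set_mult[OF P, of "coeff e i" b] bP by (simp add: mult.commute)
  have fp: "coeff (f * p) i \<in> P \<longleftrightarrow> coeff 1 i \<in> P" for i
    using prime_set_add_iff[OF P eb, of "coeff (f * p) i" i] by (simp add: fe[symmetric])
  have "\<exists>i. coeff f i \<notin> P"
  proof (rule ccontr)
    assume "\<nexists>i. coeff f i \<notin> P"
    then have "coeff (f * p) 0 \<in> P" by (intro residue_degree_mult_zero[OF P]) blast
    then show False using fp[of 0] P by (simp add: prime_set_def)
  qed
  then obtain k where "residue_degree P f k" using residue_degree_exists[OF P] by metis
  from residue_degree_mult[OF P this d(1)] have "coeff (f * p) (k + d) \<notin> P" by (simp add: residue_degree_def)
  moreover have "coeff (1 :: 'a poly) (k + d) \<in> P" using d(2) p(2) P by (simp add: prime_set_def)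
  ultimately show False using fp by blast
qed

text \<open>Let \<open>a\<close> be the content of \<open>p - p(0)\<close>. If \<open>c\<close> divides \<open>a\<close>, then \<open>p\<close> is congruent to the unit \<open>p(0)\<close>
modulo \<open>c\<close>, and the symbol of \<open>(p, c)\<close> is trivial. In general \<open>b\<close> divides a power of \<open>a\<close>. If the
smallest exponent is \<open>N = k + 1 > 1\<close>, then \<open>b = a\<^sup>k c\<close>, and either \<open>c\<close> divides \<open>a\<close>, or \<open>c = a t\<close> where
\<open>t\<close> is a unit or \<open>a\<^sup>N = 0\<close>.\<close>

lemma mennicke_trivial_const:
  fixes p :: "'a poly"
  assumes p0: "coeff p 0 dvd 1" and co: "comaximal p [:b:]"
  shows "mennicke_trivial p [:b:]"
proof (cases "p - [:coeff p 0:] = 0")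
  case True
  then have "p dvd 1" using const_unit[OF p0] by simp
  then show ?thesis by (rule mennicke_trivial_unit)
next
  case False
  obtain a f j where f: "p - [:coeff p 0:] = [:a:] * f" "coeff f j = 1" "coeff (p - [:coeff p 0:]) j = a"
      "\<And>i. a dvd coeff (p - [:coeff p 0:]) i"
    using content[OF False] by metis
  have "j \<noteq> 0 \<or> a = 0" using f(3) by (cases j) auto
  moreover have "a \<noteq> 0" using f(1) False by auto
  ultimately have j: "j > 0" by simp
  have pj: "coeff p j = a" using f(3) j by (cases j) auto
  have base: "mennicke_trivial p [:c:]" if "c dvd a" for c
  proof -
    obtain t where "a = c * t" using \<open>c dvd a\<close> by (auto simp: dvd_def)
    then have "p = [:coeff p 0:] + (smult t f) * [:c:]"
      using f(1) by (simp add: algebra_simps)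
    then show ?thesis
      using mennicke_trivial_add[of "[:c:]" "[:coeff p 0:]" "smult t f"]
        mennicke_trivial_unit_right[OF const_unit[OF p0], of "[:c:]"]
      by (metis mennicke_trivial_commute)
  qed
  have "\<exists>N. b dvd a ^ N" by (rule divides_power[OF pj j co])
  then obtain N where N: "b dvd a ^ N" "\<And>k. k < N \<Longrightarrow> \<not> b dvd a ^ k"
    using exists_least_iff[of "\<lambda>N. b dvd a ^ N"] by metis
  show ?thesis
  proof (cases "N \<le> 1")
    case True
    then have "b dvd a" using N(1) by (cases N) (auto intro: dvd_trans)
    then show ?thesis by (rule base)
  next
    case False
    then obtain k where k: "N = Suc k" "k > 0" by (cases N) auto
    have "a ^ k dvd b" using N(2)[of k] k total by blast
    then obtain c where c: "b = a ^ k * c" by (auto simp: dvd_def)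
    have bb: "[:b:] = [:a:] ^ k * [:c:]" by (simp add: c poly_const_pow)
    have cc: "comaximal p [:c:]" using co unfolding bb comaximal_mult_iff by blast
    have "comaximal p ([:a:] ^ k)" using co unfolding bb comaximal_mult_iff by blast
    moreover obtain k' where "k = Suc k'" using k(2) gr0_conv_Suc by blast
    ultimately have "comaximal p ([:a:] * [:a:] ^ k')" by (simp only: power_Suc)
    then have ca: "comaximal p [:a:]" unfolding comaximal_mult_iff ..
    have ma: "mennicke_trivial p [:a:]" by (rule base) simp
    have "mennicke_trivial p [:c:]"
    proof (cases "c dvd a")
      case False
      then obtain t where t: "c = a * t" using total[of c a] by (auto simp: dvd_def)
      obtain e where "a ^ N = b * e" using N(1) by (auto simp: dvd_def)
      also have "b * e = a ^ N * (t * e)" by (simp add: c t k(1) mult_ac)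
      finally have aN: "a ^ N = a ^ N * (t * e)" .
      have e: "a ^ N * (1 - t * e) = 0" unfolding right_diff_distrib mult_1_right aN[symmetric] by simp
      show ?thesis
      proof (cases "t dvd 1")
        case True
        have ct: "[:c:] = [:a:] * [:t:]" using t by simp
        have "comaximal p [:t:]" using const_unit[OF True] by (rule comaximal_unit)
        then show ?thesis unfolding ct
          using mennicke_trivial_mult[OF ma ca] mennicke_trivial_unit_right[OF const_unit[OF True]] by blast
      next
        case False
        then have "- (t * e) \<in> nonunits" using const_mult_nonunit(1)[of t e] by (simp add: nonunits_def)
        then have "1 - t * e \<notin> nonunits"
          using prime_set_add_iff[OF prime_set_nonunits, of "- (t * e)" 1] by (simp add: nonunits_def)
        then obtain u where u: "1 = (1 - t * e) * u" by (auto simp: nonunits_def dvd_def)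
        \<comment> \<open>zero divisors: here \<open>a\<^sup>N = 0\<close>, hence \<open>b = 0\<close> and \<open>p\<close> is a unit\<close>
        have "a ^ N = a ^ N * ((1 - t * e) * u)" using u by simp
        also have "\<dots> = 0" using e by (simp add: mult.assoc[symmetric])
        finally have "b = 0" using c t k by (simp add: mult.assoc[symmetric] power_commutes)
        then have "p dvd 1" using co unfolding comaximal_def by (metis add.right_neutral dvd_triv_right mult_zero_right pCons_0_0)
        then show ?thesis by (rule mennicke_trivial_unit)
      qed
    qed (rule base)
    then show ?thesis
      unfolding bb using mennicke_trivial_mult[OF mennicke_trivial_power[OF ma ca] comaximal_power[OF ca] cc] by blast
  qed
qed

text \<open>Nakayama's lemma in coordinates: modulo the nonunits the coefficient matrix is triangular with
units on the diagonal. Gaussian elimination starts at the top degree, where the pivot is a unit, and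
changes the remaining polynomials by nonunits only.\<close>

lemma triangular_span:
  fixes F :: "nat \<Rightarrow> 'a poly"
  assumes "\<And>i. i < N \<Longrightarrow> residue_degree nonunits (F i) i"
    and "\<And>i k. i < N \<Longrightarrow> k \<ge> N \<Longrightarrow> coeff (F i) k = 0"
    and "\<And>k. k \<ge> N \<Longrightarrow> coeff f k = 0"
  shows "\<exists>c. f = (\<Sum>i<N. [:c i:] * F i)"
  using assms
proof (induction N arbitrary: F f)
  case 0
  then have "f = 0" by (intro poly_eqI) simp
  then show ?case by simp
next
  case (Suc N)
  have "coeff (F N) N dvd 1" using Suc.prems(1)[of N] by (simp add: residue_degree_def unit_iff)
  then obtain u where u: "coeff (F N) N * u = 1" by (auto simp: dvd_def)
  define \<mu> where "\<mu> g = coeff g N * u" for g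
  have top: "coeff (g - [:\<mu> g:] * F N) N = 0" for g
  proof -
    have "coeff (g - [:\<mu> g:] * F N) N = coeff g N - coeff g N * (coeff (F N) N * u)"
      by (simp add: \<mu>_def mult_ac)
    then show ?thesis by (simp add: u)
  qed
  have z: "coeff (g - [:\<mu> g:] * F N) k = 0" if "\<And>k. k \<ge> Suc N \<Longrightarrow> coeff g k = 0" "k \<ge> N" for g k
    using top[of g] that Suc.prems(2)[of N k] by (cases "k = N") auto
  define G where "G i = F i - [:\<mu> (F i):] * F N" for i
  have "\<exists>c. f - [:\<mu> f:] * F N = (\<Sum>i<N. [:c i:] * G i)"
  proof (rule Suc.IH)
    fix i assume i: "i < N"
    then have "coeff (F i) N \<in> nonunits" using Suc.prems(1)[of i] by (simp add: residue_degree_def)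
    then have "- (\<mu> (F i) * coeff (F N) k) \<in> nonunits" for k
      using const_mult_nonunit by (simp add: \<mu>_def nonunits_def)
    then have "coeff (G i) k \<in> nonunits \<longleftrightarrow> coeff (F i) k \<in> nonunits" for k
      using prime_set_add_iff[OF prime_set_nonunits, of "- (\<mu> (F i) * coeff (F N) k)" "coeff (F i) k"]
      by (simp add: G_def)
    then show "residue_degree nonunits (G i) i" using Suc.prems(1)[of i] i by (simp add: residue_degree_def)
    show "coeff (G i) k = 0" if "k \<ge> N" for k
      unfolding G_def using z[OF Suc.prems(2)[of i] that] i by simp
  next
    show "coeff (f - [:\<mu> f:] * F N) k = 0" if "k \<ge> N" for k using z[OF Suc.prems(3) that] .
  qed
  then obtain c where c: "f - [:\<mu> f:] * F N = (\<Sum>i<N. [:c i:] * G i)" by blast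
  define c' where "c' i = (if i = N then \<mu> f - (\<Sum>i<N. c i * \<mu> (F i)) else c i)" for i
  have "(\<Sum>i<N. [:c i:] * G i) = (\<Sum>i<N. [:c i:] * F i) - (\<Sum>i<N. [:c i * \<mu> (F i):] * F N)"
    by (simp add: G_def sum_subtractf smult_diff_right)
  also have "(\<Sum>i<N. [:c i * \<mu> (F i):] * F N) = [:\<Sum>i<N. c i * \<mu> (F i):] * F N"
    by (simp add: smult_sum)
  finally have "f - [:\<mu> f:] * F N = (\<Sum>i<N. [:c i:] * F i) - [:\<Sum>i<N. c i * \<mu> (F i):] * F N"
    using c by simp
  then have "f = (\<Sum>i<N. [:c i:] * F i) + ([:\<mu> f:] - [:\<Sum>i<N. c i * \<mu> (F i):]) * F N"
    by (simp only: algebra_simps)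
  then have "f = (\<Sum>i<N. [:c i:] * F i) + [:c' N:] * F N" by (simp add: c'_def)
  moreover have "(\<Sum>i<N. [:c i:] * F i) = (\<Sum>i<N. [:c' i:] * F i)" by (rule sum.cong) (auto simp: c'_def)
  ultimately have "f = (\<Sum>i<Suc N. [:c' i:] * F i)" by simp
  then show ?case by blast
qed

lemma x_power_monom: "[:0, 1:] ^ k = (monom 1 k :: 'a poly)"
  by (induction k) (simp_all add: monom_Suc)

lemma residue_degree_shift:
  assumes "residue_degree nonunits f d"
  shows "residue_degree nonunits ([:0, 1:] ^ k * f) (k + d)"
proof (rule residue_degree_mult[OF prime_set_nonunits _ assms])
  show "residue_degree nonunits ([:0, 1:] ^ k :: 'a poly) k"
    using prime_set_nonunits by (simp add: residue_degree_def x_power_monom prime_set_def coeff_monom)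
qed

lemma coeff_x_power_mult:
  "coeff ([:0, 1:] ^ k * f) i = (if i < k then 0 else coeff f (i - k))" for f :: "'a poly"
  by (simp add: x_power_monom coeff_monom_mult)

text \<open>Weierstrass preparation in \<open>V[y]/(y\<^sup>m p(1/y))\<close>, \<open>y = 1/x\<close>, multiplied by a power of \<open>x\<close>. The polynomials
\<open>x\<^sup>i p\<close> for \<open>i < e\<close>, \<open>x\<^sup>i q\<close> for \<open>i \<le> e\<close> and \<open>x\<^sup>i\<close> for \<open>2 e < i < m + e\<close> have residue degrees
\<open>0, \<dots>, m + e - 1\<close> and hence span all polynomials of degree less than \<open>m + e\<close>. Expressing \<open>x\<close> to the
power \<open>2 e\<close> by them gives the relation. Modulo the nonunits this power is obtained from \<open>x\<^sup>e q\<close> and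
members of smaller degree, which makes \<open>g\<close> unit-leading and \<open>w\<close> congruent to 1.\<close>

lemma weierstrass:
  fixes p q :: "'a poly"
  assumes p: "residually_unit p" "degree p \<le> m" and q: "residue_degree nonunits q e" "degree q < m"
  obtains g w h where "g * q = [:0, 1:] ^ (2 * e) * w + h * p" "lead_coeff g dvd 1"
    "residually_unit w" "degree w < m"
proof -
  let ?x = "[:0, 1:] :: 'a poly"
  have em: "e < m"
  proof (rule ccontr)
    assume "\<not> e < m"
    then have "coeff q e = 0" using q(2) by (intro coeff_eq_0) simp
    then show False using q(1) prime_set_nonunits by (simp add: residue_degree_def prime_set_def)
  qed
  define N where "N = m + e"
  define F where "F i = (if i < e then ?x ^ i * p else if i \<le> 2 * e then ?x ^ (i - e) * q else ?x ^ i * 1)" for i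
  have one: "residue_degree nonunits (1 :: 'a poly) 0"
    using prime_set_nonunits by (auto simp: residue_degree_def prime_set_def)
  have top: "residue_degree nonunits (F i) i" for i
    using residue_degree_shift[OF p(1), of i] residue_degree_shift[OF q(1), of "i - e"] residue_degree_shift[OF one, of i]
    by (auto simp: F_def)
  have deg: "coeff (F i) k = 0" if "i < N" "k \<ge> N" for i k
    using that p(2) q(2) em
    by (auto simp: F_def coeff_x_power_mult N_def intro!: coeff_eq_0 simp del: mult_1_right)
  have "coeff (?x ^ (2 * e) * 1) k = 0" if "k \<ge> N" for k
    using that em unfolding coeff_x_power_mult by (auto simp: N_def intro!: coeff_eq_0)
  then obtain c where "?x ^ (2 * e) * 1 = (\<Sum>i<N. [:c i:] * F i)"
    using triangular_span[of N F "?x ^ (2 * e) * 1"] top deg by blast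
  then have c: "?x ^ (2 * e) = (\<Sum>i<N. [:c i:] * F i)" by simp
  have xe: "coeff (?x ^ (2 * e)) i = (if i = 2 * e then 1 else 0)" for i
    by (simp add: x_power_monom coeff_monom)
  have "\<exists>i<N. c i \<notin> nonunits"
  proof (rule ccontr)
    assume "\<not> ?thesis"
    then have "coeff (?x ^ (2 * e)) (2 * e) \<in> nonunits"
      unfolding c coeff_sum by (intro prime_set_sum[OF prime_set_nonunits]) (auto intro: const_mult_nonunit)
    then show False using prime_set_nonunits unfolding xe by (simp add: prime_set_def)
  qed
  then have ne: "{i. i < N \<and> c i \<notin> nonunits} \<noteq> {}" by blast
  \<comment> \<open>the last unit coefficient of the combination sits where the left-hand side has its unit\<close>
  define s where "s = Max {i. i < N \<and> c i \<notin> nonunits}"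
  have s: "s < N" "c s \<notin> nonunits" using Max_in[OF _ ne] by (simp_all add: s_def)
  have s': "c i \<in> nonunits" if "i < N" "i > s" for i
  proof (rule ccontr)
    assume "c i \<notin> nonunits"
    then have "i \<le> s" unfolding s_def using that by (intro Max_ge) auto
    then show False using that by simp
  qed
  have "coeff (?x ^ (2 * e)) s \<notin> nonunits"
  proof -
    have "coeff (?x ^ (2 * e)) s = c s * coeff (F s) s + (\<Sum>i\<in>{..<N} - {s}. c i * coeff (F i) s)"
      unfolding c coeff_sum using s(1) by (subst sum.remove[of _ s]) auto
    moreover have "(\<Sum>i\<in>{..<N} - {s}. c i * coeff (F i) s) \<in> nonunits"
    proof (rule prime_set_sum[OF prime_set_nonunits])
      fix i assume "i \<in> {..<N} - {s}"
      then consider "i < s" | "i > s" "i < N" by fastforce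
      then show "c i * coeff (F i) s \<in> nonunits"
        using s' top[of i] by cases (auto simp: residue_degree_def intro: const_mult_nonunit)
    qed
    moreover have "c s * coeff (F s) s \<notin> nonunits"
      using s(2) top[of s] prime_set_nonunits unfolding residue_degree_def prime_set_def by blast
    ultimately show ?thesis using prime_set_add_iff[OF prime_set_nonunits] by metis
  qed
  then have s2: "s = 2 * e" using prime_set_nonunits unfolding xe by (auto simp: prime_set_def split: if_splits)
  define g where "g = (\<Sum>i\<in>{e..2 * e}. [:c i:] * ?x ^ (i - e))"
  define h where "h = - (\<Sum>i<e. [:c i:] * ?x ^ i)"
  define v where "v = (\<Sum>i\<in>{2 * e<..<N}. [:c i:] * ?x ^ (i - 2 * e))"
  have split: "(\<Sum>i<N. f i) = (\<Sum>i<e. f i) + (\<Sum>i\<in>{e..2 * e}. f i) + (\<Sum>i\<in>{2 * e<..<N}. f i)"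
    for f :: "nat \<Rightarrow> 'a poly"
  proof -
    have "{..<N} = ({..<e} \<union> {e..2 * e}) \<union> {2 * e<..<N}" using s(1) s2 by auto
    moreover have "sum f (({..<e} \<union> {e..2 * e}) \<union> {2 * e<..<N}) = sum f ({..<e} \<union> {e..2 * e}) + sum f {2 * e<..<N}"
      by (rule sum.union_disjoint) auto
    moreover have "sum f ({..<e} \<union> {e..2 * e}) = sum f {..<e} + sum f {e..2 * e}"
      by (rule sum.union_disjoint) auto
    ultimately show ?thesis by simp
  qed
  have "?x ^ (2 * e) = - h * p + g * q + ?x ^ (2 * e) * v"
  proof -
    have "(\<Sum>i<e. [:c i:] * F i) = - h * p"
      unfolding h_def minus_minus sum_distrib_right by (rule sum.cong) (auto simp: F_def)
    moreover have "(\<Sum>i\<in>{e..2 * e}. [:c i:] * F i) = g * q"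
      unfolding g_def sum_distrib_right by (rule sum.cong) (auto simp: F_def)
    moreover have "(\<Sum>i\<in>{2 * e<..<N}. [:c i:] * F i) = ?x ^ (2 * e) * v"
      unfolding v_def sum_distrib_left
      by (rule sum.cong) (auto simp: F_def power_add[symmetric])
    ultimately show ?thesis using c unfolding split[of "\<lambda>i. [:c i:] * F i"] by simp
  qed
  then have eq: "g * q = ?x ^ (2 * e) * (1 - v) + h * p" by (simp add: algebra_simps)
  have cg: "coeff g i = (if i \<le> e then c (i + e) else 0)" for i
  proof -
    have "coeff g i = (\<Sum>k\<in>{e..2 * e}. if k = i + e then c k else 0)"
      unfolding g_def coeff_sum
      by (rule sum.cong) (auto simp: x_power_monom coeff_monom)
    then show ?thesis by simp
  qed
  have cv: "coeff v i = (if 0 < i \<and> i + 2 * e < N then c (i + 2 * e) else 0)" for i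
  proof -
    have "coeff v i = (\<Sum>k\<in>{2 * e<..<N}. if k = i + 2 * e then c k else 0)"
      unfolding v_def coeff_sum
      by (rule sum.cong) (auto simp: x_power_monom coeff_monom)
    then show ?thesis by simp
  qed
  have "degree g \<le> e" by (rule degree_le) (simp add: cg)
  moreover have ge: "coeff g e dvd 1" using s(2) s2 cg[of e] by (simp add: mult_2 unit_iff)
  then have "e \<le> degree g" by (intro le_degree) auto
  ultimately have "lead_coeff g dvd 1" using ge by simp
  moreover have "residually_unit (1 - v)"
  proof -
    have "coeff v i \<in> nonunits" if "i > 0" for i
      using s'[of "i + 2 * e"] s2 that prime_set_nonunits by (simp add: cv prime_set_def)
    then have "coeff (1 - v) i \<in> nonunits" if "i > 0" for i using that by (simp add: nonunits_def)
    moreover have "coeff (1 - v) 0 = 1" by (simp add: cv)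
    ultimately show ?thesis using prime_set_nonunits by (simp add: residue_degree_def prime_set_def)
  qed
  moreover have "degree (1 - v) < m"
  proof -
    have "degree v < m"
    proof (rule degree_lessI)
      show "v \<noteq> 0 \<or> 0 < m" using em by simp
      show "\<forall>k\<ge>m. coeff v k = 0" by (auto simp: cv N_def)
    qed
    then show ?thesis using degree_diff_le_max[of 1 v] em by simp
  qed
  ultimately show ?thesis using that eq by blast
qed

text \<open>Modulo \<open>p\<close> the polynomial \<open>q\<close> is a product of a power of \<open>x\<close>, a constant, and a polynomial \<open>f\<close>; up to a
further power of \<open>x\<close> and a unit-leading factor \<open>g\<close> the latter is the polynomial \<open>w\<close> of smaller degree. All
these factors have trivial symbol, so \<open>(p, q)\<close> may be replaced by \<open>(w, p)\<close>.\<close>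

lemma mennicke_trivial_residually_unit:
  fixes p q :: "'a poly"
  assumes "residually_unit p" "degree p \<le> m" "comaximal p q"
  shows "mennicke_trivial p q"
  using assms
proof (induction m arbitrary: p q)
  case 0
  then have "p = [:coeff p 0:]" by (metis degree_0_id le_zero_eq)
  then have "p dvd 1" using const_unit[OF residually_unit_coeff_0[OF 0(1)]] by metis
  then show ?case by (rule mennicke_trivial_unit)
next
  case (Suc m)
  note p0 = residually_unit_coeff_0[OF Suc.prems(1)]
  note x = comaximal_x[OF p0]
  obtain N r t where qr: "q = [:0, 1:] ^ N * r + t * p" and r: "degree r < Suc m"
    using division_x[OF p0 Suc.prems(2)] by blast
  have "comaximal p ([:0, 1:] ^ N * r)" using Suc.prems(3) unfolding qr comaximal_add .
  then have cr: "comaximal p r" unfolding comaximal_mult_iff ..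
  have qr': "mennicke_trivial p q \<longleftrightarrow> mennicke_trivial p r"
    unfolding qr mennicke_trivial_add
    by (rule mennicke_trivial_mult[OF mennicke_trivial_power[OF x(2,1)] comaximal_power[OF x(1)] cr])
  show ?case
  proof (cases "r = 0")
    case True
    then have "p dvd 1" using cr unfolding comaximal_def by (metis add.right_neutral dvd_triv_right mult_zero_right)
    then show ?thesis by (rule mennicke_trivial_unit)
  next
    case False
    obtain b f j where f: "r = [:b:] * f" "coeff f j = 1" "degree f \<le> degree r"
      using content[OF False] by metis
    have cb: "comaximal p [:b:]" and cf: "comaximal p f" using cr unfolding f(1) comaximal_mult_iff by blast+
    have rf: "mennicke_trivial p r \<longleftrightarrow> mennicke_trivial p f"
      unfolding f(1) by (rule mennicke_trivial_mult[OF mennicke_trivial_const[OF p0 cb] cb cf])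
    have "coeff f j \<notin> nonunits" using f(2) by (simp add: nonunits_def)
    then obtain e where e: "residue_degree nonunits f e" using residue_degree_exists[OF prime_set_nonunits] by metis
    obtain g w h where w: "g * f = [:0, 1:] ^ (2 * e) * w + h * p" "lead_coeff g dvd 1" "residually_unit w" "degree w < Suc m"
      using weierstrass[OF Suc.prems(1,2) e] f(3) r by (metis le_less_trans)
    have g: "comaximal p g" "mennicke_trivial p g" using residually_unit_unit_lead[OF Suc.prems(1) w(2)] by auto
    have "comaximal p (g * f)" using g(1) cf unfolding comaximal_mult_iff by blast
    then have cw: "comaximal p w" unfolding w(1) comaximal_add comaximal_mult_iff by blast
    have "mennicke_trivial p f \<longleftrightarrow> mennicke_trivial p (g * f)"
      by (rule mennicke_trivial_mult[OF g(2,1) cf, symmetric])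
    also have "\<dots> \<longleftrightarrow> mennicke_trivial p w"
      unfolding w(1) mennicke_trivial_add
      by (rule mennicke_trivial_mult[OF mennicke_trivial_power[OF x(2,1)] comaximal_power[OF x(1)] cw])
    also have "\<dots>" using Suc.IH[of w p] w(3,4) cw comaximal_commute mennicke_trivial_commute by (metis less_Suc_eq_le)
    finally show ?thesis using qr' rf by simp
  qed
qed

end

section \<open>Column reduction\<close>

inductive column_equiv :: "nat \<Rightarrow> (nat \<Rightarrow> 'a :: comm_ring_1) \<Rightarrow> (nat \<Rightarrow> 'a) \<Rightarrow> bool" for n f where
  refl: "column_equiv n f f"
| step: "column_equiv n f g \<Longrightarrow> i < n \<Longrightarrow> j < n \<Longrightarrow> i \<noteq> j \<Longrightarrow> column_equiv n f (g(i := g i + a * g j))"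

lemma column_equiv_trans:
  assumes "column_equiv n f g" "column_equiv n g h"
  shows "column_equiv n f h"
  using assms(2)
proof induction
  case (step g i j a)
  then show ?case by (intro column_equiv.step)
qed (rule assms(1))

lemma column_equiv_single:
  "i < n \<Longrightarrow> j < n \<Longrightarrow> i \<noteq> j \<Longrightarrow> column_equiv n f (f(i := f i + a * f j))"
  by (rule column_equiv.step[OF column_equiv.refl])

definition unimodular :: "nat \<Rightarrow> (nat \<Rightarrow> 'a :: comm_ring_1) \<Rightarrow> bool" where
  "unimodular n f \<longleftrightarrow> (\<exists>h. (\<Sum>i<n. h i * f i) = 1)"

lemma unimodular_column_equiv:
  assumes "column_equiv n f g" "unimodular n f"
  shows "unimodular n g"
  using assms
proof induction
  case (step g i j a)
  then obtain h where h: "(\<Sum>k<n. h k * g k) = 1" by (auto simp: unimodular_def)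
  define h' where "h' = h(j := h j - h i * a)"
  define g' where "g' = g(i := g i + a * g j)"
  have split: "(\<Sum>k<n. f k) = f i + f j + (\<Sum>k\<in>{..<n} - {i} - {j}. f k)" for f :: "nat \<Rightarrow> 'a"
    using step(2-4) sum.remove[of "{..<n}" i f] sum.remove[of "{..<n} - {i}" j f] by (simp add: add.assoc)
  have "(\<Sum>k\<in>{..<n} - {i} - {j}. h' k * g' k) = (\<Sum>k\<in>{..<n} - {i} - {j}. h k * g k)"
    by (rule sum.cong) (auto simp: h'_def g'_def)
  then have "(\<Sum>k<n. h' k * g' k) = (\<Sum>k<n. h k * g k)"
    unfolding split[of "\<lambda>k. h' k * g' k"] split[of "\<lambda>k. h k * g k"]
    using step(4) by (simp add: h'_def g'_def algebra_simps)
  then show ?case using h unfolding unimodular_def g'_def by metis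
qed

lemma column_equiv_pivot:
  assumes "i < n"
  shows "column_equiv n f (\<lambda>j. if j < n \<and> j \<noteq> i then f j + c j * f i else f j)"
proof -
  have "column_equiv n f (\<lambda>j. if j \<in> J then f j + c j * f i else f j)" if "finite J" "J \<subseteq> {..<n} - {i}" for J
    using that
  proof (induction J)
    case empty
    show ?case using column_equiv.refl by simp
  next
    case (insert k J)
    let ?g = "\<lambda>j. if j \<in> J then f j + c j * f i else f j"
    have "column_equiv n f (?g(k := ?g k + c k * ?g i))"
      using insert assms by (intro column_equiv.step) auto
    moreover have "?g(k := ?g k + c k * ?g i) = (\<lambda>j. if j \<in> insert k J then f j + c j * f i else f j)"
      using insert by (auto simp: fun_eq_iff)
    ultimately show ?case by simp
  qed
  from this[of "{..<n} - {i}"] show ?thesis by (simp add: conj_commute)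
qed

lemma column_equiv_swap:
  assumes "i < n" "j < n" "i \<noteq> j"
  shows "column_equiv n f (f(i := f j, j := - f i))"
proof -
  let ?f1 = "f(i := f i + 1 * f j)"
  let ?f2 = "?f1(j := ?f1 j + (- 1) * ?f1 i)"
  let ?f3 = "?f2(i := ?f2 i + 1 * ?f2 j)"
  have "column_equiv n f ?f3"
    using assms by (intro column_equiv.step column_equiv.refl) auto
  moreover have "?f3 = f(i := f j, j := - f i)" using assms by (auto simp: fun_eq_iff)
  ultimately show ?thesis by simp
qed

text \<open>If the last entry is the only unit at hand, it is first used to create a second entry 1.\<close>

lemma column_equiv_unit_entry:
  fixes f :: "nat \<Rightarrow> 'a :: comm_ring_1"
  assumes k: "k < n" "f k dvd 1" and n: "n \<ge> 2"
  obtains g where "column_equiv n f g" "\<And>i. i < n \<Longrightarrow> g i = (if i = n - 1 then 1 else 0)"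
proof -
  have A: "\<exists>g. column_equiv n f g \<and> (\<forall>i<n. g i = (if i = n - 1 then 1 else 0))"
    if k: "k < n - 1" "f k dvd 1" for f :: "nat \<Rightarrow> 'a" and k
  proof -
    obtain u where u: "1 = f k * u" using k by (auto simp: dvd_def)
    define f1 where "f1 = f(n - 1 := f (n - 1) + (u * (1 - f (n - 1))) * f k)"
    have 1: "column_equiv n f f1" unfolding f1_def using k by (intro column_equiv_single) auto
    have "(u * (1 - f (n - 1))) * f k = (f k * u) * (1 - f (n - 1))" by (simp add: mult_ac)
    then have f1: "f1 (n - 1) = 1" by (simp add: f1_def u[symmetric])
    have "column_equiv n f1 (\<lambda>j. if j < n \<and> j \<noteq> n - 1 then f1 j + (- f1 j) * f1 (n - 1) else f1 j)"
      using n by (intro column_equiv_pivot) simp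
    then show ?thesis using column_equiv_trans[OF 1] f1 by fastforce
  qed
  show ?thesis
  proof (cases "k = n - 1")
    case False
    then have "k < n - 1" using k by simp
    then show ?thesis using A[of k f] k(2) that by blast
  next
    case True
    obtain u where u: "1 = f k * u" using k by (auto simp: dvd_def)
    define f1 where "f1 = f(0 := f 0 + (u * (1 - f 0)) * f k)"
    have 1: "column_equiv n f f1" unfolding f1_def using k n True by (intro column_equiv_single) auto
    have "(u * (1 - f 0)) * f k = (f k * u) * (1 - f 0)" by (simp add: mult_ac)
    then have "f1 0 dvd 1" by (simp add: f1_def u[symmetric])
    then show ?thesis using A[of 0 f1] n column_equiv_trans[OF 1] that by auto
  qed
qed

text \<open>Whitehead's lemma modulo \<open>f i\<close>: the diagonal matrix of \<open>u\<^sup>-\<^sup>1\<close> and \<open>u\<close> is a product of elementary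
matrices, and errors that are multiples of \<open>f i\<close> are cleared by means of the entry \<open>i\<close>.\<close>

lemma column_equiv_whitehead:
  fixes f :: "nat \<Rightarrow> 'a :: comm_ring_1"
  assumes ijk: "i < n" "j < n" "k < n" "i \<noteq> j" "i \<noteq> k" "j \<noteq> k"
    and fj: "f j = u * w + s * f i" and u: "comaximal (f i) u"
  shows "column_equiv n f (f(j := w, k := u * f k))"
proof -
  define p where "p = f i"
  obtain t v where uv: "t * p + v * u = 1" using u by (auto simp: comaximal_def p_def)
  define b where "b = f k"
  note S = column_equiv_trans[OF _ column_equiv_single]
  have 1: "column_equiv n f (f(j := u * w))"
    using column_equiv_single[of j n i f "- s"] ijk fj by simp
  have "column_equiv n f (f(j := u * w, k := b + w))"
  proof -
    have "column_equiv n f (f(j := u * w, k := b + v * (u * w)))"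
      using S[OF 1, of k j v] ijk by (simp add: b_def)
    from S[OF this, of k i "t * w"] have "column_equiv n f (f(j := u * w, k := b + v * (u * w) + t * w * p))"
      using ijk by (simp add: p_def)
    moreover have "b + v * (u * w) + t * w * p = b + w * (t * p + v * u)" by (simp add: algebra_simps)
    ultimately show ?thesis by (simp only: uv mult_1_right)
  qed
  from S[OF this, of j k "- u"] have "column_equiv n f (f(j := - (u * b), k := b + w))"
    using ijk by (simp add: fun_upd_twist algebra_simps)
  moreover from S[OF this, of k j v]
  have "column_equiv n f (f(j := - (u * b), k := b + w - v * (u * b)))"
    using ijk by simp
  moreover from S[OF this, of k i "- (t * b)"]
  have "column_equiv n f (f(j := - (u * b), k := b + w - v * (u * b) - t * b * p))"
    using ijk by (simp add: p_def)
  moreover have "b + w - v * (u * b) - t * b * p = b + w - b * (t * p + v * u)" by (simp add: algebra_simps)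
  then have "b + w - v * (u * b) - t * b * p = w" by (simp add: uv)
  ultimately have "column_equiv n f (f(j := - (u * b), k := w))" by (simp only:)
  from column_equiv_trans[OF this column_equiv_swap[of j n k]] show ?thesis
    using ijk by (simp add: b_def fun_upd_twist)
qed

text \<open>The matrix \<open>E\<close> depends on the reduction only, not on the matrix \<open>A\<close> that contains the column.\<close>

lemma column_equiv_matrix:
  fixes f g :: "nat \<Rightarrow> 'a :: comm_ring_1"
  assumes "column_equiv n f g"
  shows "\<exists>E \<in> elementary_group n. \<forall>A \<in> carrier_mat n n. \<forall>c<n.
    (\<forall>i<n. A $$ (i, c) = f i) \<longrightarrow> (\<forall>i<n. (E * A) $$ (i, c) = g i)"
  using assms
proof induction
  case refl
  show ?case
    by (rule bexI[OF _ elementary_group_one]) simp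
next
  case (step g i j a)
  obtain E where E: "E \<in> elementary_group n" and *: "\<forall>A \<in> carrier_mat n n. \<forall>c<n.
    (\<forall>i<n. A $$ (i, c) = f i) \<longrightarrow> (\<forall>i<n. (E * A) $$ (i, c) = g i)"
    using step.IH by (elim bexE)
  show ?case
  proof (rule bexI[of _ "addrow_mat n a i j * E"], intro ballI allI impI)
    fix A c k
    assume A: "A \<in> carrier_mat n n" "c < n" "\<forall>i<n. A $$ (i, c) = f i" and k: "k < n"
    have EA: "E * A \<in> carrier_mat n n" using mult_carrier_mat[OF elementary_group_carrier[OF E] A(1)] .
    have "addrow_mat n a i j * E * A = addrow a i j (E * A)"
      using assoc_mult_mat[OF addrow_mat_carrier elementary_group_carrier[OF E] A(1)]
        addrow_mat[OF EA step(3)] by simp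
    moreover have "addrow a i j (E * A) $$ (k, c) = (if i = k then a * (E * A) $$ (j, c) + (E * A) $$ (k, c) else (E * A) $$ (k, c))"
      using EA k A(2) by (subst index_mat_addrow(1)) (auto simp del: index_mult_mat(1))
    moreover have "(E * A) $$ (k, c) = g k" "(E * A) $$ (j, c) = g j"
      using *[rule_format, OF A(1,2)] A(3) k step(3) by blast+
    ultimately show "(addrow_mat n a i j * E * A) $$ (k, c) = (g(i := g i + a * g j)) k"
      by (cases "i = k") (auto simp: add.commute simp del: index_mult_mat(1))
  qed (use E step in simp)
qed

lemma unimodular_column:
  fixes A :: "'a :: comm_ring_1 mat"
  assumes A: "A \<in> carrier_mat n n" "det A = 1" and c: "c < n"
  shows "unimodular n (\<lambda>i. A $$ (i, c))"
proof -
  have "(\<Sum>i<n. cofactor A i c * A $$ (i, c)) = 1"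
    using laplace_expansion_column[OF A(1) c] A(2) by (simp add: mult.commute)
  then show ?thesis unfolding unimodular_def by (rule exI[of _ "\<lambda>i. cofactor A i c"])
qed

text \<open>Once the last column is a unit vector, one transvection clears the last row.\<close>

lemma corner_reduction:
  fixes A :: "'a :: comm_ring_1 mat"
  assumes A: "A \<in> carrier_mat (Suc n) (Suc n)" "det A = 1"
    and red: "column_equiv (Suc n) (\<lambda>i. A $$ (i, n)) g" "\<And>i. i < Suc n \<Longrightarrow> g i = (if i = n then 1 else 0)"
  obtains C :: "'a mat" where "C \<in> carrier_mat n n" "det C = 1"
    "corner_mat C \<in> elementary_group (Suc n) \<longrightarrow> A \<in> elementary_group (Suc n)"
proof -
  obtain E where E: "E \<in> elementary_group (Suc n)"
    and col: "\<And>i. i < Suc n \<Longrightarrow> (E * A) $$ (i, n) = (if i = n then 1 else 0)"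
    using column_equiv_matrix[OF red(1)] A(1) red(2) by fastforce
  note EA = mult_carrier_mat[OF elementary_group_carrier[OF E] A(1)]
  define w where "w j = (if j = n then 0 else - (E * A) $$ (n, j))" for j
  define R where "R = transvection (Suc n) (\<lambda>k. if k = n then 1 else 0) w"
  have R: "R \<in> elementary_group (Suc n)"
    unfolding R_def by (rule transvection_unit_left) (simp_all add: w_def)
  define B where "B = E * A * R"
  have B: "B \<in> carrier_mat (Suc n) (Suc n)"
    unfolding B_def using mult_carrier_mat[OF EA elementary_group_carrier[OF R]] .
  have idx: "B $$ (i, j) = (E * A) $$ (i, j) + (E * A) $$ (i, n) * w j" if "i < Suc n" "j < Suc n" for i j
  proof -
    have "B $$ (i, j) = (\<Sum>k<Suc n. (E * A) $$ (i, k) * R $$ (k, j))"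
      unfolding B_def by (rule index_mult_mat_sum[OF EA elementary_group_carrier[OF R] that])
    also have "\<dots> = (\<Sum>k<Suc n. (E * A) $$ (i, k) * (if k = j then 1 else 0)
        + (if k = n then (E * A) $$ (i, k) * w j else 0))"
      using that unfolding R_def by (intro sum.cong) (auto simp del: index_mult_mat(1) simp: distrib_left)
    also have "\<dots> = (E * A) $$ (i, j) + (E * A) $$ (i, n) * w j"
      unfolding sum.distrib using that by (subst sum_delta_lessThan) (simp_all del: index_mult_mat(1))
    finally show ?thesis .
  qed
  define C where "C = mat n n (\<lambda>(i, j). B $$ (i, j))"
  have C: "C \<in> carrier_mat n n" by (simp add: C_def)
  have "corner_mat C = B"
  proof (rule eq_matI)
    fix i j assume "i < dim_row B" "j < dim_col B"
    then have ij: "i < Suc n" "j < Suc n" using B by auto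
    show "corner_mat C $$ (i, j) = B $$ (i, j)"
      unfolding index_corner_mat[OF C ij] using idx[OF ij] col[OF ij(1)] ij
      by (auto simp: C_def w_def less_Suc_eq simp del: index_mult_mat(1))
  qed (use B corner_mat_carrier[OF C] in auto)
  note CB = this
  moreover have "det B = 1"
    using det_mult[OF EA elementary_group_carrier[OF R]] det_mult[OF elementary_group_carrier[OF E] A(1)]
      elementary_group_SL[OF R] elementary_group_SL[OF E] A(2) by (simp add: B_def SL_def)
  ultimately have dC: "det C = 1" using det_corner_mat[OF C] by simp
  have imp: "A \<in> elementary_group (Suc n)" if "corner_mat C \<in> elementary_group (Suc n)"
    using that CB elementary_group_cancel_right[OF R EA] elementary_group_cancel_left[OF E A(1)]
    by (simp add: B_def)
  show ?thesis using that[OF C dC] imp by blast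
qed

lemma det_2x2:
  assumes A: "A \<in> carrier_mat 2 2"
  shows "det A = A $$ (0, 0) * A $$ (1, 1) - A $$ (0, 1) * A $$ (1, 0)"
proof -
  have m: "mat_delete A i 0 \<in> carrier_mat 1 1" for i
    using mat_delete_carrier[OF A] by simp
  have "det A = (\<Sum>i<2. A $$ (i, 0) * cofactor A i 0)" by (rule laplace_expansion_column[OF A]) simp
  moreover have "det (mat_delete A 0 0) = A $$ (1, 1)" "det (mat_delete A 1 0) = A $$ (0, 1)"
    unfolding det_single[OF m] using A by (simp_all add: mat_delete_def)
  then have "(\<Sum>i<2. A $$ (i, 0) * cofactor A i 0) = A $$ (0, 0) * A $$ (1, 1) - A $$ (1, 0) * A $$ (0, 1)"
    by (simp add: numeral_2_eq_2 cofactor_def)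
  ultimately show ?thesis by (simp add: mult.commute)
qed

context valuation_type
begin

text \<open>Division with remainder in the polynomial ring over the residue field, lifted.\<close>

lemma nonunit_remainder:
  fixes g q :: "'a poly"
  assumes g: "residue_degree nonunits g d"
  shows "\<exists>h. \<forall>k\<ge>d. coeff (q - h * g) k \<in> nonunits"
proof -
  have "coeff g d dvd 1" using g by (simp add: residue_degree_def unit_iff)
  then obtain u where u: "1 = coeff g d * u" by (auto simp: dvd_def)
  have "\<exists>h. \<forall>k\<ge>d. coeff (q - h * g) k \<in> nonunits" if "\<And>k. k \<ge> d + r \<Longrightarrow> coeff q k \<in> nonunits" for q r
    using that
  proof (induction r arbitrary: q)
    case 0
    then have "\<forall>k\<ge>d. coeff (q - 0 * g) k \<in> nonunits" by simp
    then show ?case by blast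
  next
    case (Suc r)
    define t where "t = monom (coeff q (d + r) * u) r"
    have "coeff (q - t * g) k \<in> nonunits" if k: "k \<ge> d + r" for k
    proof (cases "k = d + r")
      case True
      have "coeff (t * g) k = (coeff q (d + r) * u) * coeff g d"
        using True by (simp add: t_def coeff_monom_mult)
      also have "\<dots> = coeff q (d + r) * (coeff g d * u)" by (simp add: mult_ac)
      finally have "coeff (t * g) k = coeff q (d + r) * (coeff g d * u)" .
      then show ?thesis using True prime_set_nonunits by (simp add: u[symmetric] prime_set_def)
    next
      case False
      then have "coeff g (k - r) \<in> nonunits" using g k by (simp add: residue_degree_def)
      then have "- (coeff q (d + r) * u * coeff g (k - r)) \<in> nonunits"
        using const_mult_nonunit(2) by (simp add: nonunits_def)
      moreover have "coeff q k \<in> nonunits" using Suc.prems[of k] k False by simp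
      moreover have "coeff (q - t * g) k = coeff q k + (- (coeff q (d + r) * u * coeff g (k - r)))"
        using k by (simp add: t_def coeff_monom_mult)
      ultimately show ?thesis using prime_set_add_iff[OF prime_set_nonunits] by metis
    qed
    then obtain h where "\<forall>k\<ge>d. coeff (q - t * g - h * g) k \<in> nonunits" using Suc.IH by blast
    then have "\<forall>k\<ge>d. coeff (q - (t + h) * g) k \<in> nonunits" by (simp add: algebra_simps)
    then show ?case by blast
  qed
  from this[of "Suc (degree q)" q] show ?thesis
    using prime_set_nonunits by (simp add: coeff_eq_0 prime_set_def)
qed

text \<open>Euclid's algorithm over the residue field: in a column that contains an entry of the smallest
possible residue degree \<open>d\<close>, all other entries can be made to vanish modulo the nonunits. By
unimodularity that entry is then invertible modulo the nonunits, which forces \<open>d = 0\<close>.\<close>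

lemma column_equiv_residually_unit:
  fixes f :: "nat \<Rightarrow> 'a poly"
  assumes f: "unimodular n f"
  obtains g i where "column_equiv n f g" "i < n" "residually_unit (g i)"
proof -
  define Q where "Q d = (\<exists>g i. column_equiv n f g \<and> i < n \<and> residue_degree nonunits (g i) d)" for d
  have uni: "\<exists>i<n. \<exists>k. coeff (g i) k \<notin> nonunits" if ug: "unimodular n g" for g :: "nat \<Rightarrow> 'a poly"
  proof (rule ccontr)
    assume neg: "\<not> ?thesis"
    obtain h where h: "(\<Sum>i<n. h i * g i) = 1" using ug by (auto simp: unimodular_def)
    have "coeff (\<Sum>i<n. h i * g i) 0 \<in> nonunits"
      unfolding coeff_sum
    proof (rule prime_set_sum[OF prime_set_nonunits])
      fix i assume "i \<in> {..<n}"
      then show "coeff (h i * g i) 0 \<in> nonunits"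
        using neg residue_degree_mult_zero[OF prime_set_nonunits, of "g i" "h i" 0] by (simp add: mult.commute)
    qed
    then show False using h by (simp add: nonunits_def)
  qed
  have "\<exists>d. Q d"
    using uni[OF f] residue_degree_exists[OF prime_set_nonunits] column_equiv.refl unfolding Q_def by metis
  then obtain d where d: "Q d" "\<And>e. e < d \<Longrightarrow> \<not> Q e" using exists_least_iff[of Q] by blast
  then obtain g i where g: "column_equiv n f g" "i < n" "residue_degree nonunits (g i) d" by (auto simp: Q_def)
  have "\<forall>j. \<exists>h. \<forall>k\<ge>d. coeff (g j - h * g i) k \<in> nonunits"
    using nonunit_remainder[OF g(3)] by blast
  then obtain c where c: "\<And>j k. k \<ge> d \<Longrightarrow> coeff (g j - c j * g i) k \<in> nonunits" by metis
  have small: "coeff (g j - c j * g i) k \<in> nonunits" if j: "j < n" "j \<noteq> i" for j k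
  proof (rule ccontr)
    assume "coeff (g j - c j * g i) k \<notin> nonunits"
    then obtain e where e: "residue_degree nonunits (g j - c j * g i) e"
      using residue_degree_exists[OF prime_set_nonunits] by metis
    then have "e < d" using c[of e j] by (force simp: residue_degree_def)
    moreover have "column_equiv n f (g(j := g j + (- c j) * g i))"
      using g j by (intro column_equiv.step) auto
    then have "Q e" unfolding Q_def using e j by (intro exI[of _ "g(j := g j + (- c j) * g i)"] exI[of _ j]) simp
    ultimately show False using d(2) by blast
  qed
  define g' where "g' = (\<lambda>j. if j < n \<and> j \<noteq> i then g j + (- c j) * g i else g j)"
  have g': "column_equiv n f g'"
    unfolding g'_def by (rule column_equiv_trans[OF g(1) column_equiv_pivot[OF g(2)]])
  obtain h where h: "(\<Sum>k<n. h k * g' k) = 1"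
    using unimodular_column_equiv[OF g' f] by (auto simp: unimodular_def)
  have "1 = h i * g i + (\<Sum>k\<in>{..<n} - {i}. h k * g' k)"
    using h g(2) by (subst (asm) sum.remove[of _ i]) (auto simp: g'_def)
  then have one: "coeff 1 l = coeff (h i * g i) l + coeff (\<Sum>k\<in>{..<n} - {i}. h k * g' k) l" for l
    by (simp only: coeff_add[symmetric])
  have rest: "coeff (\<Sum>k\<in>{..<n} - {i}. h k * g' k) l \<in> nonunits" for l
    unfolding coeff_sum
  proof (rule prime_set_sum[OF prime_set_nonunits])
    fix k assume "k \<in> {..<n} - {i}"
    then show "coeff (h k * g' k) l \<in> nonunits"
      using small[of k] residue_degree_mult_zero[OF prime_set_nonunits, of "g' k" "h k" l]
      by (simp add: mult.commute g'_def)
  qed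
  have hg: "coeff (h i * g i) l \<in> nonunits \<longleftrightarrow> coeff 1 l \<in> nonunits" for l
    unfolding one using prime_set_add_iff[OF prime_set_nonunits rest, of "coeff (h i * g i) l" l] by blast
  have "\<exists>k. coeff (h i) k \<notin> nonunits"
  proof (rule ccontr)
    assume "\<nexists>k. coeff (h i) k \<notin> nonunits"
    then have "coeff (h i * g i) 0 \<in> nonunits" by (intro residue_degree_mult_zero[OF prime_set_nonunits]) blast
    then show False unfolding hg by (simp add: nonunits_def)
  qed
  then obtain e where "residue_degree nonunits (h i) e" using residue_degree_exists[OF prime_set_nonunits] by metis
  from residue_degree_mult[OF prime_set_nonunits this g(3)] have "coeff 1 (e + d) \<notin> nonunits"
    unfolding hg[symmetric] by (simp add: residue_degree_def)
  then have "e + d = 0" using prime_set_nonunits by (cases "e + d = 0") (auto simp: prime_set_def)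
  then have "d = 0" by simp
  then show ?thesis using that g by blast
qed

text \<open>Let \<open>p\<close> be the entry at \<open>i\<close>. Modulo \<open>p\<close> every other entry is a power of \<open>x\<close> times a polynomial whose
degree is below the bound for \<open>p\<close>. If these polynomials all vanish, \<open>p\<close> is a unit. Otherwise choose one, at
\<open>j\<close>, whose content divides the contents of all the others; by unimodularity this content is comaximal
with \<open>p\<close>. By \<open>weierstrass\<close> the entry at \<open>j\<close> is then a polynomial \<open>w\<close> with a smaller bound, up to a
factor \<open>u\<close> that is a unit modulo \<open>p\<close>. A third entry absorbs \<open>u\<close>, and \<open>w\<close> takes over the role of \<open>p\<close>.\<close>

lemma column_equiv_unit:
  fixes f :: "nat \<Rightarrow> 'a poly"
  assumes "n \<ge> 3" "i < n" "residually_unit (f i)" "degree (f i) \<le> m" "unimodular n f"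
  shows "\<exists>g k. column_equiv n f g \<and> k < n \<and> g k dvd 1"
  using assms(2-)
proof (induction m arbitrary: f i)
  case 0
  then have "f i = [:coeff (f i) 0:]" by (metis degree_0_id le_zero_eq)
  then have "f i dvd 1" using const_unit[OF residually_unit_coeff_0[OF 0(2)]] by metis
  then show ?case using 0(1) column_equiv.refl by blast
next
  case (Suc m)
  define p where "p = f i"
  have p: "residually_unit p" "degree p \<le> Suc m" using Suc.prems by (simp_all add: p_def)
  note p0 = residually_unit_coeff_0[OF p(1)]
  note x = comaximal_x(1)[OF p0]
  have "\<forall>j. \<exists>N r t. f j = [:0, 1:] ^ N * r + t * p \<and> degree r < Suc m"
    using division_x[OF p0 p(2)] by blast
  then obtain N r t where f: "\<And>j. f j = [:0, 1:] ^ N j * r j + t j * p" and r: "\<And>j. degree (r j) < Suc m"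
    by metis
  obtain h where h: "(\<Sum>k<n. h k * f k) = 1" using Suc.prems(4) by (auto simp: unimodular_def)
  define J where "J = {j. j < n \<and> j \<noteq> i \<and> r j \<noteq> 0}"
  show ?case
  proof (cases "J = {}")
    case True
    have "p dvd f k" if "k < n" for k
    proof (cases "k = i")
      case False
      then have "r k = 0" using True that by (auto simp: J_def)
      then show ?thesis using f[of k] by simp
    qed (simp add: p_def)
    then have "p dvd (\<Sum>k<n. h k * f k)" by (intro dvd_sum dvd_mult) auto
    then show ?thesis unfolding h p_def using Suc.prems(1) column_equiv.refl by blast
  next
    case False
    have "\<exists>b q l. r j = [:b:] * q \<and> coeff q l = 1 \<and> degree q \<le> degree (r j)" if "j \<in> J" for j
      using content[of "r j"] that unfolding J_def by (metis (mono_tags, lifting) mem_Collect_eq)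
    then obtain b q l where bq: "\<And>j. j \<in> J \<Longrightarrow> r j = [:b j:] * q j"
      "\<And>j. j \<in> J \<Longrightarrow> coeff (q j) (l j) = 1" "\<And>j. j \<in> J \<Longrightarrow> degree (q j) \<le> degree (r j)" by metis
    have "finite (b ` J)" "b ` J \<noteq> {}" using False by (simp_all add: J_def)
    then obtain c where "c \<in> b ` J" "\<And>a. a \<in> b ` J \<Longrightarrow> c dvd a" using minimal_divisor by metis
    then obtain j where j: "j \<in> J" and min: "\<And>k. k \<in> J \<Longrightarrow> b j dvd b k" by blast
    have "\<exists>\<alpha> \<beta>. f k = \<alpha> * p + \<beta> * [:b j:]" if "k < n" for k
    proof (cases "k \<in> J")
      case True
      then obtain a where "b k = b j * a" using min by (auto simp: dvd_def)
      then have "r k = [:b j:] * (smult a (q k))" using bq(1)[OF True] by (simp add: mult.commute)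
      then have "f k = t k * p + ([:0, 1:] ^ N k * smult a (q k)) * [:b j:]" using f[of k] by (simp add: mult_ac)
      then show ?thesis by blast
    next
      case False
      then have "k = i \<or> r k = 0" using that by (auto simp: J_def)
      then have "f k = (if k = i then 1 else t k) * p + 0 * [:b j:]" using f[of k] by (auto simp: p_def)
      then show ?thesis by blast
    qed
    then obtain \<alpha> \<beta> where ab: "\<And>k. k < n \<Longrightarrow> f k = \<alpha> k * p + \<beta> k * [:b j:]" by metis
    have "(\<Sum>k<n. h k * f k) = (\<Sum>k<n. (h k * \<alpha> k) * p + (h k * \<beta> k) * [:b j:])"
      by (rule sum.cong) (simp_all only: ab lessThan_iff distrib_left mult.assoc)
    also have "\<dots> = (\<Sum>k<n. h k * \<alpha> k) * p + (\<Sum>k<n. h k * \<beta> k) * [:b j:]"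
      by (simp only: sum.distrib sum_distrib_right)
    finally have cb: "comaximal p [:b j:]" using h comaximalI by metis
    have "coeff (q j) (l j) \<notin> nonunits" using bq(2)[OF j] by (simp add: nonunits_def)
    then obtain e where e: "residue_degree nonunits (q j) e" using residue_degree_exists[OF prime_set_nonunits] by metis
    have "degree (q j) < Suc m" using bq(3)[OF j] r[of j] by simp
    then obtain g w h' where w: "g * q j = [:0, 1:] ^ (2 * e) * w + h' * p" "lead_coeff g dvd 1"
        "residually_unit w" "degree w < Suc m"
      using weierstrass[OF p e] by metis
    obtain s g' where g': "s * p + g' * g = 1"
      using residually_unit_unit_lead[OF p(1) w(2)] by (auto simp: comaximal_def)
    have cg': "comaximal p g'" using g' comaximalI[of s p g g'] by (simp add: mult.commute)
    define u where "u = [:0, 1:] ^ N j * [:b j:] * (g' * [:0, 1:] ^ (2 * e))"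
    have cu: "comaximal p u"
      unfolding u_def comaximal_mult_iff using cb cg' comaximal_power[OF x] by blast
    define y where "y = [:0, 1:] ^ N j * [:b j:]"
    have "q j = (s * p + g' * g) * q j" by (simp add: g')
    also have "\<dots> = g' * (g * q j) + s * q j * p" by (simp add: algebra_simps)
    finally have qj: "q j = g' * [:0, 1:] ^ (2 * e) * w + (g' * h' + s * q j) * p"
      unfolding w(1) by (simp only: algebra_simps)
    have "f j = y * q j + t j * p" using f[of j] bq(1)[OF j] by (simp add: y_def mult_ac)
    also have "\<dots> = y * (g' * [:0, 1:] ^ (2 * e) * w + (g' * h' + s * q j) * p) + t j * p"
      using qj by simp
    also have "\<dots> = u * w + (y * (g' * h' + s * q j) + t j) * p"
      unfolding u_def y_def[symmetric] by (simp only: algebra_simps)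
    finally have fj: "f j = u * w + (y * (g' * h' + s * q j) + t j) * f i" by (simp add: p_def)
    have jn: "j < n" "j \<noteq> i" using j by (auto simp: J_def)
    obtain k where k: "k < n" "k \<noteq> i" "k \<noteq> j"
    proof -
      have "card {i, j} < card {..<n}" using assms(1) card_insert_le_m1[of 2 "{j}" i] by simp
      then have "\<not> {..<n} \<subseteq> {i, j}" using card_mono[of "{i, j}" "{..<n}"] by force
      then show ?thesis using that by blast
    qed
    define f' where "f' = f(j := w, k := u * f k)"
    have eq: "column_equiv n f f'"
      unfolding f'_def using fj cu Suc.prems(1) jn k
      by (intro column_equiv_whitehead[of i n j k]) (auto simp: p_def)
    have "f' j = w" using k by (simp add: f'_def)
    then have "\<exists>g k. column_equiv n f' g \<and> k < n \<and> g k dvd 1"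
      using w(3,4) jn unimodular_column_equiv[OF eq Suc.prems(4)] by (intro Suc.IH[of j]) simp_all
    then show ?thesis using column_equiv_trans[OF eq] by blast
  qed
qed

text \<open>The symbol is invariant under elementary operations on the pair, so Euclid's algorithm over the
residue field leads to \<open>mennicke_trivial_residually_unit\<close>.\<close>

lemma mennicke_trivial_comaximal:
  fixes p q :: "'a poly"
  assumes "comaximal p q"
  shows "mennicke_trivial p q"
proof -
  define f where "f i = (if i = 0 then p else q)" for i :: nat
  have two: "(\<Sum>i<2. h i) = h 0 + h 1" for h :: "nat \<Rightarrow> 'a poly" by (simp add: numeral_2_eq_2)
  have f: "unimodular 2 f"
  proof -
    obtain c d where "c * p + d * q = 1" using assms by (auto simp: comaximal_def)
    then have "(\<Sum>i<2. (if i = 0 then c else d) * f i) = 1" by (simp add: two f_def)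
    then show ?thesis unfolding unimodular_def by (rule exI[of _ "\<lambda>i. if i = 0 then c else d"])
  qed
  obtain g i where g: "column_equiv 2 f g" "i < 2" "residually_unit (g i)"
    using column_equiv_residually_unit[OF f] .
  have "comaximal (g 0) (g 1)"
    using unimodular_column_equiv[OF g(1) f] unfolding unimodular_def two comaximal_def by blast
  then have "mennicke_trivial (g 0) (g 1)"
  proof (cases "i = 0")
    case False
    then have "i = 1" using g(2) by auto
    then have "mennicke_trivial (g 1) (g 0)"
      using \<open>comaximal (g 0) (g 1)\<close> g(3) mennicke_trivial_residually_unit[of "g 1" "degree (g 1)" "g 0"]
        comaximal_commute[of "g 0" "g 1"] by blast
    then show ?thesis using mennicke_trivial_commute by blast
  qed (use g(3) mennicke_trivial_residually_unit in auto)
  moreover have "mennicke_trivial (f 0) (f 1) \<longleftrightarrow> mennicke_trivial (g 0) (g 1)"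
    using g(1)
  proof induction
    case (step g i j a)
    have "mennicke_trivial (g 0 + a * g 1) (g 1) \<longleftrightarrow> mennicke_trivial (g 0) (g 1)"
      using mennicke_trivial_add[of "g 1" "g 0" a] mennicke_trivial_commute by metis
    then show ?case
      using step mennicke_trivial_add[of "g 0" "g 1" a] by (auto simp: less_2_cases_iff)
  qed simp
  ultimately show ?thesis by (simp add: f_def)
qed

lemma column_reduction:
  fixes f :: "nat \<Rightarrow> 'a poly"
  assumes n: "n \<ge> 3" and f: "unimodular n f"
  obtains g where "column_equiv n f g" "\<And>i. i < n \<Longrightarrow> g i = (if i = n - 1 then 1 else 0)"
proof -
  obtain g i where g: "column_equiv n f g" "i < n" "residually_unit (g i)" using column_equiv_residually_unit[OF f] .
  obtain g' k where g': "column_equiv n g g'" "k < n" "g' k dvd 1"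
    using column_equiv_unit[OF n g(2,3) order_refl unimodular_column_equiv[OF g(1) f]] by blast
  have "n \<ge> 2" using n by simp
  then obtain g'' where "column_equiv n g' g''" "\<And>i. i < n \<Longrightarrow> g'' i = (if i = n - 1 then 1 else 0)"
    using column_equiv_unit_entry[of k n g'] g'(2,3) by blast
  then show ?thesis using that column_equiv_trans[OF column_equiv_trans[OF g(1) g'(1)]] by blast
qed

theorem SL_valuation_type:
  fixes A :: "'a poly mat"
  assumes n: "n \<ge> 3" and A: "A \<in> carrier_mat n n" "det A = 1"
  shows "A \<in> elementary_group n"
  using n A
proof (induction n arbitrary: A rule: nat_induct_at_least)
  case base
  have three: "3 = Suc 2" by simp
  obtain g where g: "column_equiv 3 (\<lambda>i. A $$ (i, 2)) g" "\<And>i. i < 3 \<Longrightarrow> g i = (if i = 3 - 1 then 1 else 0)"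
    using column_reduction[OF order_refl unimodular_column[OF base, of 2]] by auto
  have g2: "\<And>i. i < Suc 2 \<Longrightarrow> g i = (if i = 2 then 1 else 0)" using g(2) by simp
  obtain C :: "'a poly mat" where C: "C \<in> carrier_mat 2 2" "det C = 1"
    "corner_mat C \<in> elementary_group (Suc 2) \<longrightarrow> A \<in> elementary_group (Suc 2)"
  proof (rule corner_reduction)
    show "A \<in> carrier_mat (Suc 2) (Suc 2)" "det A = 1" using base by simp_all
    show "column_equiv (Suc 2) (\<lambda>i. A $$ (i, 2)) g" using g(1) by simp
  qed (use g2 in auto)
  have 1: "C $$ (0, 0) * C $$ (1, 1) - C $$ (0, 1) * C $$ (1, 0) = 1"
    using det_2x2[OF C(1)] C(2) by simp
  then have "comaximal (C $$ (0, 0)) (C $$ (1, 0))"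
    by (intro comaximalI[of "C $$ (1, 1)" _ "- C $$ (0, 1)"]) (simp add: mult.commute)
  then have "mat3 (C $$ (0, 0)) (C $$ (0, 1)) 0 (C $$ (1, 0)) (C $$ (1, 1)) 0 0 0 1 \<in> elementary_group 3"
    using mennicke_trivial_comaximal mennicke_trivial_iff[OF 1] by blast
  also have "mat3 (C $$ (0, 0)) (C $$ (0, 1)) 0 (C $$ (1, 0)) (C $$ (1, 1)) 0 0 0 1 = corner_mat C"
  proof (rule eq_matI)
    fix i j assume "i < dim_row (corner_mat C)" "j < dim_col (corner_mat C)"
    then have ij: "i < Suc 2" "j < Suc 2" using corner_mat_carrier[OF C(1)] by auto
    then have "i = 0 \<or> i = 1 \<or> i = 2" "j = 0 \<or> j = 1 \<or> j = 2" by auto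
    then show "mat3 (C $$ (0, 0)) (C $$ (0, 1)) 0 (C $$ (1, 0)) (C $$ (1, 1)) 0 0 0 1 $$ (i, j) = corner_mat C $$ (i, j)"
      unfolding index_corner_mat[OF C(1) ij] by (auto simp: mat3_def)
  qed (use corner_mat_carrier[OF C(1)] in \<open>auto simp: mat3_def\<close>)
  finally show ?case using C(3) by simp
next
  case (Suc n)
  obtain g where g: "column_equiv (Suc n) (\<lambda>i. A $$ (i, n)) g" "\<And>i. i < Suc n \<Longrightarrow> g i = (if i = Suc n - 1 then 1 else 0)"
    using column_reduction[of "Suc n", OF _ unimodular_column[OF Suc.prems, of n]] Suc.hyps by auto
  obtain C :: "'a poly mat" where C: "C \<in> carrier_mat n n" "det C = 1"
    "corner_mat C \<in> elementary_group (Suc n) \<longrightarrow> A \<in> elementary_group (Suc n)"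
    using corner_reduction[of A n g] Suc.prems g by auto
  show ?case using C(3) elementary_group_corner[OF Suc.IH[OF C(1,2)]] by blast
qed

end

section \<open>Ring homomorphisms on polynomials\<close>

lemma comm_ring_hom_comp: "comm_ring_hom H \<Longrightarrow> comm_ring_hom K \<Longrightarrow> comm_ring_hom (\<lambda>x. H (K x))"
proof -
  assume "comm_ring_hom H" "comm_ring_hom K"
  then interpret H: comm_ring_hom H + K: comm_ring_hom K by simp_all
  show ?thesis by unfold_locales (simp_all add: K.hom_add H.hom_add K.hom_mult H.hom_mult)
qed

lemma comm_ring_hom_const: "comm_ring_hom (\<lambda>c :: 'a :: comm_ring_1. [:c:])"
  by unfold_locales (simp_all add: one_pCons mult.commute)

lemma comm_ring_hom_pcompose: "comm_ring_hom (\<lambda>p :: 'a :: comm_ring_1 poly. pcompose p q)"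
  by unfold_locales (simp_all add: pcompose_add pcompose_mult one_pCons pcompose_const)

lemma comm_ring_hom_poly: "comm_ring_hom (\<lambda>p :: 'a :: comm_ring_1 poly. poly p a)"
  by unfold_locales simp_all

lemma comm_ring_hom_map_poly: "comm_ring_hom h \<Longrightarrow> comm_ring_hom (map_poly h)"
proof -
  assume "comm_ring_hom h"
  then interpret comm_ring_hom h .
  show ?thesis
    by unfold_locales (simp_all add: poly_eq_iff coeff_map_poly coeff_mult hom_add hom_mult hom_sum)
qed

lemma map_poly_const: "comm_ring_hom h \<Longrightarrow> map_poly h [:c:] = [:h c:]"
  "comm_ring_hom h \<Longrightarrow> map_poly h [:a, b:] = [:h a, h b:]"
proof -
  assume "comm_ring_hom h"
  then interpret comm_ring_hom h .
  show "map_poly h [:c:] = [:h c:]" "map_poly h [:a, b:] = [:h a, h b:]"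
    by (simp_all add: map_poly_pCons)
qed

text \<open>A homomorphism on a polynomial ring is determined by the constants and the variable. All
compatibilities between substitutions below are checked in this way.\<close>

lemma poly_hom_eqI:
  fixes H K :: "'a :: comm_ring_1 poly \<Rightarrow> 'b :: comm_ring_1"
  assumes "comm_ring_hom H" "comm_ring_hom K"
    and c: "\<And>c. H [:c:] = K [:c:]" and x: "H [:0, 1:] = K [:0, 1:]"
  shows "H p = K p"
proof -
  interpret H: comm_ring_hom H by fact
  interpret K: comm_ring_hom K by fact
  show ?thesis
  proof (induction p)
    case (pCons a p)
    have "pCons a p = [:a:] + [:0, 1:] * p" by simp
    then show ?case by (simp only: H.hom_add K.hom_add H.hom_mult K.hom_mult c x pCons)
  qed simp
qed

lemma map_mat_comp: "map_mat H (map_mat K A) = map_mat (\<lambda>x. H (K x)) A"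
  by (rule eq_matI) simp_all

lemma map_mat_hom_mult:
  "comm_ring_hom h \<Longrightarrow> A \<in> carrier_mat n n \<Longrightarrow> B \<in> carrier_mat n n \<Longrightarrow>
    map_mat h (A * B) = map_mat h A * map_mat h B"
proof -
  assume h: "comm_ring_hom h" and A: "A \<in> carrier_mat n n" "B \<in> carrier_mat n n"
  interpret comm_ring_hom h by (rule h)
  show ?thesis by (rule mat_hom_mult[OF A])
qed

lemma map_mat_hom_one: "comm_ring_hom h \<Longrightarrow> map_mat h (1\<^sub>m n) = 1\<^sub>m n"
proof -
  assume h: "comm_ring_hom h"
  interpret comm_ring_hom h by (rule h)
  show ?thesis by (rule mat_hom_one)
qed

section \<open>Local-global principle\<close>

text \<open>The properties of the canonical map into a ring of fractions by which matrices over the fractions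
are compared with matrices over the base. They pass to polynomial rings (\<open>fraction_hom_poly\<close>), with the
denominators regarded as constants.\<close>

locale fraction_hom =
  fixes \<Phi> :: "'a :: comm_ring_1 \<Rightarrow> 'b :: comm_ring_1" and S :: "'a set"
  assumes hom: "comm_ring_hom \<Phi>"
    and one_S: "1 \<in> S" and mult_S: "s \<in> S \<Longrightarrow> t \<in> S \<Longrightarrow> s * t \<in> S"
    and denominator: "\<exists>s\<in>S. \<exists>a. \<Phi> s * b = \<Phi> a"
    and annihilator: "\<Phi> a = 0 \<Longrightarrow> \<exists>s\<in>S. s * a = 0"
begin

sublocale comm_ring_hom \<Phi> by (rule hom)

lemma common_denominator:
  assumes "finite I"
  obtains s f where "s \<in> S" "\<And>i. i \<in> I \<Longrightarrow> \<Phi> s * g i = \<Phi> (f i)"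
proof -
  have "\<exists>s\<in>S. \<forall>i\<in>I. \<exists>a. \<Phi> s * g i = \<Phi> a"
    using assms
  proof (induction I)
    case (insert i I)
    then obtain s where s: "s \<in> S" "\<forall>i\<in>I. \<exists>a. \<Phi> s * g i = \<Phi> a" by blast
    obtain t a where t: "t \<in> S" "\<Phi> t * g i = \<Phi> a" using denominator by blast
    have "\<exists>a. \<Phi> (s * t) * g j = \<Phi> a" if "j \<in> insert i I" for j
    proof (cases "j = i")
      case True
      have "\<Phi> (s * t) * g i = \<Phi> (s * a)" using t(2) by (simp add: hom_mult mult.assoc)
      then show ?thesis using True by blast
    next
      case False
      then obtain a where "\<Phi> s * g j = \<Phi> a" using s(2) \<open>j \<in> insert i I\<close> by blast
      then have "\<Phi> (s * t) * g j = \<Phi> (a * t)" by (simp add: hom_mult mult_ac) (metis mult.assoc mult.commute)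
      then show ?thesis by blast
    qed
    then show ?case using mult_S[OF s(1) t(1)] by blast
  qed (use one_S in blast)
  then obtain s where "s \<in> S" "\<forall>i\<in>I. \<exists>a. \<Phi> s * g i = \<Phi> a" by blast
  then show ?thesis using that by metis
qed

lemma common_annihilator:
  assumes "finite I" "\<And>i. i \<in> I \<Longrightarrow> \<Phi> (f i) = 0"
  obtains s where "s \<in> S" "\<And>i. i \<in> I \<Longrightarrow> s * f i = 0"
proof -
  have "\<exists>s\<in>S. \<forall>i\<in>I. s * f i = 0"
    using assms
  proof (induction I)
    case (insert i I)
    then obtain s where s: "s \<in> S" "\<forall>i\<in>I. s * f i = 0" by blast
    obtain t where t: "t \<in> S" "t * f i = 0" using annihilator insert.prems by blast
    have "s * t * f j = 0" if "j \<in> insert i I" for j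
      using that s(2) t(2) by (cases "j = i") (auto simp: mult.assoc mult.left_commute[of s t])
    then show ?case using mult_S[OF s(1) t(1)] by blast
  qed (use one_S in blast)
  then show ?thesis using that by blast
qed

lemma poly_denominator: "\<exists>s\<in>S. \<exists>p. [:\<Phi> s:] * q = map_poly \<Phi> p"
proof -
  obtain s f where s: "s \<in> S" "\<And>i. i \<in> {..degree q} \<Longrightarrow> \<Phi> s * coeff q i = \<Phi> (f i)"
    by (rule common_denominator[of "{..degree q}" "coeff q"]) auto
  have "[:\<Phi> s:] * q = map_poly \<Phi> (\<Sum>i\<le>degree q. monom (f i) i)"
  proof (rule poly_eqI)
    fix i
    show "coeff ([:\<Phi> s:] * q) i = coeff (map_poly \<Phi> (\<Sum>i\<le>degree q. monom (f i) i)) i"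
      using s(2)[of i] by (cases "i \<le> degree q") (auto simp: coeff_map_poly coeff_sum coeff_eq_0)
  qed
  then show ?thesis using s(1) by blast
qed

lemma fraction_hom_poly: "fraction_hom (map_poly \<Phi>) ((\<lambda>s. [:s:]) ` S)"
proof (rule fraction_hom.intro)
  show "comm_ring_hom (map_poly \<Phi>)" by (rule comm_ring_hom_map_poly[OF hom])
  show "1 \<in> (\<lambda>s. [:s:]) ` S" using one_S by (force simp: one_pCons)
  show "s * t \<in> (\<lambda>s. [:s:]) ` S" if "s \<in> (\<lambda>s. [:s:]) ` S" "t \<in> (\<lambda>s. [:s:]) ` S" for s t
    using that mult_S by (auto simp: mult.commute)
  show "\<exists>s\<in>(\<lambda>s. [:s:]) ` S. \<exists>a. map_poly \<Phi> s * b = map_poly \<Phi> a" for b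
    using poly_denominator[of b] by (auto simp: map_poly_const[OF hom] simp del: mult_pCons_left)
  show "\<exists>s\<in>(\<lambda>s. [:s:]) ` S. s * a = 0" if "map_poly \<Phi> a = 0" for a
  proof -
    have "\<Phi> (coeff a i) = 0" for i
      using arg_cong[OF that, of "\<lambda>p. coeff p i"] by (simp add: coeff_map_poly)
    then obtain s where s: "s \<in> S" "\<And>i. i \<in> {..degree a} \<Longrightarrow> s * coeff a i = 0"
      using common_annihilator[of "{..degree a}" "coeff a"] by auto
    have "[:s:] * a = 0"
    proof (rule poly_eqI)
      fix i show "coeff ([:s:] * a) i = coeff 0 i"
        using s(2)[of i] by (cases "i \<le> degree a") (auto simp: coeff_eq_0)
    qed
    then show ?thesis using s(1) by blast
  qed
qed

text \<open>The matrices \<open>\<alpha>(T)\<close> such that \<open>\<alpha>(s T)\<close>, for some denominator \<open>s\<close>, is the image of an elementary matrix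
that is the identity at \<open>T = 0\<close>.\<close>

definition liftable :: "nat \<Rightarrow> 'b poly mat set" where
  "liftable n = {\<alpha> \<in> carrier_mat n n. \<exists>s\<in>S. \<exists>\<epsilon>\<in>elementary_group n.
     map_mat (\<lambda>p. poly p 0) \<epsilon> = 1\<^sub>m n \<and>
     map_mat (\<lambda>p. pcompose p [:0, \<Phi> s:]) \<alpha> = map_mat (map_poly \<Phi>) \<epsilon>}"

lemma liftable_one: "1\<^sub>m n \<in> liftable n"
  unfolding liftable_def
proof (intro CollectI conjI bexI[OF _ one_S] bexI[OF _ elementary_group_one])
  show "map_mat (\<lambda>p. pcompose p [:0, \<Phi> 1:]) (1\<^sub>m n) = map_mat (map_poly \<Phi>) (1\<^sub>m n)"
    by (simp only: map_mat_hom_one[OF comm_ring_hom_pcompose] map_mat_hom_one[OF comm_ring_hom_map_poly[OF hom]])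
qed (simp_all add: map_mat_hom_one[OF comm_ring_hom_poly])

lemma map_poly_dilation:
  "map_poly \<Phi> (pcompose p [:0, t:]) = pcompose (map_poly \<Phi> p) [:0, \<Phi> t:]"
proof -
  have "comm_ring_hom (\<lambda>p. map_poly \<Phi> (pcompose p [:0, t:]))"
    by (rule comm_ring_hom_comp[OF comm_ring_hom_map_poly[OF hom] comm_ring_hom_pcompose])
  moreover have "comm_ring_hom (\<lambda>p. pcompose (map_poly \<Phi> p) [:0, \<Phi> t:])"
    by (rule comm_ring_hom_comp[OF comm_ring_hom_pcompose comm_ring_hom_map_poly[OF hom]])
  ultimately show ?thesis
    by (rule poly_hom_eqI) (simp_all add: map_poly_const[OF hom] pcompose_pCons)
qed

lemma dilation_dilation: "pcompose (pcompose p [:0, s:]) [:0, t:] = pcompose p [:0, s * t:]"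
  for p :: "'c :: comm_ring_1 poly"
  by (simp add: pcompose_assoc[symmetric] pcompose_pCons mult.commute)

lemma dilation_liftable:
  fixes t :: 'a
  assumes \<alpha>: "map_mat (\<lambda>p. pcompose p [:0, \<Phi> s:]) \<alpha> = map_mat (map_poly \<Phi>) \<epsilon>"
    and \<epsilon>: "\<epsilon> \<in> elementary_group n" "map_mat (\<lambda>p. poly p 0) \<epsilon> = 1\<^sub>m n"
  defines "\<epsilon>' \<equiv> map_mat (\<lambda>p. pcompose p [:0, t:]) \<epsilon>"
  shows "map_mat (\<lambda>p. pcompose p [:0, \<Phi> (s * t):]) \<alpha> = map_mat (map_poly \<Phi>) \<epsilon>'"
    and "\<epsilon>' \<in> elementary_group n" and "map_mat (\<lambda>p. poly p 0) \<epsilon>' = 1\<^sub>m n"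
proof -
  have "map_mat (\<lambda>p. pcompose p [:0, \<Phi> (s * t):]) \<alpha>
    = map_mat (\<lambda>p. pcompose p [:0, \<Phi> t:]) (map_mat (\<lambda>p. pcompose p [:0, \<Phi> s:]) \<alpha>)"
    unfolding map_mat_comp dilation_dilation hom_mult ..
  also have "\<dots> = map_mat (map_poly \<Phi>) \<epsilon>'"
    unfolding \<alpha> \<epsilon>'_def map_mat_comp map_poly_dilation ..
  finally show "map_mat (\<lambda>p. pcompose p [:0, \<Phi> (s * t):]) \<alpha> = map_mat (map_poly \<Phi>) \<epsilon>'" .
  show "\<epsilon>' \<in> elementary_group n"
    unfolding \<epsilon>'_def by (rule elementary_group_hom[OF comm_ring_hom_pcompose \<epsilon>(1)])
  show "map_mat (\<lambda>p. poly p 0) \<epsilon>' = 1\<^sub>m n"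
    using \<epsilon>(2) unfolding \<epsilon>'_def map_mat_comp by (simp add: poly_pcompose)
qed

lemma liftable_mult:
  assumes "\<alpha> \<in> liftable n" "\<beta> \<in> liftable n"
  shows "\<alpha> * \<beta> \<in> liftable n"
proof -
  obtain s \<epsilon> where \<alpha>: "\<alpha> \<in> carrier_mat n n" "s \<in> S" "\<epsilon> \<in> elementary_group n"
    "map_mat (\<lambda>p. poly p 0) \<epsilon> = 1\<^sub>m n" "map_mat (\<lambda>p. pcompose p [:0, \<Phi> s:]) \<alpha> = map_mat (map_poly \<Phi>) \<epsilon>"
    using assms(1) unfolding liftable_def by auto
  obtain t \<delta> where \<beta>: "\<beta> \<in> carrier_mat n n" "t \<in> S" "\<delta> \<in> elementary_group n"
    "map_mat (\<lambda>p. poly p 0) \<delta> = 1\<^sub>m n" "map_mat (\<lambda>p. pcompose p [:0, \<Phi> t:]) \<beta> = map_mat (map_poly \<Phi>) \<delta>"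
    using assms(2) unfolding liftable_def by auto
  define \<epsilon>' where "\<epsilon>' = map_mat (\<lambda>p. pcompose p [:0, t:]) \<epsilon>"
  define \<delta>' where "\<delta>' = map_mat (\<lambda>p. pcompose p [:0, s:]) \<delta>"
  note E = dilation_liftable[OF \<alpha>(5,3,4), of t, folded \<epsilon>'_def]
  note D = dilation_liftable[OF \<beta>(5,3,4), of s, folded \<delta>'_def, unfolded mult.commute[of t s]]
  note c = elementary_group_carrier[OF E(2)] elementary_group_carrier[OF D(2)]
  have "map_mat (\<lambda>p. pcompose p [:0, \<Phi> (s * t):]) (\<alpha> * \<beta>) = map_mat (map_poly \<Phi>) (\<epsilon>' * \<delta>')"
    by (simp only: map_mat_hom_mult[OF comm_ring_hom_pcompose \<alpha>(1) \<beta>(1)]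
        map_mat_hom_mult[OF comm_ring_hom_map_poly[OF hom] c] E(1) D(1))
  moreover have "map_mat (\<lambda>p. poly p 0) (\<epsilon>' * \<delta>') = 1\<^sub>m n"
    by (simp add: map_mat_hom_mult[OF comm_ring_hom_poly c] E(3) D(3))
  ultimately show ?thesis
    unfolding liftable_def using mult_S[OF \<alpha>(2) \<beta>(2)] elementary_group_mult[OF E(2) D(2)]
      mult_carrier_mat[OF \<alpha>(1) \<beta>(1)] by blast
qed

lemma liftable_koszul:
  fixes v :: "nat \<Rightarrow> 'b"
  assumes kl: "k < n" "l < n" "k \<noteq> l" and n: "n \<ge> 3"
  shows "transvection n (\<lambda>i. [:v i:]) (\<lambda>i. if i = k then ([:0, 1:] * h) * [:v l:]
      else if i = l then - (([:0, 1:] * h) * [:v k:]) else 0) \<in> liftable n"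
proof -
  obtain s v' where s: "s \<in> S" "\<And>i. i \<in> {..<n} \<Longrightarrow> \<Phi> s * v i = \<Phi> (v' i)"
    by (rule common_denominator[of "{..<n}" v]) auto
  obtain t h' where t: "t \<in> S" "[:\<Phi> t:] * h = map_poly \<Phi> h'" using poly_denominator by blast
  \<comment> \<open>one factor \<open>s\<close> for each of the two entries of \<open>v\<close> in a product, and \<open>t\<close> for \<open>h\<close>\<close>
  define r where "r = s * (s * t)"
  define a where "a = [:0, 1:] * pcompose h' [:0, r:]"
  define x where "x = [:0, \<Phi> r:]"
  have dil: "pcompose ([:0, 1:] * h) x = [:\<Phi> r:] * ([:0, 1:] * pcompose h x)"
    by (simp add: pcompose_mult pcompose_pCons x_def)
  have entry: "pcompose ([:v i:] * (([:0, 1:] * h) * [:v j:])) x = map_poly \<Phi> ([:v' i:] * (a * [:v' j:]))"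
    if "i < n" "j < n" for i j
  proof -
    have "pcompose ([:v i:] * (([:0, 1:] * h) * [:v j:])) x
      = [:v i:] * (([:\<Phi> r:] * ([:0, 1:] * pcompose h x)) * [:v j:])"
      by (simp only: pcompose_mult[of "[:v i:]"] pcompose_mult[of _ "[:v j:]"] pcompose_const dil)
    also have "[:\<Phi> r:] = [:\<Phi> s:] * ([:\<Phi> s:] * [:\<Phi> t:])"
      by (simp add: r_def hom_mult mult_ac)
    also have "[:v i:] * (([:\<Phi> s:] * ([:\<Phi> s:] * [:\<Phi> t:]) * ([:0, 1:] * pcompose h x)) * [:v j:])
      = ([:\<Phi> s:] * [:v i:]) * (([:0, 1:] * ([:\<Phi> t:] * pcompose h x)) * ([:\<Phi> s:] * [:v j:]))"
      by (simp only: mult_ac)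
    also have "\<dots> = [:\<Phi> (v' i):] * (([:0, 1:] * ([:\<Phi> t:] * pcompose h x)) * [:\<Phi> (v' j):])"
    proof -
      have "[:\<Phi> s:] * [:v i:] = [:\<Phi> (v' i):]" "[:\<Phi> s:] * [:v j:] = [:\<Phi> (v' j):]"
        using s(2)[of i] s(2)[of j] that by (simp_all add: mult.commute)
      then show ?thesis by (simp only:)
    qed
    also have "[:\<Phi> t:] * pcompose h x = pcompose ([:\<Phi> t:] * h) x"
      by (simp only: pcompose_mult pcompose_const)
    also have "\<dots> = map_poly \<Phi> (pcompose h' [:0, r:])" unfolding t(2) map_poly_dilation x_def ..
    also have "[:\<Phi> (v' i):] * (([:0, 1:] * map_poly \<Phi> (pcompose h' [:0, r:])) * [:\<Phi> (v' j):])
      = map_poly \<Phi> ([:v' i:] * (a * [:v' j:]))"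
    proof -
      interpret P: comm_ring_hom "map_poly \<Phi>" by (rule comm_ring_hom_map_poly[OF hom])
      show ?thesis unfolding a_def by (simp only: P.hom_mult map_poly_const[OF hom] hom_zero hom_one)
    qed
    finally show ?thesis .
  qed
  define \<epsilon> where "\<epsilon> = transvection n (\<lambda>i. [:v' i:]) (\<lambda>i. if i = k then a * [:v' l:] else if i = l then - (a * [:v' k:]) else 0)"
  have \<epsilon>: "\<epsilon> \<in> elementary_group n" unfolding \<epsilon>_def by (rule transvection_koszul[OF kl n])
  moreover have "map_mat (\<lambda>p. poly p 0) \<epsilon> = 1\<^sub>m n"
    by (rule eq_matI) (auto simp: \<epsilon>_def a_def)
  moreover have "r \<in> S" unfolding r_def by (intro mult_S s(1) t(1))
  moreover have "map_mat (\<lambda>p. pcompose p [:0, \<Phi> r:]) (transvection n (\<lambda>i. [:v i:]) (\<lambda>i. if i = k then ([:0, 1:] * h) * [:v l:]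
      else if i = l then - (([:0, 1:] * h) * [:v k:]) else 0)) = map_mat (map_poly \<Phi>) \<epsilon>" (is "map_mat ?d ?\<alpha> = _")
  proof (rule eq_matI)
    interpret P: comm_ring_hom "map_poly \<Phi>" by (rule comm_ring_hom_map_poly[OF hom])
    interpret D: comm_ring_hom ?d by (rule comm_ring_hom_pcompose)
    fix i j assume "i < dim_row (map_mat (map_poly \<Phi>) \<epsilon>)" "j < dim_col (map_mat (map_poly \<Phi>) \<epsilon>)"
    then have ij: "i < n" "j < n" by (simp_all add: \<epsilon>_def)
    have delta: "?d (if i = j then 1 else 0) = map_poly \<Phi> (if i = j then 1 else 0)" by simp
    have "?d ([:v i:] * (if j = k then ([:0, 1:] * h) * [:v l:]
      else if j = l then - (([:0, 1:] * h) * [:v k:]) else 0)) =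
      map_poly \<Phi> ([:v' i:] * (if j = k then a * [:v' l:] else if j = l then - (a * [:v' k:]) else 0))"
      using entry[OF ij(1) kl(1), unfolded x_def] entry[OF ij(1) kl(2), unfolded x_def]
      by (simp only: if_distrib[of "\<lambda>x. [:v i:] * x"] mult_minus_right D.hom_uminus P.hom_uminus mult_zero_right
          D.hom_zero P.hom_zero split: if_split) (simp del: mult_pCons_left mult_pCons_right)
    then have "?d ((if i = j then 1 else 0) + [:v i:] * (if j = k then ([:0, 1:] * h) * [:v l:]
      else if j = l then - (([:0, 1:] * h) * [:v k:]) else 0)) =
      map_poly \<Phi> ((if i = j then 1 else 0) + [:v' i:] * (if j = k then a * [:v' l:] else if j = l then - (a * [:v' k:]) else 0))"
      by (simp only: D.hom_add P.hom_add delta)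
    then show "map_mat ?d ?\<alpha> $$ (i, j) = map_mat (map_poly \<Phi>) \<epsilon> $$ (i, j)"
      using ij by (simp only: \<epsilon>_def index_map_mat index_transvection)
  qed (simp_all add: \<epsilon>_def)
  ultimately show ?thesis unfolding liftable_def using transvection_carrier by blast
qed

lemma liftable_conjugate:
  fixes C D :: "'b mat"
  assumes C: "C \<in> carrier_mat n n" and D: "D \<in> carrier_mat n n" and CD: "C * D = 1\<^sub>m n" "D * C = 1\<^sub>m n"
    and ij: "i < n" "j < n" "i \<noteq> j" and n: "n \<ge> 3"
  shows "map_mat (\<lambda>c. [:c:]) C * addrow_mat n ([:0, 1:] * h) i j * map_mat (\<lambda>c. [:c:]) D \<in> liftable n"
proof -
  let ?c = "map_mat (\<lambda>c :: 'b. [:c:])"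
  note cc = C[THEN map_carrier_mat[THEN iffD2], of "\<lambda>c. [:c:]"] D[THEN map_carrier_mat[THEN iffD2], of "\<lambda>c. [:c:]"]
  have 1: "?c C * ?c D = 1\<^sub>m n"
    using map_mat_hom_mult[OF comm_ring_hom_const C D] CD(1) map_mat_hom_one[OF comm_ring_hom_const] by metis
  define v where "v k = C $$ (k, i)" for k
  define w where "w k = D $$ (j, k)" for k
  define u where "u k = D $$ (i, k)" for k
  have uv: "(\<Sum>l<n. u l * v l) = 1" and wv: "(\<Sum>l<n. w l * v l) = 0"
    using index_mult_mat_sum[OF D C ij(1,1)] index_mult_mat_sum[OF D C ij(2,1)] ij CD(2)
    by (simp_all add: u_def v_def w_def)
  let ?S = "{(p, q). p < q \<and> q < n}"
  define c where "c p q = w p * u q - w q * u p" for p q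
  define f where "f = (\<lambda>(p, q) k. if k = p then ([:0, 1:] * (h * [:c p q:])) * [:v q:]
      else if k = q then - (([:0, 1:] * (h * [:c p q:])) * [:v p:]) else 0)"
  have fin: "finite ?S" by (rule finite_subset[of _ "{..<n} \<times> {..<n}"]) auto
  have "?c C * addrow_mat n ([:0, 1:] * h) i j * ?c D
    = transvection n (\<lambda>k. ?c C $$ (k, i)) (\<lambda>k. ([:0, 1:] * h) * ?c D $$ (j, k))"
    by (rule conjugate_addrow_mat[OF cc 1 ij])
  also have "\<dots> = transvection n (\<lambda>k. [:v k:]) (\<lambda>k. \<Sum>pq\<in>?S. f pq k)"
  proof (rule transvection_cong)
    show "?c C $$ (k, i) = [:v k:]" if "k < n" for k using that ij C by (simp add: v_def)
    fix k assume k: "k < n"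
    have "[:w k:] = [:\<Sum>(p, q)\<in>?S. if k = p then c p q * v q else if k = q then - (c p q * v p) else 0:]"
      using koszul_decomposition[OF uv wv k] by (simp only: c_def)
    also have "\<dots> = (\<Sum>(p, q)\<in>?S. [:if k = p then c p q * v q else if k = q then - (c p q * v p) else 0:])"
    proof -
      interpret K: comm_ring_hom "\<lambda>c :: 'b. [:c:]" by (rule comm_ring_hom_const)
      show ?thesis unfolding K.hom_sum by (rule sum.cong) auto
    qed
    finally have wk: "[:w k:] = (\<Sum>(p, q)\<in>?S. [:if k = p then c p q * v q else if k = q then - (c p q * v p) else 0:])" .
    have "([:0, 1:] * h) * [:w k:] = (\<Sum>pq\<in>?S. f pq k)"
      unfolding wk sum_distrib_left by (rule sum.cong) (auto simp: f_def mult_ac)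
    then show "([:0, 1:] * h) * ?c D $$ (j, k) = (\<Sum>pq\<in>?S. f pq k)"
      using k ij D by (simp add: w_def del: mult_pCons_left)
  qed
  also have "\<dots> \<in> liftable n"
  proof (rule transvection_sum_right[OF fin])
    fix pq assume "pq \<in> ?S"
    then obtain p q where pq: "pq = (p, q)" "p < q" "q < n" by auto
    have "(\<Sum>k<n. f pq k * [:v k:]) = (\<Sum>k\<in>{p, q}. f pq k * [:v k:])"
      using pq by (intro sum.mono_neutral_right) (auto simp: f_def)
    also have "\<dots> = 0" using pq by (simp add: f_def mult_ac)
    finally show "(\<Sum>k<n. f pq k * [:v k:]) = 0" .
    show "transvection n (\<lambda>k. [:v k:]) (f pq) \<in> liftable n"
      unfolding pq(1) f_def split_conv using pq n by (intro liftable_koszul) auto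
  qed (rule liftable_one, rule liftable_mult)
  finally show ?thesis .
qed

end

text \<open>The substitution \<open>p(x) \<mapsto> p(x + T)\<close>, where \<open>T\<close> is the outer variable.\<close>

definition shift :: "'a :: comm_ring_1 poly \<Rightarrow> 'a poly poly" where
  "shift p = pcompose (map_poly (\<lambda>c. [:c:]) p) [:[:0, 1:], 1:]"

lemma comm_ring_hom_shift: "comm_ring_hom shift"
  unfolding shift_def[abs_def]
  by (rule comm_ring_hom_comp[OF comm_ring_hom_pcompose comm_ring_hom_map_poly[OF comm_ring_hom_const]])

lemma shift_const: "shift [:c:] = [:[:c:]:]"
  by (simp add: shift_def map_poly_const[OF comm_ring_hom_const] pcompose_const)

lemma shift_x: "shift [:0, 1:] = [:[:0, 1:], 1:]"
  by (simp add: shift_def map_poly_const[OF comm_ring_hom_const] pcompose_pCons one_pCons)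

lemma poly_shift_0: "poly (shift p) 0 = p"
  by (rule poly_hom_eqI[OF comm_ring_hom_comp[OF comm_ring_hom_poly comm_ring_hom_shift]])
     (unfold_locales, simp_all add: shift_const shift_x)

lemma shift_decomposition:
  obtains h where "shift p = [:p:] + [:0, 1:] * h"
proof -
  have "coeff (shift p - [:p:]) 0 = 0" using poly_shift_0[of p] by (simp add: poly_0_coeff_0)
  then obtain h where "shift p - [:p:] = [:0, 1:] * h" by (rule poly_eq_x_mult)
  then have "shift p = [:p:] + [:0, 1:] * h" by (simp add: diff_eq_eq add.commute)
  then show ?thesis by (rule that)
qed

lemma addrow_mat_add:
  fixes a b :: "'a :: comm_ring_1"
  assumes "i < n" "j < n" "i \<noteq> j"
  shows "addrow_mat n (a + b) i j = addrow_mat n a i j * addrow_mat n b i j"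
  unfolding addrow_mat[OF addrow_mat_carrier assms(2), symmetric]
  using assms by (intro eq_matI) (auto simp: algebra_simps)

lemma map_mat_addrow: "comm_ring_hom h \<Longrightarrow> map_mat h (addrow_mat n a i j) = addrow_mat n (h a) i j"
proof -
  assume "comm_ring_hom h"
  then interpret comm_ring_hom h .
  show ?thesis by (rule eq_matI) (simp_all add: hom_add)
qed

text \<open>Quillen's ideal for \<open>\<sigma>\<close>. The polynomials \<open>f\<close> and \<open>g\<close> are arbitrary so that the steps \<open>s\<close> can be
added.\<close>

definition translation_set :: "nat \<Rightarrow> 'a :: comm_ring_1 poly mat \<Rightarrow> 'a set" where
  "translation_set n \<sigma> = {s. \<forall>f g. \<exists>\<epsilon>\<in>elementary_group n.
     map_mat (\<lambda>p. pcompose p (f + [:s:] * g)) \<sigma> = map_mat (\<lambda>p. pcompose p f) \<sigma> * \<epsilon>}"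

context fraction_hom
begin

lemma map_poly_shift: "map_poly (map_poly \<Phi>) (shift p) = shift (map_poly \<Phi> p)"
proof -
  note P = comm_ring_hom_map_poly[OF hom]
  have "comm_ring_hom (\<lambda>p. map_poly (map_poly \<Phi>) (shift p))"
    by (rule comm_ring_hom_comp[OF comm_ring_hom_map_poly[OF P] comm_ring_hom_shift])
  moreover have "comm_ring_hom (\<lambda>p. shift (map_poly \<Phi> p))"
    by (rule comm_ring_hom_comp[OF comm_ring_hom_shift P])
  ultimately show ?thesis
    by (rule poly_hom_eqI) (simp_all add: map_poly_const[OF hom] map_poly_const[OF P] shift_const shift_x)
qed

interpretation poly: fraction_hom "map_poly \<Phi>" "(\<lambda>s. [:s:]) ` S"
  by (rule fraction_hom_poly)

text \<open>The quotient of \<open>\<gamma>(x + T)\<close> by \<open>\<gamma>(x)\<close> is multiplicative up to conjugation by matrices that do not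
involve \<open>T\<close>, and for a single elementary matrix it is elementary with an entry divisible by \<open>T\<close>.\<close>

lemma shift_liftable:
  assumes "\<gamma> \<in> elementary_group n" and n: "n \<ge> 3"
  shows "\<exists>\<alpha> \<in> poly.liftable n. map_mat shift \<gamma> = map_mat (\<lambda>c. [:c:]) \<gamma> * \<alpha>"
  using assms(1)
proof (induction rule: elementary_group_induct)
  case one
  have "map_mat shift (1\<^sub>m n) = map_mat (\<lambda>c. [:c:]) (1\<^sub>m n) * (1\<^sub>m n :: 'b poly poly mat)"
    by (simp only: map_mat_hom_one[OF comm_ring_hom_shift] map_mat_hom_one[OF comm_ring_hom_const])
       (use left_mult_one_mat[of "1\<^sub>m n :: 'b poly poly mat" n n] in simp)
  then show ?case using poly.liftable_one by blast
next
  case (addrow a i j B)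
  let ?c = "map_mat (\<lambda>c :: 'b poly. [:c:])"
  obtain \<alpha> where \<alpha>: "\<alpha> \<in> poly.liftable n" "map_mat shift B = ?c B * \<alpha>" using addrow.IH by blast
  obtain C where C: "C \<in> elementary_group n" "B * C = 1\<^sub>m n" "C * B = 1\<^sub>m n"
    using addrow(4) by (rule elementary_group_inverse)
  note B = elementary_group_carrier[OF addrow(4)] and C' = elementary_group_carrier[OF C(1)]
  have \<alpha>c: "\<alpha> \<in> carrier_mat n n" using \<alpha>(1) by (simp add: poly.liftable_def)
  have cc: "?c B \<in> carrier_mat n n" "?c C \<in> carrier_mat n n" using B C' by simp_all
  obtain h where h: "shift a = [:a:] + [:0, 1:] * h" by (rule shift_decomposition)
  define M where "M = ?c C * addrow_mat n ([:0, 1:] * h) i j * ?c B"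
  have M: "M \<in> poly.liftable n"
    unfolding M_def by (rule poly.liftable_conjugate[OF C' B C(3,2) addrow(1-3) n])
  have Mc: "M \<in> carrier_mat n n" using M by (simp add: poly.liftable_def)
  have cBC: "?c B * ?c C = 1\<^sub>m n"
    using map_mat_hom_mult[OF comm_ring_hom_const B C'] C(2) map_mat_hom_one[OF comm_ring_hom_const] by metis
  let ?a = "addrow_mat n [:a:] i j" and ?h = "addrow_mat n ([:0, 1:] * h) i j"
  have A: "P * (Q * R) = P * Q * R" if "P \<in> carrier_mat n n" "Q \<in> carrier_mat n n" "R \<in> carrier_mat n n"
    for P Q R :: "'b poly poly mat"
    using assoc_mult_mat[OF that] ..
  have m: "P * Q \<in> carrier_mat n n" if "P \<in> carrier_mat n n" "Q \<in> carrier_mat n n" for P Q :: "'b poly poly mat"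
    using mult_carrier_mat[OF that] .
  have ah: "?a \<in> carrier_mat n n" "?h \<in> carrier_mat n n" by (rule addrow_mat_carrier)+
  have "?c B * M = ?c B * (?c C * ?h) * ?c B" unfolding M_def by (intro A m cc ah)
  also have "?c B * (?c C * ?h) = ?c B * ?c C * ?h" by (intro A m cc ah)
  also have "\<dots> = ?h" unfolding cBC by (rule left_mult_one_mat[OF ah(2)])
  finally have BM: "?c B * M = ?h * ?c B" .
  have "map_mat shift (addrow_mat n a i j * B) = map_mat shift (addrow_mat n a i j) * map_mat shift B"
    by (rule map_mat_hom_mult[OF comm_ring_hom_shift addrow_mat_carrier B])
  also have "map_mat shift (addrow_mat n a i j) = ?a * ?h"
    by (simp only: map_mat_addrow[OF comm_ring_hom_shift] h addrow_mat_add[OF addrow(1-3)])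
  also have "?a * ?h * map_mat shift B = ?a * ?h * ?c B * \<alpha>"
    unfolding \<alpha>(2) by (intro A m cc ah \<alpha>c)
  also have "?a * ?h * ?c B = ?a * (?h * ?c B)" by (intro A[symmetric] m cc ah)
  also have "\<dots> = ?a * ?c B * M" unfolding BM[symmetric] by (intro A m cc ah Mc)
  also have "?a * ?c B * M * \<alpha> = ?a * ?c B * (M * \<alpha>)" by (intro A[symmetric] m cc ah Mc \<alpha>c)
  also have "?a * ?c B = ?c (addrow_mat n a i j * B)"
    by (simp only: map_mat_hom_mult[OF comm_ring_hom_const addrow_mat_carrier B] map_mat_addrow[OF comm_ring_hom_const])
  finally show ?case using poly.liftable_mult[OF M \<alpha>(1)] by blast
qed

text \<open>For a suitable denominator \<open>s\<close> the matrices \<open>\<sigma>(x + s T)\<close> and \<open>\<sigma>(x) \<epsilon>(T)\<close>, with \<open>\<epsilon>\<close> elementary over the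
base, have the same image. They also agree at \<open>T = 0\<close>, so their difference has no constant term in \<open>T\<close>, and a
further dilation by an annihilator \<open>t\<close> of its coefficients removes it. Finally \<open>x\<close> and \<open>T\<close> are specialized to \<open>f\<close>
and \<open>g\<close>.\<close>

theorem translation_set_meets:
  assumes n: "n \<ge> 3" and \<sigma>: "\<sigma> \<in> carrier_mat n n"
    and el: "map_mat (map_poly \<Phi>) \<sigma> \<in> elementary_group n"
  shows "\<exists>s\<in>S. s \<in> translation_set n \<sigma>"
proof -
  let ?\<Phi> = "map_poly (map_poly \<Phi>)" and ?c = "map_mat (\<lambda>c :: 'a poly. [:c:])" and ?c' = "map_mat (\<lambda>c :: 'b poly. [:c:])"
  note P = comm_ring_hom_map_poly[OF hom]
  note PP = comm_ring_hom_map_poly[OF P]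
  define \<sigma>' where "\<sigma>' = map_mat (map_poly \<Phi>) \<sigma>"
  have \<sigma>': "\<sigma>' \<in> carrier_mat n n" using \<sigma> by (simp add: \<sigma>'_def)
  obtain \<alpha> where \<alpha>: "\<alpha> \<in> poly.liftable n" "map_mat shift \<sigma>' = ?c' \<sigma>' * \<alpha>"
    using shift_liftable[OF el n] unfolding \<sigma>'_def by blast
  then obtain s \<epsilon> where \<alpha>c: "\<alpha> \<in> carrier_mat n n" and s: "s \<in> S" and \<epsilon>: "\<epsilon> \<in> elementary_group n"
      "map_mat (\<lambda>p. poly p 0) \<epsilon> = 1\<^sub>m n"
      and d\<alpha>: "map_mat (\<lambda>p. pcompose p [:0, map_poly \<Phi> [:s:]:]) \<alpha> = map_mat ?\<Phi> \<epsilon>"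
    unfolding poly.liftable_def by auto
  note \<epsilon>c = elementary_group_carrier[OF \<epsilon>(1)]
  define A where "A = map_mat (\<lambda>p. pcompose (shift p) [:0, [:s:]:]) \<sigma>"
  define B where "B = ?c \<sigma> * \<epsilon>"
  have c\<sigma>: "?c \<sigma> \<in> carrier_mat n n" "?c' \<sigma>' \<in> carrier_mat n n" using \<sigma> \<sigma>' by simp_all
  have AB: "A \<in> carrier_mat n n" "B \<in> carrier_mat n n"
    unfolding A_def B_def using \<sigma> mult_carrier_mat[OF c\<sigma>(1) \<epsilon>c] by simp_all
  have "map_mat ?\<Phi> A = map_mat (\<lambda>p. pcompose p [:0, map_poly \<Phi> [:s:]:]) (map_mat shift \<sigma>')"
    unfolding A_def \<sigma>'_def map_mat_comp poly.map_poly_dilation map_poly_shift ..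
  also have "\<dots> = map_mat (\<lambda>p. pcompose p [:0, map_poly \<Phi> [:s:]:]) (?c' \<sigma>') * map_mat ?\<Phi> \<epsilon>"
    unfolding \<alpha>(2) map_mat_hom_mult[OF comm_ring_hom_pcompose c\<sigma>(2) \<alpha>c] d\<alpha> ..
  also have "map_mat (\<lambda>p. pcompose p [:0, map_poly \<Phi> [:s:]:]) (?c' \<sigma>') = map_mat ?\<Phi> (?c \<sigma>)"
    unfolding \<sigma>'_def map_mat_comp pcompose_const map_poly_const[OF P] ..
  also have "map_mat ?\<Phi> (?c \<sigma>) * map_mat ?\<Phi> \<epsilon> = map_mat ?\<Phi> B"
    unfolding B_def by (rule map_mat_hom_mult[OF PP c\<sigma>(1) \<epsilon>c, symmetric])
  finally have \<Phi>AB: "map_mat ?\<Phi> A = map_mat ?\<Phi> B" .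
  have "map_mat (\<lambda>p. poly p 0) A = \<sigma>"
    unfolding A_def map_mat_comp by (rule eq_matI) (simp_all add: poly_pcompose poly_shift_0)
  moreover have "map_mat (\<lambda>p. poly p 0) B = \<sigma>"
  proof -
    have "map_mat (\<lambda>p. poly p 0) B = map_mat (\<lambda>p. poly p 0) (?c \<sigma>) * 1\<^sub>m n"
      unfolding B_def map_mat_hom_mult[OF comm_ring_hom_poly c\<sigma>(1) \<epsilon>c] \<epsilon>(2) ..
    also have "map_mat (\<lambda>p. poly p 0) (?c \<sigma>) = \<sigma>"
      unfolding map_mat_comp by (rule eq_matI) simp_all
    finally show ?thesis using \<sigma> by simp
  qed
  ultimately have AB0: "map_mat (\<lambda>p. poly p 0) A = map_mat (\<lambda>p. poly p 0) B" by simp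
  define D where "D i j = A $$ (i, j) - B $$ (i, j)" for i j
  have D0: "coeff (D i j) 0 = 0" if "i < n" "j < n" for i j
    using arg_cong[OF AB0, of "\<lambda>M. M $$ (i, j)"] that AB by (simp add: D_def poly_0_coeff_0)
  have \<Phi>D: "map_poly \<Phi> (coeff (D i j) k) = 0" if "i < n" "j < n" for i j k
  proof -
    interpret P: comm_ring_hom ?\<Phi> by (rule PP)
    have "?\<Phi> (D i j) = 0"
      using arg_cong[OF \<Phi>AB, of "\<lambda>M. M $$ (i, j)"] that AB by (simp add: D_def P.hom_minus)
    from arg_cong[OF this, of "\<lambda>p. coeff p k"] show ?thesis by (simp add: coeff_map_poly)
  qed
  define I where "I = (SIGMA i:{..<n}. SIGMA j:{..<n}. {..degree (D i j)})"
  have "finite I" by (simp add: I_def)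
  then obtain t' where t': "t' \<in> (\<lambda>s. [:s:]) ` S" "\<And>x. x \<in> I \<Longrightarrow> t' * (case x of (i, j, k) \<Rightarrow> coeff (D i j) k) = 0"
    by (rule poly.common_annihilator[of I "\<lambda>(i, j, k). coeff (D i j) k"]) (use \<Phi>D in \<open>auto simp: I_def\<close>)
  then obtain t where t: "t \<in> S" "t' = [:t:]" by blast
  have tD: "[:t:] * coeff (D i j) k = 0" if "i < n" "j < n" for i j k
    using t'(2)[of "(i, j, k)"] that t(2) by (cases "k \<le> degree (D i j)") (auto simp: I_def coeff_eq_0)
  have dD: "pcompose (D i j) [:0, [:t:]:] = 0" if "i < n" "j < n" for i j
  proof (rule poly_eqI)
    fix k show "coeff (pcompose (D i j) [:0, [:t:]:]) k = coeff 0 k"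
      using D0[OF that] tD[OF that, of k] by (cases k) (simp_all add: coeff_pcompose_linear poly_0_coeff_0 mult.assoc mult.left_commute[of "[:t:]"] del: mult_pCons_left)
  qed
  have dAB: "map_mat (\<lambda>p. pcompose p [:0, [:t:]:]) A = map_mat (\<lambda>p. pcompose p [:0, [:t:]:]) B"
    using dD AB by (intro eq_matI) (auto simp: D_def pcompose_diff)
  have "s * t \<in> translation_set n \<sigma>"
    unfolding translation_set_def
  proof (intro CollectI allI)
    fix f g :: "'a poly"
    define \<theta> where "\<theta> p = poly (map_poly (\<lambda>c. pcompose c f) (pcompose p [:0, [:t:]:])) g" for p
    note Q = comm_ring_hom_map_poly[OF comm_ring_hom_pcompose[of f]]
    have \<theta>: "comm_ring_hom \<theta>"
      unfolding \<theta>_def[abs_def]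
      by (rule comm_ring_hom_comp[OF comm_ring_hom_poly comm_ring_hom_comp[OF Q comm_ring_hom_pcompose]])
    have \<theta>c: "\<theta> [:c:] = pcompose c f" for c
      by (simp add: \<theta>_def pcompose_const map_poly_const[OF comm_ring_hom_pcompose])
    have "\<theta> (pcompose (shift p) [:0, [:s:]:]) = pcompose p (f + [:s * t:] * g)" for p
    proof -
      have "comm_ring_hom (\<lambda>p. \<theta> (pcompose (shift p) [:0, [:s:]:]))"
        by (rule comm_ring_hom_comp[OF \<theta> comm_ring_hom_comp[OF comm_ring_hom_pcompose comm_ring_hom_shift]])
      then show ?thesis
      proof (rule poly_hom_eqI[OF _ comm_ring_hom_pcompose])
        show "\<theta> (pcompose (shift [:c:]) [:0, [:s:]:]) = pcompose [:c:] (f + [:s * t:] * g)" for c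
          by (simp add: shift_const pcompose_const \<theta>c)
        show "\<theta> (pcompose (shift [:0, 1:]) [:0, [:s:]:]) = pcompose [:0, 1:] (f + [:s * t:] * g)"
          by (simp add: shift_x \<theta>_def pcompose_pCons map_poly_const[OF comm_ring_hom_pcompose] one_pCons mult.commute)
      qed
    qed
    then have \<theta>A: "map_mat \<theta> A = map_mat (\<lambda>p. pcompose p (f + [:s * t:] * g)) \<sigma>"
      unfolding A_def map_mat_comp by simp
    have "map_mat \<theta> A = map_mat \<theta> B"
      using arg_cong[OF dAB, of "map_mat (\<lambda>p. poly (map_poly (\<lambda>c. pcompose c f) p) g)"]
      unfolding map_mat_comp \<theta>_def .
    also have "\<dots> = map_mat \<theta> (?c \<sigma>) * map_mat \<theta> \<epsilon>"
      unfolding B_def by (rule map_mat_hom_mult[OF \<theta> c\<sigma>(1) \<epsilon>c])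
    also have "map_mat \<theta> (?c \<sigma>) = map_mat (\<lambda>p. pcompose p f) \<sigma>"
      unfolding map_mat_comp \<theta>c ..
    finally show "\<exists>\<epsilon>\<in>elementary_group n. map_mat (\<lambda>p. pcompose p (f + [:s * t:] * g)) \<sigma> = map_mat (\<lambda>p. pcompose p f) \<sigma> * \<epsilon>"
      unfolding \<theta>A using elementary_group_hom[OF \<theta> \<epsilon>(1)] by blast
  qed
  then show ?thesis using mult_S[OF s t(1)] by blast
qed

end

lemma translation_set_ideal:
  fixes \<sigma> :: "'a :: comm_ring_1 poly mat"
  assumes \<sigma>: "\<sigma> \<in> carrier_mat n n"
  shows "0 \<in> translation_set n \<sigma>"
    and "s \<in> translation_set n \<sigma> \<Longrightarrow> r * s \<in> translation_set n \<sigma>"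
    and "s \<in> translation_set n \<sigma> \<Longrightarrow> t \<in> translation_set n \<sigma> \<Longrightarrow> s + t \<in> translation_set n \<sigma>"
proof -
  let ?e = "\<lambda>f. map_mat (\<lambda>p. pcompose p f) \<sigma>"
  have c: "?e f \<in> carrier_mat n n" for f using \<sigma> by simp
  show "0 \<in> translation_set n \<sigma>"
    unfolding translation_set_def
  proof (intro CollectI allI bexI)
    show "?e (f + [:0:] * g) = ?e f * 1\<^sub>m n" for f g using right_mult_one_mat[OF c[of f]] by simp
  qed simp
  show "r * s \<in> translation_set n \<sigma>" if s: "s \<in> translation_set n \<sigma>"
    unfolding translation_set_def
  proof (intro CollectI allI)
    fix f g
    have "[:r * s:] * g = [:s:] * ([:r:] * g)" by (simp add: mult.commute)
    then show "\<exists>\<epsilon>\<in>elementary_group n. ?e (f + [:r * s:] * g) = ?e f * \<epsilon>"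
      using s unfolding translation_set_def by (simp only: mem_Collect_eq)
  qed
  show "s + t \<in> translation_set n \<sigma>" if s: "s \<in> translation_set n \<sigma>" "t \<in> translation_set n \<sigma>"
    unfolding translation_set_def
  proof (intro CollectI allI)
    fix f g
    obtain \<epsilon> where \<epsilon>: "\<epsilon> \<in> elementary_group n" "?e (f + [:s:] * g) = ?e f * \<epsilon>"
      using s(1) unfolding translation_set_def by blast
    obtain \<delta> where \<delta>: "\<delta> \<in> elementary_group n" "?e (f + [:s:] * g + [:t:] * g) = ?e (f + [:s:] * g) * \<delta>"
      using s(2) unfolding translation_set_def by blast
    have "[:s + t:] * g = [:s:] * g + [:t:] * g" by (simp add: smult_add_left)
    then have "?e (f + [:s + t:] * g) = ?e f * \<epsilon> * \<delta>" using \<delta>(2) by (simp only: \<epsilon>(2) add.assoc)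
    also have "\<dots> = ?e f * (\<epsilon> * \<delta>)" 
      by (rule assoc_mult_mat[OF c elementary_group_carrier[OF \<epsilon>(1)] elementary_group_carrier[OF \<delta>(1)]])
    finally show "\<exists>\<epsilon>\<in>elementary_group n. ?e (f + [:s + t:] * g) = ?e f * \<epsilon>"
      using elementary_group_mult[OF \<epsilon>(1) \<delta>(1)] by blast
  qed
qed

section \<open>Localizations as types\<close>

abbreviation type_ring :: "'a :: comm_ring_1 ring" where
  "type_ring \<equiv> ring_of_type_algebra"

lemma type_ring_simps [simp]:
  "carrier (type_ring :: 'a :: comm_ring_1 ring) = UNIV"
  "mult (type_ring :: 'a ring) = (*)" "add (type_ring :: 'a ring) = (+)"
  "one (type_ring :: 'a ring) = 1" "zero (type_ring :: 'a ring) = 0"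
  by (simp_all add: ring_of_type_algebra_def)

lemma cring_type_ring: "cring (type_ring :: 'a :: comm_ring_1 ring)"
  by (rule cring_from_type_algebra)

text \<open>The sets of denominators at which the theorem would fail. Polynomials and matrices need a type of
coefficients, but the localization at \<open>S\<close> depends on the variable \<open>S\<close>. A single obstructed set, however, if
there is one, can be chosen once and for all. This makes it a constant, and its localization a type, to
which \<open>SL_valuation_type\<close> applies; a contradiction results (\<open>not_obstructed\<close>).\<close>

definition obstructed :: "'a :: comm_ring_1 set \<Rightarrow> bool" where
  "obstructed S \<longleftrightarrow> submonoid S (type_ring :: 'a ring) \<and> 0 \<notin> S
     \<and> valuation_ring (localization (type_ring :: 'a ring) S)
     \<and> (\<exists>n\<ge>3. \<exists>\<sigma> \<in> carrier_mat n n. det \<sigma> = 1 \<and> S \<inter> translation_set n \<sigma> = {})"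

text \<open>If no set is obstructed, then \<open>{1}\<close> serves as a default, so that the type of fractions is a ring in
any case.\<close>

definition obstructed_set :: "'a :: comm_ring_1 set" where
  "obstructed_set = (if \<exists>S :: 'a set. obstructed S then SOME S. obstructed S else {1})"

lemma obstructed_set:
  fixes S :: "'a :: comm_ring_1 set"
  defines "S \<equiv> obstructed_set"
  shows "submonoid S type_ring" "0 \<notin> S"
proof -
  have "submonoid S type_ring \<and> 0 \<notin> S"
  proof (cases "\<exists>S :: 'a set. obstructed S")
    case True
    then have "obstructed S"
      unfolding S_def obstructed_set_def using someI_ex by simp
    then show ?thesis by (simp add: obstructed_def)
  next
    case False
    have "S = {1}" unfolding S_def obstructed_set_def if_not_P[OF False] ..
    then show ?thesis by (simp add: submonoid_def)
  qed
  then show "submonoid S type_ring" "0 \<notin> S" by simp_all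
qed

lemma obstructed_fractions: "cring_fractions (type_ring :: 'a :: comm_ring_1 ring) obstructed_set"
  by (intro cring_fractions.intro cring_fractions_axioms.intro cring_type_ring obstructed_set)

abbreviation obstructed_localization :: "('a :: comm_ring_1 \<times> 'a) set ring" where
  "obstructed_localization \<equiv> localization type_ring obstructed_set"

lemma cring_obstructed_localization: "cring (obstructed_localization :: ('a :: comm_ring_1 \<times> 'a) set ring)"
  by (rule cring_fractions.cring_localization[OF obstructed_fractions])

typedef (overloaded) 'a obstructed_local =
  "carrier (obstructed_localization :: ('a :: comm_ring_1 \<times> 'a) set ring)"
proof -
  interpret cring "obstructed_localization :: ('a \<times> 'a) set ring" by (rule cring_obstructed_localization)
  show ?thesis using zero_closed by blast
qed

instantiation obstructed_local :: (comm_ring_1) comm_ring_1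
begin

definition zero_obstructed_local :: "'a obstructed_local" where
  "0 = Abs_obstructed_local \<zero>\<^bsub>obstructed_localization\<^esub>"
definition one_obstructed_local :: "'a obstructed_local" where
  "1 = Abs_obstructed_local \<one>\<^bsub>obstructed_localization\<^esub>"
definition plus_obstructed_local :: "'a obstructed_local \<Rightarrow> 'a obstructed_local \<Rightarrow> 'a obstructed_local" where
  "x + y = Abs_obstructed_local (Rep_obstructed_local x \<oplus>\<^bsub>obstructed_localization\<^esub> Rep_obstructed_local y)"
definition times_obstructed_local :: "'a obstructed_local \<Rightarrow> 'a obstructed_local \<Rightarrow> 'a obstructed_local" where
  "x * y = Abs_obstructed_local (Rep_obstructed_local x \<otimes>\<^bsub>obstructed_localization\<^esub> Rep_obstructed_local y)"
definition uminus_obstructed_local :: "'a obstructed_local \<Rightarrow> 'a obstructed_local" where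
  "- x = Abs_obstructed_local (\<ominus>\<^bsub>obstructed_localization\<^esub> Rep_obstructed_local x)"
definition minus_obstructed_local :: "'a obstructed_local \<Rightarrow> 'a obstructed_local \<Rightarrow> 'a obstructed_local" where
  "x - y = x + - (y :: 'a obstructed_local)"

instance
proof -
  interpret L: cring "obstructed_localization :: ('a \<times> 'a) set ring" by (rule cring_obstructed_localization)
  interpret Q: cring_fractions "type_ring :: 'a ring" obstructed_set by (rule obstructed_fractions)
  note [simp] = Rep_obstructed_local Abs_obstructed_local_inverse Rep_obstructed_local_inverse
  note defs = zero_obstructed_local_def one_obstructed_local_def plus_obstructed_local_def times_obstructed_local_def
    uminus_obstructed_local_def minus_obstructed_local_def
  have "(0 :: 'a obstructed_local) \<noteq> 1"
  proof
    assume "(0 :: 'a obstructed_local) = 1"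
    then have "Rep_obstructed_local (0 :: 'a obstructed_local) = Rep_obstructed_local 1" by simp
    then have "\<zero>\<^bsub>obstructed_localization :: ('a \<times> 'a) set ring\<^esub> = \<one>\<^bsub>obstructed_localization\<^esub>"
      by (simp add: defs)
    then have "fraction type_ring obstructed_set (0 :: 'a) 1 = fraction type_ring obstructed_set 1 1"
      by (simp add: Q.localization_zero Q.localization_one)
    then have "(1 :: 'a, 1) \<in> fraction type_ring obstructed_set 0 1"
      using Q.fraction_self[of 1 1] Q.S_one by simp
    then have "((0 :: 'a, 1), (1, 1)) \<in> fraction_rel type_ring obstructed_set"
      by (simp add: fraction_def)
    then obtain u :: 'a where "u \<in> obstructed_set" "u * (1 * 0) = u * (1 * 1)"
      by (rule Q.fraction_relE) auto
    then show False using obstructed_set(2) by auto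
  qed
  then show "OFCLASS('a obstructed_local, comm_ring_1_class)"
    by intro_classes
       (simp_all add: defs L.m_assoc L.a_assoc L.m_comm L.a_comm L.l_distr L.l_neg L.r_neg L.r_distr L.m_ac L.a_ac)
qed

end

definition to_fraction :: "'a :: comm_ring_1 \<Rightarrow> 'a obstructed_local" where
  "to_fraction a = Abs_obstructed_local (fraction type_ring obstructed_set a 1)"

lemma fraction_hom_to_fraction:
  "fraction_hom to_fraction (obstructed_set :: 'a :: comm_ring_1 set)"
proof -
  interpret Q: cring_fractions "type_ring :: 'a ring" obstructed_set by (rule obstructed_fractions)
  note S = Q.S_one[simplified] Q.S_mult[simplified]
  have F: "fraction type_ring obstructed_set a s \<in> carrier (obstructed_localization :: ('a \<times> 'a) set ring)"
    if "s \<in> obstructed_set" for a s :: 'a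
    using that by (simp add: Q.fraction_in_carrier)
  have Rep: "Rep_obstructed_local (to_fraction a) = fraction type_ring obstructed_set a 1" for a :: 'a
    using F[OF S(1)] by (simp add: to_fraction_def Abs_obstructed_local_inverse)
  show ?thesis
  proof (rule fraction_hom.intro)
    show "comm_ring_hom (to_fraction :: 'a \<Rightarrow> 'a obstructed_local)"
    proof
      fix a b :: 'a
      show "to_fraction (a + b) = to_fraction a + to_fraction b"
        unfolding plus_obstructed_local_def Rep using S by (simp add: Q.localization_add to_fraction_def add.commute)
      show "to_fraction (a * b) = to_fraction a * to_fraction b"
        unfolding times_obstructed_local_def Rep using S by (simp add: Q.localization_mult to_fraction_def)
      show "to_fraction (0 :: 'a) = 0" "to_fraction (1 :: 'a) = 1"
        by (simp_all add: to_fraction_def zero_obstructed_local_def one_obstructed_local_def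
            Q.localization_zero Q.localization_one)
    qed
    show "(1 :: 'a) \<in> obstructed_set" by (rule S(1))
    show "s * t \<in> obstructed_set" if "s \<in> obstructed_set" "t \<in> obstructed_set" for s t :: 'a
      using S(2) that .
    show "\<exists>s\<in>obstructed_set. \<exists>a. to_fraction s * b = to_fraction a" for b :: "'a obstructed_local"
    proof -
      obtain a s where a: "s \<in> obstructed_set" "Rep_obstructed_local b = fraction type_ring obstructed_set a s"
        using Q.localizationE[OF Rep_obstructed_local[of b]] by metis
      have "fraction type_ring obstructed_set (s * a) s = fraction type_ring obstructed_set a 1"
        using a(1) S by (intro Q.fraction_eqI[of _ _ _ _ 1]) simp_all
      then have "to_fraction s * b = to_fraction a"
        unfolding times_obstructed_local_def Rep a(2) using S a(1) by (simp add: Q.localization_mult to_fraction_def)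
      then show ?thesis using a(1) by blast
    qed
    show "\<exists>s\<in>obstructed_set. s * a = 0" if "to_fraction a = 0" for a :: 'a
    proof -
      have "Rep_obstructed_local (to_fraction a) = Rep_obstructed_local (to_fraction (0 :: 'a))"
        using that by (simp add: to_fraction_def zero_obstructed_local_def Q.localization_zero)
      then have "(a, 1) \<in> fraction type_ring obstructed_set 0 1"
        unfolding Rep using Q.fraction_self[of a 1] S(1) by simp
      then have "((0, 1), (a, 1)) \<in> fraction_rel type_ring obstructed_set"
        by (simp add: fraction_def)
      then obtain u where "u \<in> obstructed_set" "u * (1 * 0) = u * (1 * a)"
        by (rule Q.fraction_relE) auto
      then show ?thesis by auto
    qed
  qed
qed

lemma not_obstructed: "\<not> obstructed (S :: 'a :: comm_ring_1 set)"
proof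
  assume "obstructed S"
  then have "obstructed (obstructed_set :: 'a set)"
    unfolding obstructed_set_def using someI[of obstructed S] by auto
  then obtain n and \<sigma> :: "'a poly mat" where val: "valuation_ring (obstructed_localization :: ('a \<times> 'a) set ring)"
    and n: "n \<ge> 3" and \<sigma>: "\<sigma> \<in> carrier_mat n n" "det \<sigma> = 1"
    and disj: "obstructed_set \<inter> translation_set n \<sigma> = {}"
    unfolding obstructed_def by blast
  interpret valuation_type "TYPE('a obstructed_local)"
  proof
    have dvd: "x dvd y" if xy: "Rep_obstructed_local x divides\<^bsub>obstructed_localization\<^esub> Rep_obstructed_local y" for x y :: "'a obstructed_local"
    proof -
      obtain c where c: "c \<in> carrier (obstructed_localization :: ('a \<times> 'a) set ring)"
        "Rep_obstructed_local y = Rep_obstructed_local x \<otimes>\<^bsub>obstructed_localization\<^esub> c"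
        using xy unfolding factor_def by blast
      then have "y = x * Abs_obstructed_local c"
        by (simp add: times_obstructed_local_def Abs_obstructed_local_inverse Rep_obstructed_local_inverse flip: c(2))
      then show ?thesis by (rule dvdI)
    qed
    show "x dvd y \<or> y dvd x" for x y :: "'a obstructed_local"
      using valuation_ring.divides_total[OF val Rep_obstructed_local[of x] Rep_obstructed_local[of y]] dvd by blast
  qed
  interpret F: fraction_hom to_fraction "obstructed_set :: 'a set" by (rule fraction_hom_to_fraction)
  interpret P: comm_ring_hom "map_poly (to_fraction :: 'a \<Rightarrow> _)" by (rule comm_ring_hom_map_poly[OF F.hom])
  have "map_mat (map_poly to_fraction) \<sigma> \<in> elementary_group n"
    using \<sigma> P.hom_det[of \<sigma>] by (intro SL_valuation_type[OF n]) simp_all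
  from F.translation_set_meets[OF n \<sigma>(1) this] show False using disj by blast
qed

section \<open>Arithmetical rings\<close>

text \<open>Zorn's lemma, for the ideals that contain \<open>J\<close> but not 1.\<close>

lemma exists_maximalideal:
  fixes J :: "'a :: comm_ring_1 set"
  assumes J: "0 \<in> J" "\<And>s t. s \<in> J \<Longrightarrow> t \<in> J \<Longrightarrow> s + t \<in> J" "\<And>r s. s \<in> J \<Longrightarrow> r * s \<in> J" "1 \<notin> J"
  obtains m where "maximalideal m (type_ring :: 'a ring)" "J \<subseteq> m"
proof -
  define I where "I = {m :: 'a set. 0 \<in> m \<and> (\<forall>s\<in>m. \<forall>t\<in>m. s + t \<in> m) \<and> (\<forall>r. \<forall>s\<in>m. r * s \<in> m) \<and> 1 \<notin> m \<and> J \<subseteq> m}"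
  have I: "0 \<in> A" "\<And>s t. s \<in> A \<Longrightarrow> t \<in> A \<Longrightarrow> s + t \<in> A" "\<And>r s. s \<in> A \<Longrightarrow> r * s \<in> A" "1 \<notin> A" "J \<subseteq> A"
    if "A \<in> I" for A
    using that by (simp_all add: I_def)
  have "\<exists>m\<in>I. \<forall>K\<in>I. m \<subseteq> K \<longrightarrow> K = m"
  proof (rule subset_Zorn_nonempty)
    have "J \<in> I" using J by (simp add: I_def)
    then show "I \<noteq> {}" by blast
    fix C assume C: "C \<noteq> {}" "subset.chain I C"
    have CI: "\<And>A. A \<in> C \<Longrightarrow> A \<in> I" and chain: "\<And>A B. A \<in> C \<Longrightarrow> B \<in> C \<Longrightarrow> A \<subseteq> B \<or> B \<subseteq> A"
      using C(2) by (auto simp: subset_chain_def)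
    obtain A where A: "A \<in> C" using C(1) by blast
    have "s + t \<in> \<Union>C" if st: "s \<in> \<Union>C" "t \<in> \<Union>C" for s t
    proof -
      obtain A B where AB: "A \<in> C" "B \<in> C" "s \<in> A" "t \<in> B" using st by (elim UnionE)
      have "s + t \<in> A \<or> s + t \<in> B"
        using chain[OF AB(1,2)] AB(3,4) I(2)[OF CI[OF AB(1)]] I(2)[OF CI[OF AB(2)]] by blast
      then show ?thesis using AB(1,2) by blast
    qed
    moreover have "0 \<in> \<Union>C" "J \<subseteq> \<Union>C" using A I(1,5)[OF CI[OF A]] by blast+
    moreover have "r * s \<in> \<Union>C" if "s \<in> \<Union>C" for r s using that I(3)[OF CI] by blast
    moreover have "1 \<notin> \<Union>C" using I(4)[OF CI] by blast
    ultimately show "\<Union>C \<in> I" unfolding I_def by simp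
  qed
  then obtain m where m: "m \<in> I" "\<And>K. K \<in> I \<Longrightarrow> m \<subseteq> K \<Longrightarrow> K = m" by blast
  interpret R: cring "type_ring :: 'a ring" by (rule cring_type_ring)
  have "maximalideal m (type_ring :: 'a ring)"
  proof (rule maximalidealI)
    show "ideal m (type_ring :: 'a ring)"
    proof (rule idealI)
      show "subgroup m (add_monoid (type_ring :: 'a ring))"
      proof (rule R.add.subgroupI)
        show "m \<noteq> {}" using m(1) unfolding I_def by blast
        show "\<ominus>\<^bsub>type_ring\<^esub> a \<in> m" if "a \<in> m" for a
        proof -
          have "\<ominus>\<^bsub>type_ring\<^esub> a = - a" by (rule R.minus_equality) simp_all
          moreover have "(- 1) * a \<in> m" using m(1) that unfolding I_def by blast
          ultimately show ?thesis by simp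
        qed
      qed (use m(1) in \<open>auto simp: I_def\<close>)
      fix a x assume "a \<in> m"
      then show "x \<otimes>\<^bsub>type_ring\<^esub> a \<in> m" "a \<otimes>\<^bsub>type_ring\<^esub> x \<in> m"
        using I(3)[OF m(1), of a x] by (simp_all add: mult.commute)
    qed (rule R.ring_axioms)
    show "carrier (type_ring :: 'a ring) \<noteq> m" using m(1) unfolding I_def by auto
    fix K assume K: "ideal K (type_ring :: 'a ring)" "m \<subseteq> K" "K \<subseteq> carrier type_ring"
    interpret K: ideal K "type_ring :: 'a ring" by (rule K(1))
    show "K = m \<or> K = carrier type_ring"
    proof (cases "1 \<in> K")
      case True
      then have "r \<in> K" for r using K.I_l_closed[of 1 r] by simp
      then show ?thesis by auto
    next
      case False
      have "K \<in> I"
        unfolding I_def using False K(2) m(1) K.I_l_closed K.a_closed K.zero_closed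
        by (auto simp: I_def)
      then show ?thesis using m(2) K(2) by blast
    qed
  qed
  then show ?thesis using that m(1) unfolding I_def by blast
qed

theorem theorem4p5:
  fixes n :: nat and \<sigma> :: "'a :: comm_ring_1 poly mat"
  assumes "arithmetical_ring (ring_of_type_algebra :: 'a ring)"
    and "n \<ge> 3"
    and "\<sigma> \<in> carrier (SL n)"
  shows "\<exists>E \<in> elementary_group n. \<sigma> * E = const_mat (eval0_mat \<sigma>)"
proof -
  interpret R: arithmetical_ring "type_ring :: 'a ring" by (rule assms(1))
  have \<sigma>: "\<sigma> \<in> carrier_mat n n" "det \<sigma> = 1" using assms(3) by (simp_all add: SL_def)
  let ?J = "translation_set n \<sigma>"
  have "1 \<in> ?J"
  proof (rule ccontr)
    assume "1 \<notin> ?J"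
    then obtain m where m: "maximalideal m (type_ring :: 'a ring)" "?J \<subseteq> m"
      using exists_maximalideal[of ?J] translation_set_ideal[OF \<sigma>(1)] by metis
    interpret m: primeideal m "type_ring :: 'a ring" by (rule R.maximalideal_prime[OF m(1)])
    have "1 \<notin> m" using m.I_notcarr m.one_imp_carrier by auto
    then have "submonoid (UNIV - m) (type_ring :: 'a ring)"
      using m.I_prime by unfold_locales auto
    moreover have "0 \<in> m" using m.zero_closed by simp
    ultimately have "obstructed (UNIV - m)"
      unfolding obstructed_def using R.valuation_ring_localization[OF m(1)] \<sigma> assms(2) m(2) by auto
    then show False by (simp add: not_obstructed)
  qed
  then obtain \<epsilon> where \<epsilon>: "\<epsilon> \<in> elementary_group n"
    "map_mat (\<lambda>p. pcompose p (0 + [:1:] * [:0, 1:])) \<sigma> = map_mat (\<lambda>p. pcompose p 0) \<sigma> * \<epsilon>"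
    unfolding translation_set_def by blast
  obtain E where E: "E \<in> elementary_group n" "\<epsilon> * E = 1\<^sub>m n"
    using \<epsilon>(1) by (rule elementary_group_inverse)
  have "map_mat (\<lambda>p. pcompose p (0 + [:1:] * [:0, 1:])) \<sigma> = \<sigma>"
    by (rule eq_matI) (simp_all add: pcompose_idR)
  moreover have "map_mat (\<lambda>p. pcompose p 0) \<sigma> = const_mat (eval0_mat \<sigma>)"
    by (rule eq_matI) (simp_all add: const_mat_def eval0_mat_def pcompose_0' poly_0_coeff_0)
  ultimately have eq: "\<sigma> = const_mat (eval0_mat \<sigma>) * \<epsilon>" using \<epsilon>(2) by simp
  have c: "const_mat (eval0_mat \<sigma>) \<in> carrier_mat n n" using \<sigma> by (simp add: const_mat_def eval0_mat_def)
  have "\<sigma> * E = const_mat (eval0_mat \<sigma>) * (\<epsilon> * E)"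
    by (subst eq) (rule assoc_mult_mat[OF c elementary_group_carrier[OF \<epsilon>(1)] elementary_group_carrier[OF E(1)]])
  then have "\<sigma> * E = const_mat (eval0_mat \<sigma>)" using E(2) right_mult_one_mat[OF c] by simp
  then show ?thesis using E(1) by blast
qed

end
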